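(* Let $D\ge1$ and $k\ge1$ be integers, and let $\mathbf{G}_1$ and $\mathbf{G}_2$ be locally equivalent graphings (with all degrees at most $D$). Then $\mathrm{sep}_k^*(\mathbf{G}_1)=\mathrm{sep}_k^*(\mathbf{G}_2)$.
   Context: A graphing is a Borel graph $\mathbf{G}=(I,\mathcal{A},\lambda,E)$ on a standard probability space $(I,\mathcal{A},\lambda)$, with symmetric Borel edge set $E\subseteq I\times I$ and all degrees at most $D$, satisfying $\int_A\deg_B(x)\,d\lambda(x)=\int_B\deg_A(x)\,d\lambda(x)$ for all Borel $A,B\subseteq I$, where $\deg_B(x)$ is the number of edges from $x$ to points of $B$. For $x\in I$ and an integer $r\ge0$, $B_{\mathbf{G}}(x,r)$ is the subgraph induced by the nodes at graph distance at most $r$ from $x$, considered as a rooted graph with root $x$; $\rho_{\mathbf{G},r}$ is the distribution of the isomorphism class of $B_{\mathbf{G}}(x,r)$ for $x$ chosen according to $\lambda$. Two graphings $\mathbf{G}_1,\mathbf{G}_2$ are locally equivalent if $\rho_{\mathbf{G}_1,r}=\rho_{\mathbf{G}_2,r}$ for every $r\ge0$. Let $\mathcal{R}_k=\mathcal{R}_k(\mathbf{G})$ be the set of subsets of $I$ with between $1$ and $k$ elements inducing a connected subgraph of $\mathbf{G}$, regarded (via listing elements) as a Borel subset of $I\cup I^2\cup\dots\cup I^k$. For a finite measure $\tau$ on $\mathcal{R}_k$, its marginal is the measure $\tau'(X)=\int_{\mathcal{R}_k}\frac{|X\cap Y|}{|Y|}\,d\tau(Y)$ on Borel $X\subseteq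 I$. A fractional $\mathcal{R}_k$-partition is a probability measure $\tau$ on $\mathcal{R}_k$ with $\tau'=\lambda$. For finite $Y\subseteq I$ let $\partial Y$ be the set of edges from $Y$ to $I\setminus Y$ and $h(Y)=|\partial Y|/|Y|$. Define $\mathrm{sep}_k^*(\mathbf{G})=\frac12\inf_\tau\int_{\mathcal{R}_k}h(Y)\,d\tau(Y)$, the infimum over all fractional $\mathcal{R}_k$-partitions $\tau$. *)

theory Defs
  imports "HOL-Probability.Probability"
begin

definition standard_borel :: "'a measure \<Rightarrow> bool" where
  "standard_borel M \<longleftrightarrow>
     (\<exists>T. completely_metrizable_space T \<and> second_countable T \<and> topspace T = space M \<and>
          sets M = sigma_sets (topspace T) {U. openin T U})"

definition deg :: "'a rel \<Rightarrow> 'a set \<Rightarrow> 'a \<Rightarrow> nat" where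
  "deg E B x = card {y \<in> B. (x, y) \<in> E}"

text \<open>Vertex set \<open>space M\<close>, Borel sets \<open>sets M\<close>, node distribution \<open>M\<close>, edge set \<open>E\<close>. Edges are
  ordered pairs; an undirected edge is present in both orientations. The degree bound needs an
  explicit finiteness clause because \<open>card\<close> of an infinite set is 0.\<close>

locale graphing = prob_space M for D :: nat and M :: "'a measure" and E :: "'a rel" +
  assumes standard: "standard_borel M"
    and edges_borel: "E \<in> sets (M \<Otimes>\<^sub>M M)"
    and edges_sym: "sym E"
    and degree_bound: "\<And>x. x \<in> space M \<Longrightarrow>
      finite {y \<in> space M. (x, y) \<in> E} \<and> deg E (space M) x \<le> D"
    and mass_transport: "\<And>A B. A \<in> sets M \<Longrightarrow> B \<in> sets M \<Longrightarrow>
      (\<integral>\<^sup>+x\<in>A. of_nat (deg E B x) \<partial>M) = (\<integral>\<^sup>+x\<in>B. of_nat (deg E A x) \<partial>M)"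

type_synonym 'v rooted_graph = "'v set \<times> 'v rel \<times> 'v"

fun rooted_iso :: "'v rooted_graph \<Rightarrow> 'w rooted_graph \<Rightarrow> bool" where
  "rooted_iso (V, E, x) (W, F, y) \<longleftrightarrow>
     (\<exists>f. bij_betw f V W \<and> map_prod f f ` E = F \<and> f x = y)"

text \<open>Isomorphism classes of finite rooted graphs are represented inside the graphs with vertices
  in \<open>nat\<close>, so that graphs on different vertex types can be compared.\<close>

definition iso_class :: "'v rooted_graph \<Rightarrow> nat rooted_graph set" where
  "iso_class G = {H. rooted_iso G H}"

definition ball_nodes :: "'a rel \<Rightarrow> 'a \<Rightarrow> nat \<Rightarrow> 'a set" where
  "ball_nodes E x r = {y. \<exists>n\<le>r. (x, y) \<in> E ^^ n}"

definition rooted_ball :: "'a rel \<Rightarrow> 'a \<Rightarrow> nat \<Rightarrow> 'a rooted_graph" where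
  "rooted_ball E x r = (ball_nodes E x r, E \<inter> ball_nodes E x r \<times> ball_nodes E x r, x)"

definition ball_distr :: "'a measure \<Rightarrow> 'a rel \<Rightarrow> nat \<Rightarrow> nat rooted_graph set measure" where
  "ball_distr M E r = distr M (count_space UNIV) (\<lambda>x. iso_class (rooted_ball E x r))"

definition locally_equivalent ::
    "'a measure \<Rightarrow> 'a rel \<Rightarrow> 'b measure \<Rightarrow> 'b rel \<Rightarrow> bool" where
  "locally_equivalent M1 E1 M2 E2 \<longleftrightarrow> (\<forall>r. ball_distr M1 E1 r = ball_distr M2 E2 r)"

definition induces_connected :: "'a rel \<Rightarrow> 'a set \<Rightarrow> bool" where
  "induces_connected E Y \<longleftrightarrow> (\<forall>x\<in>Y. \<forall>y\<in>Y. (x, y) \<in> (E \<inter> Y \<times> Y)\<^sup>*)"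

definition conn_sets :: "'a measure \<Rightarrow> 'a rel \<Rightarrow> nat \<Rightarrow> 'a set set" where
  "conn_sets M E k =
     {Y. Y \<subseteq> space M \<and> finite Y \<and> 1 \<le> card Y \<and> card Y \<le> k \<and> induces_connected E Y}"

text \<open>The Borel structure on \<open>conn_sets M E k\<close>: a family of sets is Borel iff, for every
  \<open>n \<le> k\<close>, the injective listings of its \<open>n\<close>-element members form a Borel subset of the \<open>n\<close>-th
  power of the vertex space. All listings of a set are included, so no Borel linear order on the
  vertices has to be chosen.\<close>

definition listings :: "'a set set \<Rightarrow> nat \<Rightarrow> (nat \<Rightarrow> 'a) set" where
  "listings S n = {v. v \<in> extensional {..<n} \<and> (\<exists>Y\<in>S. bij_betw v {..<n} Y)}"

definition conn_space :: "'a measure \<Rightarrow> 'a rel \<Rightarrow> nat \<Rightarrow> 'a set measure" where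
  "conn_space M E k = sigma (conn_sets M E k)
     {S. S \<subseteq> conn_sets M E k \<and>
         (\<forall>n\<in>{1..k}. listings S n \<in> sets (\<Pi>\<^sub>M i\<in>{..<n}. M))}"

definition marginal :: "'a set measure \<Rightarrow> 'a set \<Rightarrow> ennreal" where
  "marginal \<tau> X = (\<integral>\<^sup>+Y. ennreal (real (card (X \<inter> Y)) / real (card Y)) \<partial>\<tau>)"

definition fractional_partition :: "'a measure \<Rightarrow> 'a rel \<Rightarrow> nat \<Rightarrow> 'a set measure \<Rightarrow> bool" where
  "fractional_partition M E k \<tau> \<longleftrightarrow>
     prob_space \<tau> \<and> sets \<tau> = sets (conn_space M E k) \<and>
     (\<forall>X\<in>sets M. marginal \<tau> X = emeasure M X)"

definition edge_boundary :: "'a measure \<Rightarrow> 'a rel \<Rightarrow> 'a set \<Rightarrow> 'a rel" where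
  "edge_boundary M E Y = E \<inter> Y \<times> (space M - Y)"

definition expansion :: "'a measure \<Rightarrow> 'a rel \<Rightarrow> 'a set \<Rightarrow> real" where
  "expansion M E Y = real (card (edge_boundary M E Y)) / real (card Y)"

definition sep_star :: "nat \<Rightarrow> 'a measure \<Rightarrow> 'a rel \<Rightarrow> real" where
  "sep_star k M E =
     1 / 2 * (INF \<tau>\<in>{\<tau>. fractional_partition M E k \<tau>}. \<integral>Y. expansion M E Y \<partial>\<tau>)"

end

theory Submission
  imports Defs
begin

text \<open>Let \<open>\<kappa>\<close> be the measure on connected sets under which a family has mass equal to the expected
  number of its members at a random node. Every fractional partition \<open>\<tau>\<close> is dominated by \<open>\<kappa>\<close>;
  averaging its density over all connected sets with isomorphic \<open>q\<close>-neighborhoods gives weights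
  \<open>w\<^sub>q \<in> [0, 1]\<close> which depend only on the local structure and have the same expected expansion as
  \<open>\<tau>\<close>. The \<open>w\<^sub>q\<close> form an \<open>L\<^sup>2\<close>-bounded martingale, and mass transport shows that the weights of the sets
  at a node sum to a function that tends to \<open>1\<close> in mean square. Since these weights are local, they
  can be evaluated in a locally equivalent graphing, where an approximate fractional partition with
  the same cost results; scaling it down slightly and adding singletons makes it exact.

  The iso class of a ball is a Borel function of its root only because Borel sets with finite
  sections have Borel projections. This is proved by coding the nodes by sequences of
  numbers.\<close>

section \<open>Borel projections along finite sections\<close>

text \<open>The density of \<open>\<tau>\<close> is no local function, so only its averages over
  types can be moved to another graphing, and averaging breaks the marginal condition. What survives
  is weak: the weights of radius \<open>r\<close> have the right marginal when tested against
  functions of the \<open>p\<close>-ball of a node with \<open>p \<le> r\<close>. But the node sum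
  \<open>s q\<close> of the weights of radius \<open>q\<close> depends on the ball of radius
  \<open>k * k + q\<close>, where \<open>k * k\<close> bounds how far a connected set reaches from
  its nodes. So \<open>s q\<close> is tested against \<open>s r\<close> with
  \<open>r = k * k + q\<close>: the integral of \<open>(s q - 1)\<^sup>2\<close> equals that of
  \<open>s q * (s q - s r)\<close>, which is small because increasing bounded L2 norms force the
  weights of radius \<open>q\<close> and \<open>r\<close> together. In \<open>kappa\<close> a set
  counts once for each of its nodes; this is the normalization in which a density with node sums 1
  has the node measure as its marginal. The measurability obstacle is that having an edge into a
  Borel set is a projection statement. Measurable neighbor functions turn it into finitely many
  equations.\<close>

abbreviation baire :: "(nat \<Rightarrow> nat) measure" where
  "baire \<equiv> PiM UNIV (\<lambda>_. count_space UNIV)"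

section \<open>Borel sets of the Baire space as injective projections of closed relations\<close>

definition agree :: "nat \<Rightarrow> (nat \<Rightarrow> nat) \<Rightarrow> (nat \<Rightarrow> nat) \<Rightarrow> bool" where
  "agree n x y \<longleftrightarrow> (\<forall>i<n. x i = y i)"

definition closed_rel :: "((nat \<Rightarrow> nat) \<Rightarrow> (nat \<Rightarrow> nat) \<Rightarrow> bool) \<Rightarrow> bool" where
  "closed_rel F \<longleftrightarrow>
     (\<forall>z a. (\<forall>n. \<exists>z' a'. agree n z z' \<and> agree n a a' \<and> F z' a') \<longrightarrow> F z a)"

text \<open>The classical representation of a Borel set as an injective continuous image of a closed
  set. Uniqueness of the witness keeps the sections small when \<open>projection_borel\<close>
  replaces a Borel relation by a closed one.\<close>

definition unique_closed_witness :: "(nat \<Rightarrow> nat) set \<Rightarrow> bool" where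
  "unique_closed_witness A \<longleftrightarrow>
     (\<exists>F. closed_rel F \<and> (\<forall>z. z \<in> A \<longleftrightarrow> (\<exists>a. F z a)) \<and> (\<forall>z a b. F z a \<longrightarrow> F z b \<longrightarrow> a = b))"

lemma closed_relI:
  assumes "\<And>z a. (\<And>n. \<exists>z' a'. agree n z z' \<and> agree n a a' \<and> F z' a') \<Longrightarrow> F z a"
  shows "closed_rel F"
  using assms unfolding closed_rel_def by blast

lemma closed_relD:
  assumes "closed_rel F" "\<And>n. \<exists>z' a'. agree n z z' \<and> agree n a a' \<and> F z' a'"
  shows "F z a"
  using assms unfolding closed_rel_def by blast

lemma unique_closed_witness_coordinate: "unique_closed_witness {z. P (z i)}"
proof -
  have "closed_rel (\<lambda>z a. P (z i) \<and> a = (\<lambda>_. 0))"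
  proof (rule closed_relI)
    fix z a assume *: "\<And>n. \<exists>z' a'. agree n z z' \<and> agree n a a' \<and> P (z' i) \<and> a' = (\<lambda>_. 0)"
    have "a j = 0" for j using *[of "Suc j"] by (auto simp: agree_def)
    moreover have "P (z i)" using *[of "Suc i"] by (auto simp: agree_def)
    ultimately show "P (z i) \<and> a = (\<lambda>_. 0)" by auto
  qed
  then show ?thesis unfolding unique_closed_witness_def
    by (intro exI[of _ "\<lambda>z a. P (z i) \<and> a = (\<lambda>_. 0)"]) auto
qed

text \<open>One sequence carries witnesses for all \<open>A n\<close> at once, the
  \<open>n\<close>-th along the positions \<open>prod_encode (n, i)\<close>. These positions exhaust
  the natural numbers, so uniqueness is inherited.\<close>

lemma unique_closed_witness_INT:
  assumes "\<And>n::nat. unique_closed_witness (A n)"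
  shows "unique_closed_witness (\<Inter>n. A n)"
proof -
  obtain F where F: "\<And>n. closed_rel (F n)" "\<And>n z. z \<in> A n \<longleftrightarrow> (\<exists>a. F n z a)"
    "\<And>n z a b. F n z a \<Longrightarrow> F n z b \<Longrightarrow> a = b"
    using assms unfolding unique_closed_witness_def by metis
  define G where "G z a \<longleftrightarrow> (\<forall>n. F n z (\<lambda>i. a (prod_encode (n, i))))" for z a
  have "closed_rel G"
  proof (rule closed_relI)
    fix z a assume *: "\<And>N. \<exists>z' a'. agree N z z' \<and> agree N a a' \<and> G z' a'"
    show "G z a" unfolding G_def
    proof
      fix n
      show "F n z (\<lambda>i. a (prod_encode (n, i)))"
      proof (rule closed_relD[OF F(1)])
        fix N
        \<comment> \<open>At least \<open>N\<close>, and beyond every position that holds one of the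
          first \<open>N\<close> entries of the \<open>n\<close>-th witness.\<close>
        define K where "K = N + (\<Sum>i<N. Suc (prod_encode (n, i)))"
        have K: "prod_encode (n, i) < K" if "i < N" for i
          using member_le_sum[of i "{..<N}" "\<lambda>i. Suc (prod_encode (n, i))"] that
          unfolding K_def by auto
        obtain z' a' where z': "agree K z z'" "agree K a a'" "G z' a'" using * by blast
        have "agree N z z'" using z'(1) by (auto simp: agree_def K_def)
        moreover have "agree N (\<lambda>i. a (prod_encode (n, i))) (\<lambda>i. a' (prod_encode (n, i)))"
          using z'(2) K by (auto simp: agree_def)
        ultimately show "\<exists>z' b. agree N z z' \<and> agree N (\<lambda>i. a (prod_encode (n, i))) b \<and> F n z' b"
          using z'(3) unfolding G_def by blast
      qed
    qed
  qed
  moreover have "z \<in> (\<Inter>n. A n) \<longleftrightarrow> (\<exists>a. G z a)" for z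
  proof
    assume "z \<in> (\<Inter>n. A n)"
    then have "\<forall>n. \<exists>a. F n z a" using F(2) by auto
    then obtain b where b: "\<And>n. F n z (b n)" by metis
    have "G z (\<lambda>j. b (fst (prod_decode j)) (snd (prod_decode j)))"
      unfolding G_def using b by simp
    then show "\<exists>a. G z a" by blast
  qed (auto simp: G_def F(2))
  moreover have "a = b" if "G z a" "G z b" for z a b
  proof
    fix j
    obtain n i where j: "j = prod_encode (n, i)" by (metis prod_decode_inverse surj_pair)
    have "(\<lambda>i. a (prod_encode (n, i))) = (\<lambda>i. b (prod_encode (n, i)))"
      using that F(3)[of n z] unfolding G_def by blast
    then show "a j = b j" unfolding j by meson
  qed
  ultimately show ?thesis unfolding unique_closed_witness_def by blast
qed

text \<open>Entry 0 of a witness names the member of the family that contains the point, and the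
  remaining entries are a witness for that member. Disjointness makes entry 0 unique.\<close>

lemma unique_closed_witness_disjoint_UN:
  assumes "\<And>n::nat. unique_closed_witness (A n)" "disjoint_family A"
  shows "unique_closed_witness (\<Union>n. A n)"
proof -
  obtain F where F: "\<And>n. closed_rel (F n)" "\<And>n z. z \<in> A n \<longleftrightarrow> (\<exists>a. F n z a)"
    "\<And>n z a b. F n z a \<Longrightarrow> F n z b \<Longrightarrow> a = b"
    using assms(1) unfolding unique_closed_witness_def by metis
  define G where "G z a \<longleftrightarrow> F (a 0) z (\<lambda>i. a (Suc i))" for z a
  have "closed_rel G"
  proof (rule closed_relI)
    fix z a assume *: "\<And>N. \<exists>z' a'. agree N z z' \<and> agree N a a' \<and> G z' a'"
    show "G z a" unfolding G_def
    proof (rule closed_relD[OF F(1)])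
      fix N
      obtain z' a' where z': "agree (Suc N) z z'" "agree (Suc N) a a'" "G z' a'" using * by blast
      have "a' 0 = a 0" "agree N z z'" "agree N (\<lambda>i. a (Suc i)) (\<lambda>i. a' (Suc i))"
        using z'(1,2) by (auto simp: agree_def)
      then show "\<exists>z' b. agree N z z' \<and> agree N (\<lambda>i. a (Suc i)) b \<and> F (a 0) z' b"
        using z'(3) unfolding G_def by metis
    qed
  qed
  moreover have "z \<in> (\<Union>n. A n) \<longleftrightarrow> (\<exists>a. G z a)" for z
  proof
    assume "z \<in> (\<Union>n. A n)"
    then obtain n b where "F n z b" using F(2) by auto
    then have "G z (\<lambda>j. case j of 0 \<Rightarrow> n | Suc i \<Rightarrow> b i)" unfolding G_def by simp
    then show "\<exists>a. G z a" by blast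
  qed (auto simp: G_def F(2))
  moreover have "a = b" if "G z a" "G z b" for z a b
  proof
    have "z \<in> A (a 0)" "z \<in> A (b 0)" using that F(2) unfolding G_def by auto
    then have 0: "a 0 = b 0" using assms(2) unfolding disjoint_family_on_def by blast
    then have "(\<lambda>i. a (Suc i)) = (\<lambda>i. b (Suc i))" using that F(3)[of "a 0" z] unfolding G_def by metis
    then show "a j = b j" for j using 0 by (cases j) (auto dest: fun_cong)
  qed
  ultimately show ?thesis unfolding unique_closed_witness_def by blast
qed

lemma unique_closed_witness_Int:
  assumes "unique_closed_witness A" "unique_closed_witness B"
  shows "unique_closed_witness (A \<inter> B)"
proof -
  have "A \<inter> B = (\<Inter>n::nat. if n = 0 then A else B)" by (auto split: if_splits)
  then show ?thesis using unique_closed_witness_INT[of "\<lambda>n. if n = 0 then A else B"] assms by auto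
qed

lemma space_baire: "space baire = UNIV"
  by (simp add: space_PiM)

text \<open>The induction carries the complement along: a union must be made disjoint first, and the
  pieces of \<open>disjointed\<close> involve complements.\<close>

lemma baire_unique_closed_witness:
  assumes "A \<in> sets baire"
  shows "unique_closed_witness A"
proof -
  have "A \<in> sigma_sets UNIV {{f. f i \<in> A} | (i::nat) (A::nat set). True}"
    using assms unfolding sets_PiM_single by (simp add: PiE_UNIV_domain Collect_conj_eq image_def)
  then have "unique_closed_witness A \<and> unique_closed_witness (- A)"
  proof induction
    case (Basic a)
    then obtain i B where "a = {f. f i \<in> B}" by auto
    moreover from this have "- a = {f. f i \<notin> B}" by auto
    ultimately show ?case using unique_closed_witness_coordinate[of "\<lambda>t. t \<in> B" i]
        unique_closed_witness_coordinate[of "\<lambda>t. t \<notin> B" i] by simp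
  next
    case Empty
    show ?case using unique_closed_witness_coordinate[of "\<lambda>_. False"]
        unique_closed_witness_coordinate[of "\<lambda>_. True"] by (simp add: Compl_eq_Diff_UNIV)
  next
    case (Compl a)
    then show ?case by (simp add: Compl_eq_Diff_UNIV[symmetric])
  next
    case (Union a)
    have fin: "unique_closed_witness (\<Inter>i<n. - a i)" for n
    proof (induction n)
      case 0
      show ?case using unique_closed_witness_coordinate[of "\<lambda>_. True"] by simp
    next
      case (Suc n)
      have "(\<Inter>i<Suc n. - a i) = - a n \<inter> (\<Inter>i<n. - a i)" by (auto simp: less_Suc_eq)
      then show ?case using Suc unique_closed_witness_Int Union by metis
    qed
    have "disjointed a n = a n \<inter> (\<Inter>i<n. - a i)" for n
      unfolding disjointed_def by auto
    then have "unique_closed_witness (disjointed a n)" for n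
      using fin Union unique_closed_witness_Int by metis
    then have "unique_closed_witness (\<Union>n. disjointed a n)"
      by (intro unique_closed_witness_disjoint_UN disjoint_family_disjointed)
    moreover have "- (\<Union>n. a n) = (\<Inter>n. - a n)" by auto
    ultimately show ?case using unique_closed_witness_INT[of "\<lambda>n. - a n"] Union
      by (metis UN_disjointed_eq)
  qed
  then show ?thesis by blast
qed

section \<open>Simultaneous Lusin separation of finitely many analytic sets\<close>

definition starts :: "nat list \<Rightarrow> (nat \<Rightarrow> nat) \<Rightarrow> bool" where
  "starts u x \<longleftrightarrow> (\<forall>i<length u. x i = u ! i)"

lemma starts_Nil [simp]: "starts [] x"
  by (simp add: starts_def)

lemma starts_snoc: "starts (u @ [a]) x \<longleftrightarrow> starts u x \<and> x (length u) = a"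
  by (auto simp: starts_def nth_append less_Suc_eq)

lemma starts_agree: "starts u x \<Longrightarrow> starts u y \<Longrightarrow> n \<le> length u \<Longrightarrow> agree n x y"
  by (simp add: starts_def agree_def)

lemma starts_measurable [measurable]: "{x. starts u x} \<in> sets baire"
proof -
  have "{x \<in> space baire. \<forall>i<length u. x i = u ! i} \<in> sets baire" by measurable
  then show ?thesis by (simp add: starts_def space_baire)
qed

text \<open>Entry \<open>i\<close> of the limit of a growing chain of lists is already settled in
  \<open>L (Suc i)\<close>, so the limit is read off along the diagonal.\<close>

lemma starts_limit:
  assumes "\<And>n. \<exists>a. L (Suc n) = L n @ [a]" "\<And>n. n \<le> length (L n)"
  shows "starts (L n) (\<lambda>i. L (Suc i) ! i)"
proof -
  have mono: "p \<le> q \<Longrightarrow> i < length (L p) \<Longrightarrow> L q ! i = L p ! i \<and> length (L p) \<le> length (L q)" for p q i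
  proof (induction q rule: dec_induct)
    case (step q)
    obtain a where "L (Suc q) = L q @ [a]" using assms(1) by blast
    then show ?case using step by (simp add: nth_append)
  qed auto
  show ?thesis unfolding starts_def
  proof (intro allI impI)
    fix i assume i: "i < length (L n)"
    have "i < length (L (Suc i))" using assms(2)[of "Suc i"] by simp
    then show "L (Suc i) ! i = L n ! i"
      using mono[of n "Suc i" i] mono[of "Suc i" n i] i by (cases "n \<le> Suc i") auto
  qed
qed

definition cell :: "((nat \<Rightarrow> nat) \<Rightarrow> (nat \<Rightarrow> nat) \<Rightarrow> bool) \<Rightarrow> nat list \<Rightarrow> nat list \<Rightarrow> (nat \<Rightarrow> nat) set" where
  "cell F u s = {x. starts u x \<and> (\<exists>w. F x w \<and> starts s w)}"

text \<open>Lusin separation for \<open>m + 1\<close> analytic sets at once. Only the common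
  intersection of the Borel hulls is empty, not each pairwise one, because a section with at most
  \<open>m\<close> points rules out no more than a common point of \<open>m + 1\<close>
  cells.\<close>

definition separable :: "((nat \<Rightarrow> nat) \<Rightarrow> (nat \<Rightarrow> nat) \<Rightarrow> bool) \<Rightarrow> nat \<Rightarrow> nat list \<Rightarrow> (nat \<Rightarrow> nat list) \<Rightarrow> bool" where
  "separable F m u s \<longleftrightarrow>
     (\<exists>Q. (\<forall>i\<le>m. Q i \<in> sets baire \<and> cell F u (s i) \<subseteq> Q i) \<and> (\<Inter>i\<le>m. Q i) = {})"

lemma cell_snoc1: "x \<in> cell F u s \<Longrightarrow> x \<in> cell F (u @ [x (length u)]) s"
  by (auto simp: cell_def starts_snoc)

text \<open>The hulls belonging to different \<open>a\<close> are cut down to disjoint cylinders, so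
  their union over \<open>a\<close> still has empty common intersection.\<close>

lemma separable_split_base:
  assumes "\<And>a. separable F m (u @ [a]) s"
  shows "separable F m u s"
proof -
  have "\<forall>a. \<exists>Q. (\<forall>i\<le>m. Q i \<in> sets baire \<and> cell F (u @ [a]) (s i) \<subseteq> Q i) \<and> (\<Inter>i\<le>m. Q i) = {}"
    using assms unfolding separable_def by blast
  then obtain Q where Q: "\<And>a i. i \<le> m \<Longrightarrow> Q a i \<in> sets baire"
      "\<And>a i. i \<le> m \<Longrightarrow> cell F (u @ [a]) (s i) \<subseteq> Q a i" "\<And>a. (\<Inter>i\<le>m. Q a i) = {}"
    by metis
  define R where "R i = (\<Union>a. Q a i \<inter> {x. starts (u @ [a]) x})" for i
  have "cell F u (s i) \<subseteq> R i" if "i \<le> m" for i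
  proof
    fix x assume "x \<in> cell F u (s i)"
    then have x: "x \<in> cell F (u @ [x (length u)]) (s i)" by (rule cell_snoc1)
    moreover have "starts (u @ [x (length u)]) x" using x by (simp add: cell_def)
    ultimately show "x \<in> R i" using Q(2)[OF that] unfolding R_def by blast
  qed
  moreover have "R i \<in> sets baire" if "i \<le> m" for i
    unfolding R_def using Q(1)[OF that] by (intro sets.countable_UN sets.Int) (auto simp: starts_measurable)
  moreover have "(\<Inter>i\<le>m. R i) = {}"
  proof (rule equals0I)
    fix x
    assume *: "x \<in> (\<Inter>i\<le>m. R i)"
    have "x \<in> Q (x (length u)) i" if "i \<le> m" for i
      using * that by (auto simp: R_def starts_snoc)
    then show False using Q(3)[of "x (length u)"] by blast
  qed
  ultimately have "(\<forall>i\<le>m. R i \<in> sets baire \<and> cell F u (s i) \<subseteq> R i) \<and> (\<Inter>i\<le>m. R i) = {}"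
    by blast
  then show ?thesis unfolding separable_def by (rule exI[of _ R])
qed

text \<open>The \<open>l\<close>-th cell is the union of its refinements while the other cells do
  not change. So the union of the hulls serves for \<open>l\<close>, and the intersection of the
  hulls for the others.\<close>

lemma separable_split_branch:
  assumes l: "l \<le> m" and "\<And>j. separable F m u (s(l := s l @ [j]))"
  shows "separable F m u s"
proof -
  have "\<forall>j. \<exists>Q. (\<forall>i\<le>m. Q i \<in> sets baire \<and> cell F u ((s(l := s l @ [j])) i) \<subseteq> Q i) \<and> (\<Inter>i\<le>m. Q i) = {}"
    using assms(2) unfolding separable_def by blast
  then obtain Q where Q: "\<And>j i. i \<le> m \<Longrightarrow> Q j i \<in> sets baire"
      "\<And>j i. i \<le> m \<Longrightarrow> cell F u ((s(l := s l @ [j])) i) \<subseteq> Q j i" "\<And>j. (\<Inter>i\<le>m. Q j i) = {}"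
    by metis
  define R where "R i = (if i = l then (\<Union>j. Q j i) else (\<Inter>j. Q j i))" for i
  have "cell F u (s l) \<subseteq> R l"
  proof
    fix x assume "x \<in> cell F u (s l)"
    then obtain w where w: "starts u x" "F x w" "starts (s l) w" unfolding cell_def by blast
    then have "x \<in> cell F u (s l @ [w (length (s l))])" by (auto simp: cell_def starts_snoc)
    then show "x \<in> R l" using Q(2)[OF l, of "w (length (s l))"] unfolding R_def by auto
  qed
  moreover have "cell F u (s i) \<subseteq> R i" if "i \<le> m" "i \<noteq> l" for i
    using Q(2)[OF that(1)] that(2) unfolding R_def by auto
  moreover have "R i \<in> sets baire" if "i \<le> m" for i
    unfolding R_def using Q(1)[OF that] by auto
  moreover have "(\<Inter>i\<le>m. R i) = {}"
  proof (rule equals0I)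
    fix x
    assume *: "x \<in> (\<Inter>i\<le>m. R i)"
    then have "x \<in> R l" using l by blast
    then obtain j where "x \<in> Q j l" unfolding R_def by auto
    moreover have "x \<in> R i" if "i \<le> m" for i using * that by blast
    ultimately have "x \<in> Q j i" if "i \<le> m" for i
      using that unfolding R_def by (metis INT_iff UNIV_I)
    then show False using Q(3)[of j] by blast
  qed
  ultimately have "(\<forall>i\<le>m. R i \<in> sets baire \<and> cell F u (s i) \<subseteq> R i) \<and> (\<Inter>i\<le>m. R i) = {}"
    by metis
  then show ?thesis unfolding separable_def by (rule exI[of _ R])
qed

lemma not_separable_extend_branches:
  assumes "\<not> separable F m u s" "l \<le> Suc m"
  shows "\<exists>f. \<not> separable F m u (\<lambda>i. if i < l then s i @ [f i] else s i)"
  using assms(2)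
proof (induction l)
  case 0
  then show ?case using assms(1) by simp
next
  case (Suc l)
  then obtain f where f: "\<not> separable F m u (\<lambda>i. if i < l then s i @ [f i] else s i)" by auto
  let ?s = "\<lambda>i. if i < l then s i @ [f i] else s i"
  obtain j where j: "\<not> separable F m u (?s(l := ?s l @ [j]))"
    using separable_split_branch[of l m F u ?s] f Suc(2) by auto
  have "?s(l := ?s l @ [j]) = (\<lambda>i. if i < Suc l then s i @ [(f(l := j)) i] else s i)"
    by (auto simp: fun_eq_iff)
  then show ?case using j by metis
qed

lemma not_separable_extend:
  assumes "\<not> separable F m u s"
  shows "\<exists>a s'. \<not> separable F m (u @ [a]) s' \<and> (\<forall>i\<le>m. \<exists>j. s' i = s i @ [j])"
proof -
  obtain a where "\<not> separable F m (u @ [a]) s" using assms separable_split_base by blast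
  from not_separable_extend_branches[OF this, of "Suc m"]
  obtain f where "\<not> separable F m (u @ [a]) (\<lambda>i. if i < Suc m then s i @ [f i] else s i)" by auto
  then show ?thesis by (intro exI conjI) auto
qed

lemma not_separable_cell:
  assumes "\<not> separable F m u s" "i \<le> m"
  shows "cell F u (s i) \<noteq> {}"
proof
  assume e: "cell F u (s i) = {}"
  have "separable F m u s" unfolding separable_def
  proof (intro exI[of _ "\<lambda>j. if j = i then {} else UNIV"] conjI allI impI)
    fix j show "(if j = i then {} else UNIV) \<in> sets baire"
      using sets.top[of baire] by (simp add: space_baire)
  qed (use e assms(2) in \<open>auto split: if_splits\<close>)
  then show False using assms(1) by simp
qed

text \<open>By contraposition of the two splitting lemmas, an inseparable family can be refined
  forever, by one letter in the base and in every branch at each stage. The prefixes converge to one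
  point and \<open>m + 1\<close> sequences, and since no cell on the way is empty, closedness of
  \<open>F\<close> makes all these sequences witnesses of that point.\<close>

lemma not_separable_witnesses:
  assumes F: "closed_rel F" and ns: "\<not> separable F m [] s"
  shows "\<exists>x w. \<forall>i\<le>m. F x (w i) \<and> starts (s i) (w i)"
proof -
  \<comment> \<open>The clause for \<open>n = 0\<close> ties the chain to the given
    \<open>s\<close>. Indices above \<open>m\<close> stay unconstrained.\<close>
  define P where "P n = (\<lambda>(u, t). \<not> separable F m u t \<and> length u = n \<and>
      (\<forall>i\<le>m. length (t i) = length (s i) + n \<and> (n = 0 \<longrightarrow> t i = s i)))" for n
  define Q where "Q n = (\<lambda>(u :: nat list, t :: nat \<Rightarrow> nat list) (u', t'). (\<exists>a. u' = u @ [a]) \<and> (\<forall>i\<le>m. \<exists>j. t' i = t i @ [j]))" for n :: nat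
  have "\<exists>f. \<forall>n. P n (f n) \<and> Q n (f n) (f (Suc n))"
  proof (rule dependent_nat_choice)
    show "\<exists>x. P 0 x" using ns by (intro exI[of _ "([], s)"]) (simp add: P_def)
  next
    fix x :: "nat list \<times> (nat \<Rightarrow> nat list)" and n assume Px: "P n x"
    obtain u t where x: "x = (u, t)" by force
    obtain a t' where *: "\<not> separable F m (u @ [a]) t'" "\<forall>i\<le>m. \<exists>j. t' i = t i @ [j]"
      using not_separable_extend[of F m u t] Px x by (auto simp: P_def)
    have "length (t' i) = length (s i) + Suc n" if "i \<le> m" for i
    proof -
      have "\<exists>j. t' i = t i @ [j]" using *(2) that by blast
      then show ?thesis using Px x that by (auto simp: P_def)
    qed
    then show "\<exists>y. P (Suc n) y \<and> Q n x y"
      using * Px x by (intro exI[of _ "(u @ [a], t')"]) (auto simp: P_def Q_def)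
  qed
  then obtain f where f: "\<And>n. P n (f n)" "\<And>n. Q n (f n) (f (Suc n))" by blast
  define U where "U n = fst (f n)" for n
  define T where "T i n = snd (f n) i" for i n
  have U: "length (U n) = n" "\<exists>a. U (Suc n) = U n @ [a]" "\<not> separable F m (U n) (\<lambda>i. T i n)" for n
    using f(1)[of n] f(2)[of n] by (auto simp: P_def Q_def U_def T_def split: prod.splits)
  have T: "length (T i n) = length (s i) + n" "\<exists>a. T i (Suc n) = T i n @ [a]" "T i 0 = s i"
    if "i \<le> m" for i n
    using f(1)[of n] f(1)[of 0] f(2)[of n] that by (auto simp: P_def Q_def U_def T_def split: prod.splits)
  define x where "x i = U (Suc i) ! i" for i
  define w where "w i j = T i (Suc j) ! j" for i j
  have x: "starts (U n) x" for n
    unfolding x_def by (rule starts_limit) (use U in auto)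
  have w: "starts (T i n) (w i)" if "i \<le> m" for i n
    unfolding w_def by (rule starts_limit) (use T[OF that] in auto)
  have "F x (w i)" if i: "i \<le> m" for i
  proof (rule closed_relD[OF F])
    fix n
    obtain x' w' where "starts (U n) x'" "F x' w'" "starts (T i n) w'"
      using not_separable_cell[OF U(3) i, of n] by (auto simp: cell_def)
    then show "\<exists>z' a'. agree n x z' \<and> agree n (w i) a' \<and> F z' a'"
      using starts_agree[OF x, of n x' n] starts_agree[OF w[OF i], of n w' n] U(1) T(1)[OF i] by auto
  qed
  then show ?thesis using w[of _ 0] T(3) by fastforce
qed

text \<open>Inseparable cells would have a common point with \<open>m + 1\<close> witnesses. These
  are distinct because their prefixes are distinct and of equal length.\<close>

lemma sections_bounded_separable:
  assumes F: "closed_rel F" and card: "\<And>x. finite {w. F x w} \<and> card {w. F x w} \<le> m"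
    and len: "\<And>i. i \<le> m \<Longrightarrow> length (s i) = n" and inj: "inj_on s {..m}"
  shows "separable F m [] s"
proof (rule ccontr)
  assume "\<not> separable F m [] s"
  from not_separable_witnesses[OF F this] obtain x w
    where w: "\<And>i. i \<le> m \<Longrightarrow> F x (w i) \<and> starts (s i) (w i)" by blast
  have "inj_on w {..m}"
  proof (rule inj_onI)
    fix i j assume ij: "i \<in> {..m}" "j \<in> {..m}" "w i = w j"
    then have "s i = s j"
      using w[of i] w[of j] len[of i] len[of j]
      by (intro nth_equalityI) (auto simp: starts_def)
    then show "i = j" using inj ij by (auto dest: inj_onD)
  qed
  then have "Suc m = card (w ` {..m})" by (simp add: card_image)
  also have "\<dots> \<le> card {w. F x w}" using w card by (intro card_mono) auto
  finally show False using card[of x] by simp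
qed

section \<open>Koenig's lemma and projections of relations with bounded sections\<close>

lemma koenig_prefix:
  fixes T :: "nat list \<Rightarrow> bool"
  assumes T0: "\<And>n. \<exists>s. length s = n \<and> T s"
    and pre: "\<And>s j. T (s @ [j]) \<Longrightarrow> T s"
    and fin: "\<And>n. finite {s. length s = n \<and> T s}"
  shows "\<exists>w. \<forall>n. T (map w [0..<n])"
proof -
  have pre': "T (s @ r) \<Longrightarrow> T s" for s r
    by (induction r rule: rev_induct) (auto simp: append_assoc[symmetric] simp del: append_assoc intro: pre)
  define good where "good s \<longleftrightarrow> (\<forall>n. \<exists>r. length r = n \<and> T (s @ r))" for s
  have step: "\<exists>j. good (s @ [j])" if good_s: "good s" for s
  proof (rule ccontr)
    assume "\<nexists>j. good (s @ [j])"
    then have "\<forall>j. \<exists>n. \<forall>r. length r = n \<longrightarrow> \<not> T (s @ [j] @ r)" unfolding good_def by auto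
    then obtain N where N: "\<And>j r. length r = N j \<Longrightarrow> \<not> T (s @ [j] @ r)" by metis
    define J where "J = {j. T (s @ [j])}"
    have "(\<lambda>j. s @ [j]) ` J \<subseteq> {t. length t = Suc (length s) \<and> T t}" by (auto simp: J_def)
    then have "finite ((\<lambda>j. s @ [j]) ` J)" using fin finite_subset by blast
    then have fJ: "finite J" by (rule finite_imageD) (simp add: inj_on_def)
    \<comment> \<open>\<open>Suc\<close> makes \<open>r\<close> nonempty, and its tail is at least
      as long as every \<open>N j\<close>, so the extension \<open>r\<close> of \<open>s\<close>
      contradicts the choice of \<open>N\<close> at its own first letter.\<close>
    obtain r where r: "length r = Suc (\<Sum>j\<in>J. N j)" "T (s @ r)"
      using good_s unfolding good_def by blast
    obtain j r' where r': "r = j # r'" using r(1) by (cases r) auto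
    have "T (s @ [j])" using pre'[of "s @ [j]" r'] r(2) r' by simp
    then have "N j \<le> length r'" using r(1) r' fJ member_le_sum[of j J N] by (simp add: J_def)
    moreover have "T (s @ [j] @ take (N j) r')"
      using pre'[of "s @ [j] @ take (N j) r'" "drop (N j) r'"] r(2) r' by simp
    ultimately show False using N[of "take (N j) r'" j] by simp
  qed
  have "good []" using T0 unfolding good_def by simp
  then have "\<exists>f. \<forall>n. (good (f n) \<and> length (f n) = n) \<and> (\<exists>j. f (Suc n) = f n @ [j])"
  proof (intro dependent_nat_choice)
    fix s n assume "good s \<and> length s = n"
    moreover from this obtain j where "good (s @ [j])" using step by blast
    ultimately show "\<exists>y. (good y \<and> length y = Suc n) \<and> (\<exists>j. y = s @ [j])"
      by (intro exI[of _ "s @ [j]"]) auto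
  qed auto
  then obtain f where f: "\<And>n. good (f n)" "\<And>n. length (f n) = n" "\<And>n. \<exists>j. f (Suc n) = f n @ [j]"
    by blast
  have "starts (f n) (\<lambda>i. f (Suc i) ! i)" for n
    by (rule starts_limit) (use f in auto)
  then have "f n = map (\<lambda>i. f (Suc i) ! i) [0..<n]" for n
    unfolding starts_def f(2) by (intro nth_equalityI) (simp_all add: f(2))
  moreover have "T (f n)" for n using f(1)[of n] unfolding good_def by (metis append_Nil2 length_0_conv)
  ultimately show ?thesis by metis
qed

text \<open>Membership depends only on the first \<open>n\<close> entries of \<open>x\<close>, so
  this neighborhood of a cell is a countable union of cylinders. The cell itself is only known to be
  analytic.\<close>

lemma near_cell_measurable:
  "{x. \<exists>x' w. F x' w \<and> agree n x x' \<and> starts s w} \<in> sets baire"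
proof -
  have "{x. \<exists>x' w. F x' w \<and> agree n x x' \<and> starts s w} =
    (\<Union>u\<in>{u. length u = n \<and> cell F u s \<noteq> {}}. {x. starts u x})" (is "?L = ?R")
  proof (intro equalityI subsetI)
    fix x assume "x \<in> ?L"
    then obtain x' w where *: "F x' w" "agree n x x'" "starts s w" by blast
    then have "x' \<in> cell F (map x [0..<n]) s" "starts (map x [0..<n]) x"
      by (auto simp: cell_def starts_def agree_def)
    then show "x \<in> ?R" by force
  next
    fix x assume "x \<in> ?R"
    then obtain u x' w where "length u = n" "starts u x" "starts u x'" "F x' w" "starts s w"
      by (auto simp: cell_def)
    then show "x \<in> ?L" using starts_agree[of u x x' n] by auto
  qed
  also have "\<dots> \<in> sets baire" by (intro sets.countable_UN') auto
  finally show ?thesis .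
qed

text \<open>The cells of the witnesses form a tree; Borel supersets of their projections, chosen to
  separate any \<open>m + 1\<close> cells of the same level, make this tree finitely branching over
  each point, and Koenig's lemma recovers a witness.\<close>

lemma closed_rel_projection_borel:
  assumes F: "closed_rel F" and card: "\<And>x. finite {w. F x w} \<and> card {w. F x w} \<le> m"
  shows "{x. \<exists>w. F x w} \<in> sets baire"
proof -
  define tup where "tup t \<longleftrightarrow> (\<exists>n. length t = Suc m \<and> distinct t \<and> (\<forall>s\<in>set t. length s = n))"
    for t :: "nat list list"
  have "\<exists>Q. (\<forall>i\<le>m. Q i \<in> sets baire \<and> cell F [] (t ! i) \<subseteq> Q i) \<and> (\<Inter>i\<le>m. Q i) = {}"
    if t: "tup t" for t
  proof -
    obtain n where n: "length t = Suc m" "distinct t" "\<forall>s\<in>set t. length s = n" using t tup_def by blast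
    have "separable F m [] (\<lambda>i. t ! i)"
      using n by (intro sections_bounded_separable[OF F card, where n = n])
        (auto simp: inj_on_def nth_eq_iff_index_eq)
    then show ?thesis unfolding separable_def .
  qed
  then obtain Q where Q: "\<And>t i. tup t \<Longrightarrow> i \<le> m \<Longrightarrow> Q t i \<in> sets baire"
      "\<And>t i. tup t \<Longrightarrow> i \<le> m \<Longrightarrow> cell F [] (t ! i) \<subseteq> Q t i" "\<And>t. tup t \<Longrightarrow> (\<Inter>i\<le>m. Q t i) = {}"
    by metis
  \<comment> \<open>Provides pairs of \<open>F\<close> arbitrarily close to \<open>x\<close> and to
    a branch of the tree, from which closedness of \<open>F\<close> puts the branch into the section
    of \<open>x\<close>. The sets \<open>Q\<close> in \<open>R\<close> keep the tree finitely
    branching.\<close>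
  define C where "C s = {x. \<exists>x' w. F x' w \<and> agree (length s) x x' \<and> starts s w}" for s
  define R where "R s = C s \<inter> (\<Inter>t\<in>{t. tup t}. \<Inter>i\<in>{i. i \<le> m \<and> t ! i = s}. Q t i)" for s
  \<comment> \<open>All prefixes are tested so that \<open>T x\<close> is closed under prefixes, as
    \<open>koenig_prefix\<close> requires.\<close>
  define T where "T x s \<longleftrightarrow> (\<forall>p\<le>length s. x \<in> R (take p s))" for x s
  have R_borel: "R s \<in> sets baire" for s
  proof -
    have "(if tup t \<and> i \<le> m \<and> t ! i = s then Q t i else UNIV) \<in> sets baire" for t i
      using Q(1) sets.top[of baire] by (auto simp: space_baire)
    then have "(\<Inter>t i. if tup t \<and> i \<le> m \<and> t ! i = s then Q t i else UNIV) \<in> sets baire"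
      by (intro sets.countable_INT'[OF countableI_type UNIV_not_empty] image_subsetI)
    moreover have "(\<Inter>t\<in>{t. tup t}. \<Inter>i\<in>{i. i \<le> m \<and> t ! i = s}. Q t i) =
        (\<Inter>t i. if tup t \<and> i \<le> m \<and> t ! i = s then Q t i else UNIV)"
      by (rule set_eqI) (simp, blast)
    moreover have "C s \<in> sets baire" unfolding C_def by (rule near_cell_measurable)
    ultimately show ?thesis unfolding R_def by auto
  qed
  have cell_R: "cell F [] s \<subseteq> R s" for s
  proof
    fix x assume x: "x \<in> cell F [] s"
    then have "x \<in> C s" by (auto simp: C_def cell_def agree_def)
    then show "x \<in> R s" using x Q(2) by (auto simp: R_def)
  qed
  have level: "finite {s. length s = n \<and> T x s} \<and> card {s. length s = n \<and> T x s} \<le> m" for n x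
  proof (rule ccontr)
    let ?S = "{s. length s = n \<and> T x s}"
    assume "\<not> (finite ?S \<and> card ?S \<le> m)"
    then have "\<exists>S. S \<subseteq> ?S \<and> finite S \<and> card S = Suc m"
    proof (cases "finite ?S")
      case True
      then have "Suc m \<le> card ?S" using \<open>\<not> (finite ?S \<and> card ?S \<le> m)\<close> by linarith
      then show ?thesis by (meson obtain_subset_with_card_n)
    next
      case False
      then show ?thesis using infinite_arbitrarily_large by blast
    qed
    then obtain S where S: "S \<subseteq> ?S" "finite S" "card S = Suc m" by blast
    obtain t where t: "set t = S" "distinct t" using S(2) finite_distinct_list by blast
    have lt: "length t = Suc m" using distinct_card[OF t(2)] t(1) S(3) by simp
    have tt: "tup t" unfolding tup_def
      by (rule exI[of _ n]) (use t S(1) lt in auto)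
    have "x \<in> Q t i" if i: "i \<le> m" for i
    proof -
      have "t ! i \<in> S" using t(1) lt i nth_mem[of i t] by simp
      then have "T x (t ! i)" using S by blast
      then have "x \<in> R (take (length (t ! i)) (t ! i))" unfolding T_def by blast
      then have "x \<in> R (t ! i)" by simp
      then show ?thesis using tt i by (auto simp: R_def)
    qed
    then show False using Q(3)[OF tt] by blast
  qed
  have "(\<exists>w. F x w) \<longleftrightarrow> (\<forall>n. \<exists>s. length s = n \<and> T x s)" for x
  proof
    assume "\<exists>w. F x w"
    then obtain w where w: "F x w" by blast
    have "x \<in> cell F [] (take p (map w [0..<n]))" for n p
      using w unfolding cell_def by (auto simp: starts_def intro!: exI[of _ w])
    then have "T x (map w [0..<n])" for n unfolding T_def using cell_R by blast
    then show "\<forall>n. \<exists>s. length s = n \<and> T x s"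
      by (intro allI exI[of _ "map w [0..<n]" for n]) simp
  next
    assume *: "\<forall>n. \<exists>s. length s = n \<and> T x s"
    have "\<exists>w. \<forall>n. T x (map w [0..<n])"
    proof (rule koenig_prefix)
      show "T x s" if "T x (s @ [j])" for s j
        unfolding T_def
      proof (intro allI impI)
        fix p assume "p \<le> length s"
        then show "x \<in> R (take p s)" using that[unfolded T_def, rule_format, of p] by simp
      qed
    qed (use * level in auto)
    then obtain w where w: "\<And>n. T x (map w [0..<n])" by blast
    have "F x w"
    proof (rule closed_relD[OF F])
      fix n
      have "x \<in> R (take n (map w [0..<n]))" using w[of n] unfolding T_def by fastforce
      then have "x \<in> R (map w [0..<n])" by (metis diff_zero length_map length_upt order_refl take_all)
      then have "x \<in> C (map w [0..<n])" unfolding R_def by simp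
      then obtain x' w' where "F x' w'" "agree n x x'" "starts (map w [0..<n]) w'"
        by (auto simp: C_def)
      then show "\<exists>z' a'. agree n x z' \<and> agree n w a' \<and> F z' a'"
        by (intro exI[of _ x'] exI[of _ w']) (auto simp: starts_def agree_def)
    qed
    then show "\<exists>w. F x w" by blast
  qed
  then have "{x. \<exists>w. F x w} = (\<Inter>n. \<Union>s\<in>{s. length s = n}. \<Inter>p\<in>{..length s}. R (take p s))"
  proof (intro set_eqI)
    fix x
    have "x \<in> {x. \<exists>w. F x w} \<longleftrightarrow> (\<forall>n. \<exists>s. length s = n \<and> T x s)"
      using \<open>\<And>x. (\<exists>w. F x w) = (\<forall>n. \<exists>s. length s = n \<and> T x s)\<close> by simp
    also have "\<dots> \<longleftrightarrow> x \<in> (\<Inter>n. \<Union>s\<in>{s. length s = n}. \<Inter>p\<in>{..length s}. R (take p s))"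
      unfolding T_def INT_iff UN_iff Ball_def Bex_def by simp
    finally show "x \<in> {x. \<exists>w. F x w} \<longleftrightarrow>
        x \<in> (\<Inter>n. \<Union>s\<in>{s. length s = n}. \<Inter>p\<in>{..length s}. R (take p s))" .
  qed
  also have "\<dots> \<in> sets baire"
    by (intro sets.countable_INT sets.countable_UN' sets.finite_INT) (auto intro: R_borel)
  finally show ?thesis .
qed

text \<open>A witness \<open>w\<close> of \<open>x\<close> under \<open>G\<close> interleaves a
  point \<open>y\<close> of the section (even entries) with the certificate that
  \<open>(x, y) \<in> A\<close> (odd entries). The certificate is unique, so \<open>ev\<close> maps
  the sections of \<open>G\<close> bijectively onto those of \<open>A\<close> and the bound
  \<open>m\<close> carries over to the closed relation \<open>G\<close>.\<close>

lemma projection_borel: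
  assumes A: "A \<in> sets (baire \<Otimes>\<^sub>M baire)"
    and card: "\<And>x. finite {y. (x, y) \<in> A} \<and> card {y. (x, y) \<in> A} \<le> m"
  shows "{x. \<exists>y. (x, y) \<in> A} \<in> sets baire"
proof -
  define ev where "ev z = (\<lambda>i. z (2 * i))" for z :: "nat \<Rightarrow> nat"
  define od where "od z = (\<lambda>i. z (Suc (2 * i)))" for z :: "nat \<Rightarrow> nat"
  define il where "il x y = (\<lambda>i. if even i then x (i div 2) else y (i div 2))" for x y :: "nat \<Rightarrow> nat"
  have il: "ev (il x y) = x" "od (il x y) = y" for x y
    by (auto simp: ev_def od_def il_def)
  have [measurable]: "ev \<in> measurable baire baire" "od \<in> measurable baire baire"
    unfolding ev_def od_def by (intro measurable_PiM_single'; simp add: PiE_UNIV_domain)+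
  have "{z \<in> space baire. (ev z, od z) \<in> A} \<in> sets baire" using A by measurable
  then have "{z. (ev z, od z) \<in> A} \<in> sets baire" by (simp add: space_baire)
  from baire_unique_closed_witness[OF this]
  obtain F where F: "closed_rel F" "\<And>z. (ev z, od z) \<in> A \<longleftrightarrow> (\<exists>a. F z a)"
    "\<And>z a b. F z a \<Longrightarrow> F z b \<Longrightarrow> a = b"
    unfolding unique_closed_witness_def by blast
  define G where "G x w \<longleftrightarrow> F (il x (ev w)) (od w)" for x w
  have "closed_rel G"
  proof (rule closed_relI)
    fix x w assume *: "\<And>n. \<exists>x' w'. agree n x x' \<and> agree n w w' \<and> G x' w'"
    show "G x w" unfolding G_def
    proof (rule closed_relD[OF F(1)])
      fix n
      obtain x' w' where "agree (Suc (2 * n)) x x'" "agree (Suc (2 * n)) w w'" "G x' w'" using * by blast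
      then show "\<exists>z' a'. agree n (il x (ev w)) z' \<and> agree n (od w) a' \<and> F z' a'"
        by (intro exI[of _ "il x' (ev w')"] exI[of _ "od w'"])
          (auto simp: agree_def G_def il_def ev_def od_def)
    qed
  qed
  moreover have inj: "inj_on ev {w. G x w}" for x
  proof (rule inj_onI)
    fix w w' assume *: "w \<in> {w. G x w}" "w' \<in> {w. G x w}" "ev w = ev w'"
    then have "od w = od w'" using F(3)[of "il x (ev w)"] by (auto simp: G_def)
    show "w = w'"
    proof
      fix i
      show "w i = w' i"
      proof (cases "even i")
        case True
        then show ?thesis using fun_cong[OF *(3), of "i div 2"] by (simp add: ev_def)
      next
        case False
        then show ?thesis using fun_cong[OF \<open>od w = od w'\<close>, of "i div 2"]
          by (simp add: od_def odd_two_times_div_two_succ)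
      qed
    qed
  qed
  have img: "ev ` {w. G x w} = {y. (x, y) \<in> A}" for x
  proof (intro equalityI subsetI)
    fix y assume "y \<in> ev ` {w. G x w}"
    then obtain w where "y = ev w" "F (il x (ev w)) (od w)" by (auto simp: G_def)
    then show "y \<in> {y. (x, y) \<in> A}" using F(2)[of "il x (ev w)"] il by auto
  next
    fix y assume "y \<in> {y. (x, y) \<in> A}"
    then obtain a where "F (il x y) a" using F(2)[of "il x y"] il by auto
    then have "G x (il y a)" by (simp add: G_def il)
    then show "y \<in> ev ` {w. G x w}" using il(1) by (metis image_eqI mem_Collect_eq)
  qed
  have "finite {w. G x w} \<and> card {w. G x w} \<le> m" for x
    using card[of x] img[of x] inj[of x] by (metis card_image finite_image_iff)
  ultimately have "{x. \<exists>w. G x w} \<in> sets baire" by (rule closed_rel_projection_borel)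
  moreover have "(\<exists>w. G x w) \<longleftrightarrow> (\<exists>y. (x, y) \<in> A)" for x using img[of x] by blast
  ultimately show ?thesis by simp
qed

section \<open>Coding the points of a standard Borel space by the basic balls that contain
  them\<close>

lemma standard_borel_embedding:
  assumes "standard_borel M"
  obtains \<phi> :: "'a \<Rightarrow> nat \<Rightarrow> nat" and S where
    "\<phi> \<in> measurable M baire" "S \<in> sets baire" "\<phi> ` space M = S" "inj_on \<phi> (space M)"
    "\<And>A. A \<in> sets M \<Longrightarrow> \<exists>B\<in>sets baire. A = \<phi> -` B \<inter> space M"
proof (cases "space M = {}")
  case True
  show ?thesis
  proof (rule that[of "\<lambda>_ _. 0" "{}"])
    fix A assume "A \<in> sets M"
    then have "A = {}" using True sets.sets_into_space by blast
    then show "\<exists>B\<in>sets baire. A = (\<lambda>_ _. 0) -` B \<inter> space M" using True by blast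
  qed (use True in \<open>auto simp: measurable_def\<close>)
next
  case False
  obtain T where T: "completely_metrizable_space T" "second_countable T" "topspace T = space M"
    "sets M = sigma_sets (topspace T) {U. openin T U}"
    using assms unfolding standard_borel_def by blast
  obtain X d where X: "Metric_space X d" "Metric_space.mcomplete X d" "T = Metric_space.mtopology X d"
    using T(1) unfolding completely_metrizable_space_def by blast
  interpret Metric_space X d by (rule X(1))
  have XM: "X = space M" using T(3) X(3) by simp
  obtain C where C: "countable C" "C \<subseteq> X" "mtopology closure_of C = X"
    using second_countable_imp_separable_space[OF T(2)] X(3) unfolding separable_space_def by auto
  have "C \<noteq> {}" using C(3) False XM by auto
  define q where "q = from_nat_into C"
  have q: "range q = C" unfolding q_def using \<open>C \<noteq> {}\<close> C(1) by (rule range_from_nat_into)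
  have qX: "q i \<in> X" for i using q C(2) by blast
  have dense: "\<exists>i. d x (q i) < e" if xe: "x \<in> X" "e > 0" for x e
  proof -
    have "x \<in> mtopology closure_of C" using C(3) xe by simp
    then obtain c where "c \<in> C" "c \<in> mball x e" using xe(2) unfolding metric_closure_of by blast
    then show ?thesis using q by (auto simp: in_mball)
  qed
  define r where "r n = 1 / (real n + 1)" for n :: nat
  have r0: "r n > 0" for n by (simp add: r_def)
  have r_small: "\<exists>n. r n < e" if "e > 0" for e
    using reals_Archimedean[OF that] by (auto simp: r_def inverse_eq_divide add.commute)
  define cen where "cen j = q (fst (prod_decode j))" for j
  define rad where "rad j = r (snd (prod_decode j))" for j
  define U where "U j = mball (cen j) (rad j)" for j
  \<comment> \<open>An inequality between centers and radii which implies that even the closed ball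
    \<open>j'\<close> lies inside the open ball \<open>j\<close>.\<close>
  define formal where "formal j' j \<longleftrightarrow> d (cen j') (cen j) + rad j' < rad j" for j' j
  define \<phi> where "\<phi> x j = (if x \<in> U j then 2 else 0 :: nat)" for x j
  have cenX: "cen j \<in> X" for j using qX by (simp add: cen_def)
  have rad0: "rad j > 0" for j using r0 by (simp add: rad_def)
  have U: "x \<in> U j \<longleftrightarrow> x \<in> X \<and> d (cen j) x < rad j" for x j
    using cenX by (auto simp: U_def in_mball)
  have enc: "cen (prod_encode (i, n)) = q i" "rad (prod_encode (i, n)) = r n" for i n
    by (auto simp: cen_def rad_def)
  have basis: "\<exists>j. x \<in> U j \<and> U j \<subseteq> V" if V: "openin mtopology V" "x \<in> V" for x V
  proof -
    obtain e where e: "e > 0" "mball x e \<subseteq> V" using V openin_mtopology by metis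
    have x: "x \<in> X" using V openin_mtopology by blast
    obtain n where n: "r n < e / 2" using r_small[of "e / 2"] e by auto
    obtain i where i: "d x (q i) < r n" using dense[OF x r0] by blast
    have "x \<in> U (prod_encode (i, n))" using i x by (simp add: U enc commute)
    moreover have "U (prod_encode (i, n)) \<subseteq> mball x e"
    proof
      fix y assume "y \<in> U (prod_encode (i, n))"
      then have "y \<in> X" "d (q i) y < r n" by (auto simp: U enc)
      then have "d x y < e" using i n triangle[OF x qX, of y i] by linarith
      then show "y \<in> mball x e" using x \<open>y \<in> X\<close> by (simp add: in_mball)
    qed
    ultimately show ?thesis using e by blast
  qed
  have U_sets: "U j \<in> sets M" for j
    unfolding T(4) X(3) by (rule sigma_sets.Basic) (simp add: U_def openin_mball)
  have \<phi>_meas: "\<phi> \<in> measurable M baire"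
  proof (rule measurable_PiM_single')
    fix j show "(\<lambda>x. \<phi> x j) \<in> measurable M (count_space UNIV)"
      unfolding \<phi>_def using U_sets by measurable
  qed (simp add: PiE_UNIV_domain)
  \<comment> \<open>The range of \<open>\<phi>\<close>, described by countably many conditions so
    that it is visibly Borel. Arbitrarily small chosen balls that meet pairwise give a Cauchy
    sequence of centers, which converges by completeness. The last condition then forces the chosen
    balls to be exactly those that contain the limit.\<close>
  define S where "S = {b :: nat \<Rightarrow> nat. (\<forall>j. b j = 0 \<or> b j = 2) \<and> (\<forall>n. \<exists>i. b (prod_encode (i, n)) = 2) \<and>
     (\<forall>j j'. b j = 2 \<longrightarrow> b j' = 2 \<longrightarrow> U j \<inter> U j' \<noteq> {}) \<and>
     (\<forall>j. b j = 2 \<longleftrightarrow> (\<exists>j'. formal j' j \<and> b j' = 2))}"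
  have [measurable]: "Measurable.pred baire (\<lambda>b. b j = c)" for j and c :: nat
  proof -
    have "(\<lambda>b. b j) -` {c} \<inter> space baire \<in> sets baire"
      by (rule measurable_sets[OF measurable_component_singleton]) auto
    then show ?thesis unfolding pred_def by (simp add: vimage_def Int_def conj_commute)
  qed
  have "{b \<in> space baire. (\<forall>j. b j = 0 \<or> b j = 2) \<and> (\<forall>n. \<exists>i. b (prod_encode (i, n)) = 2) \<and>
     (\<forall>j j'. b j = 2 \<longrightarrow> b j' = 2 \<longrightarrow> U j \<inter> U j' \<noteq> {}) \<and>
     (\<forall>j. b j = 2 \<longleftrightarrow> (\<exists>j'. formal j' j \<and> b j' = 2))} \<in> sets baire"
    by measurable
  then have S_sets: "S \<in> sets baire" by (simp add: S_def space_baire)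
  have \<phi>2: "\<phi> x j = 2 \<longleftrightarrow> x \<in> U j" for x j by (simp add: \<phi>_def)
  have \<phi>S: "\<phi> x \<in> S" if x: "x \<in> X" for x
  proof -
    have "\<exists>i. \<phi> x (prod_encode (i, n)) = 2" for n
      using dense[OF x r0[of n]] x by (auto simp: \<phi>2 U enc commute)
    moreover have "\<phi> x j = 2 \<longleftrightarrow> (\<exists>j'. formal j' j \<and> \<phi> x j' = 2)" for j
      unfolding \<phi>2
    proof
      assume "x \<in> U j"
      then have lt: "d (cen j) x < rad j" by (simp add: U)
      then obtain n where n: "r n < (rad j - d (cen j) x) / 2"
        using r_small[of "(rad j - d (cen j) x) / 2"] by auto
      obtain i where i: "d x (q i) < r n" using dense[OF x r0] by blast
      have "d (q i) (cen j) \<le> d (cen j) x + d x (q i)"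
        using triangle[OF cenX x qX, of j i] by (simp add: commute)
      then have "formal (prod_encode (i, n)) j" unfolding formal_def enc using n i
        by (simp add: field_simps)
      then show "\<exists>j'. formal j' j \<and> x \<in> U j'" using i x
        by (intro exI[of _ "prod_encode (i, n)"]) (simp add: U enc commute)
    next
      assume "\<exists>j'. formal j' j \<and> x \<in> U j'"
      then obtain j' where j': "formal j' j" "x \<in> U j'" by blast
      then show "x \<in> U j" using triangle[OF cenX cenX x, of j j'] x commute[of "cen j" "cen j'"]
        by (simp add: U formal_def)
    qed
    moreover have "\<phi> x j = 2 \<longrightarrow> \<phi> x j' = 2 \<longrightarrow> U j \<inter> U j' \<noteq> {}" for j j'
      unfolding \<phi>2 by blast
    moreover have "\<phi> x j = 0 \<or> \<phi> x j = 2" for j by (simp add: \<phi>_def)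
    ultimately show ?thesis unfolding S_def by blast
  qed
  have meet: "d (cen j) (cen j') < rad j + rad j'" if ne: "U j \<inter> U j' \<noteq> {}" for j j'
  proof -
    obtain y where y: "y \<in> U j" "y \<in> U j'" using ne by blast
    then show ?thesis using triangle[OF cenX _ cenX, of y j j'] commute[of y "cen j'"]
      by (auto simp: U)
  qed
  have S\<phi>: "\<exists>x\<in>X. \<phi> x = b" if b: "b \<in> S" for b
  proof -
    have b01: "b j = 0 \<or> b j = 2" for j using b unfolding S_def by blast
    have bmeet: "b j = 2 \<Longrightarrow> b j' = 2 \<Longrightarrow> d (cen j) (cen j') < rad j + rad j'" for j j'
      using b meet[of j j'] unfolding S_def by blast
    have bform: "b j = 2 \<longleftrightarrow> (\<exists>j'. formal j' j \<and> b j' = 2)" for j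
      using b unfolding S_def by blast
    have "\<forall>n. \<exists>i. b (prod_encode (i, n)) = 2" using b unfolding S_def by blast
    then obtain c where c: "\<And>n. b (prod_encode (c n, n)) = 2" by metis
    have qm: "d (q (c n)) (q (c m)) < r n + r m" for n m
      using bmeet[OF c[of n] c[of m]] by (simp add: enc)
    have r_mono: "r n \<le> r N" if "N \<le> n" for n N using that by (simp add: r_def frac_le)
    have "MCauchy (\<lambda>n. q (c n))" unfolding MCauchy_def
    proof (intro conjI allI impI)
      fix e :: real assume "e > 0"
      then obtain N where "r N < e / 2" using r_small[of "e / 2"] by auto
      then have "d (q (c n)) (q (c m)) < e" if "N \<le> n" "N \<le> m" for n m
        using qm[of n m] r_mono[OF that(1)] r_mono[OF that(2)] by linarith
      then show "\<exists>N. \<forall>n n'. N \<le> n \<longrightarrow> N \<le> n' \<longrightarrow> d (q (c n)) (q (c n')) < e" by blast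
    qed (use qX in auto)
    then obtain x where x: "limitin mtopology (\<lambda>n. q (c n)) x sequentially"
      using X(2) unfolding mcomplete_def by blast
    then have xX: "x \<in> X" by (simp add: limitin_metric)
    have xlim: "\<exists>n\<ge>N. d (q (c n)) x < e \<and> r n < e" if e: "e > 0" for e N
    proof -
      obtain N1 where N1: "\<And>n. n \<ge> N1 \<Longrightarrow> d (q (c n)) x < e"
        using x e unfolding limit_metric_sequentially by blast
      obtain N2 where N2: "r N2 < e" using r_small[OF e] by blast
      have "r (N + N1 + N2) < e" using r_mono[of N2 "N + N1 + N2"] N2 by linarith
      then show ?thesis using N1[of "N + N1 + N2"] by (intro exI[of _ "N + N1 + N2"]) auto
    qed
    \<comment> \<open>A limit argument only yields membership in closed balls. Below, a chosen ball
      formally inside \<open>j\<close> upgrades this to the open ball \<open>j\<close>.\<close>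
    have closeness: "d x (cen j) \<le> rad j" if "b j = 2" for j
    proof (rule field_le_epsilon)
      fix e :: real assume e: "e > 0"
      obtain n where n: "d (q (c n)) x < e / 2" "r n < e / 2" using xlim[of "e / 2" 0] e by auto
      have "d (q (c n)) (cen j) < r n + rad j" using bmeet[OF c[of n] that] by (simp add: enc)
      moreover have "d x (cen j) \<le> d x (q (c n)) + d (q (c n)) (cen j)"
        by (rule triangle[OF xX qX cenX])
      ultimately show "d x (cen j) \<le> rad j + e"
        using n commute[of x "q (c n)"] \<open>d x (cen j) \<le> d x (q (c n)) + d (q (c n)) (cen j)\<close> by linarith
    qed
    have "x \<in> U j \<longleftrightarrow> b j = 2" for j
    proof
      assume "x \<in> U j"
      then have pos: "rad j - d (cen j) x > 0" by (simp add: U)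
      obtain n where n: "d (q (c n)) x < (rad j - d (cen j) x) / 2" "r n < (rad j - d (cen j) x) / 2"
        using xlim[of "(rad j - d (cen j) x) / 2" 0] pos by auto
      have "d (q (c n)) (cen j) \<le> d (q (c n)) x + d (cen j) x"
        using triangle[OF qX xX cenX] by (metis commute)
      then have "formal (prod_encode (c n, n)) j"
        unfolding formal_def enc using n by (simp add: field_simps)
      then show "b j = 2" using bform[of j] c[of n] by blast
    next
      assume "b j = 2"
      then obtain j' where j': "formal j' j" "b j' = 2" using bform[of j] by blast
      have "d (cen j) x \<le> d (cen j') (cen j) + d x (cen j')"
        using triangle[OF cenX cenX xX] by (metis commute)
      then show "x \<in> U j" using closeness[OF j'(2)] j'(1) xX by (simp add: U formal_def)
    qed
    then have "\<phi> x j = b j" for j using \<phi>2[of x j] b01[of j] by (auto simp: \<phi>_def)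
    then show ?thesis using xX by blast
  qed
  have inj: "inj_on \<phi> (space M)"
  proof (rule inj_onI, rule ccontr)
    fix x y assume *: "x \<in> space M" "y \<in> space M" "\<phi> x = \<phi> y" "x \<noteq> y"
    then have xy: "x \<in> X" "y \<in> X" "d x y > 0" using XM by auto
    obtain j where j: "x \<in> U j" "U j \<subseteq> mball x (d x y)"
      using basis[OF openin_mball, of x x "d x y"] xy by (auto simp: in_mball)
    have "y \<in> U j" using j(1) *(3) \<phi>2 by metis
    then have "d x y < d x y" using j(2) by (auto simp: in_mball)
    then show False by simp
  qed
  have gen: "\<exists>B\<in>sets baire. A = \<phi> -` B \<inter> space M" if "A \<in> sets M" for A
    using that unfolding T(4) T(3)
  proof induction
    case (Basic V)
    then have V: "openin mtopology V" using X(3) by simp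
    define B where "B = (\<Union>j\<in>{j. U j \<subseteq> V}. {b :: nat \<Rightarrow> nat. b j = 2})"
    have "{b :: nat \<Rightarrow> nat. b j = 2} \<in> sets baire" for j
      using measurable_sets[OF measurable_component_singleton[of j UNIV "\<lambda>_. count_space (UNIV :: nat set)"], of "{2}"]
      by (simp add: space_baire vimage_def)
    then have "B \<in> sets baire" unfolding B_def by (intro sets.countable_UN') (auto simp: space_baire)
    moreover have "V = \<phi> -` B \<inter> space M"
    proof (intro equalityI subsetI)
      fix x assume x: "x \<in> V"
      then have "x \<in> space M" using openin_subset[OF V] unfolding XM[symmetric] by auto
      moreover obtain j where "x \<in> U j" "U j \<subseteq> V" using basis[OF V x] by blast
      ultimately show "x \<in> \<phi> -` B \<inter> space M" by (auto simp: B_def \<phi>2)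
    qed (auto simp: B_def \<phi>2)
    ultimately show ?case by blast
  next
    case Empty
    show ?case by (rule bexI[of _ "{}"]) auto
  next
    case (Compl A)
    then obtain B where B: "B \<in> sets baire" "A = \<phi> -` B \<inter> space M" by blast
    then have "space M - A = \<phi> -` (space baire - B) \<inter> space M" by (auto simp: space_baire)
    then show ?case using sets.compl_sets[OF B(1)] by (rule bexI)
  next
    case (Union A)
    then obtain B where B: "\<And>i. B i \<in> sets baire" "\<And>i. A i = \<phi> -` B i \<inter> space M" by metis
    then have "(\<Union>i. A i) = \<phi> -` (\<Union>i. B i) \<inter> space M" by blast
    moreover have "(\<Union>i. B i) \<in> sets baire" using B(1) by (intro sets.countable_UN) auto
    ultimately show ?case by (rule bexI)
  qed
  have "\<phi> ` space M = S"
  proof (intro equalityI subsetI)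
    fix b assume "b \<in> S"
    then show "b \<in> \<phi> ` space M" using S\<phi> XM by blast
  qed (use \<phi>S XM in blast)
  then show ?thesis by (rule that[OF \<phi>_meas S_sets _ inj gen])
qed

lemma pair_sets_pullback:
  assumes gen: "\<And>A. A \<in> sets M \<Longrightarrow> \<exists>B\<in>sets N. A = \<phi> -` B \<inter> space M"
    and \<phi>: "\<phi> \<in> measurable M N" and A: "A \<in> sets (M \<Otimes>\<^sub>M M)"
  shows "\<exists>B\<in>sets (N \<Otimes>\<^sub>M N). \<forall>x\<in>space M. \<forall>y\<in>space M. (x, y) \<in> A \<longleftrightarrow> (\<phi> x, \<phi> y) \<in> B"
  using A unfolding sets_pair_measure
proof induction
  case (Basic a)
  then obtain A1 A2 where a: "a = A1 \<times> A2" "A1 \<in> sets M" "A2 \<in> sets M" by blast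
  obtain B1 B2 where B: "B1 \<in> sets N" "A1 = \<phi> -` B1 \<inter> space M" "B2 \<in> sets N" "A2 = \<phi> -` B2 \<inter> space M"
    using gen[OF a(2)] gen[OF a(3)] by blast
  show ?case unfolding sets_pair_measure[symmetric]
    by (rule bexI[of _ "B1 \<times> B2"]) (use a B in auto)
next
  case Empty
  show ?case by (rule bexI[of _ "{}"]) (auto intro: sigma_sets.Empty)
next
  case (Compl a)
  then obtain B where B: "B \<in> sets (N \<Otimes>\<^sub>M N)"
    "\<forall>x\<in>space M. \<forall>y\<in>space M. (x, y) \<in> a \<longleftrightarrow> (\<phi> x, \<phi> y) \<in> B"
    unfolding sets_pair_measure by blast
  show ?case unfolding sets_pair_measure[symmetric]
    by (rule bexI[of _ "space (N \<Otimes>\<^sub>M N) - B"])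
      (use B measurable_space[OF \<phi>] in \<open>auto simp: space_pair_measure\<close>)
next
  case (Union a)
  have "\<forall>i. \<exists>B. B \<in> sets (N \<Otimes>\<^sub>M N) \<and>
      (\<forall>x\<in>space M. \<forall>y\<in>space M. (x, y) \<in> a i \<longleftrightarrow> (\<phi> x, \<phi> y) \<in> B)"
    using Union.IH unfolding sets_pair_measure Bex_def by blast
  from choice[OF this] obtain B where B: "\<And>i. B i \<in> sets (N \<Otimes>\<^sub>M N)"
    "\<And>i. \<forall>x\<in>space M. \<forall>y\<in>space M. (x, y) \<in> a i \<longleftrightarrow> (\<phi> x, \<phi> y) \<in> B i"
    by blast
  show ?case unfolding sets_pair_measure[symmetric]
    by (rule bexI[of _ "\<Union>i. B i"]) (use B in auto)
qed

text \<open>The finite-section case of the Lusin--Novikov theorem.\<close>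

lemma standard_borel_projection:
  assumes M: "standard_borel M" and A: "A \<in> sets (M \<Otimes>\<^sub>M M)"
    and card: "\<And>x. x \<in> space M \<Longrightarrow> finite {y. (x, y) \<in> A} \<and> card {y. (x, y) \<in> A} \<le> m"
  shows "{x \<in> space M. \<exists>y. (x, y) \<in> A} \<in> sets M"
proof -
  obtain \<phi> :: "'a \<Rightarrow> nat \<Rightarrow> nat" and S where \<phi>:
    "\<phi> \<in> measurable M baire" "S \<in> sets baire" "\<phi> ` space M = S" "inj_on \<phi> (space M)"
    "\<And>A. A \<in> sets M \<Longrightarrow> \<exists>B\<in>sets baire. A = \<phi> -` B \<inter> space M"
    using standard_borel_embedding[OF M] by blast
  note [measurable] = \<phi>(1)
  have AM: "A \<subseteq> space M \<times> space M" using sets.sets_into_space[OF A] by (simp add: space_pair_measure)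
  obtain B where B: "B \<in> sets (baire \<Otimes>\<^sub>M baire)"
    "\<And>x y. x \<in> space M \<Longrightarrow> y \<in> space M \<Longrightarrow> (x, y) \<in> A \<longleftrightarrow> (\<phi> x, \<phi> y) \<in> B"
    using pair_sets_pullback[OF \<phi>(5) \<phi>(1) A] by blast
  \<comment> \<open>Nothing is known about \<open>B\<close> off the range of \<open>\<phi>\<close>.
    After the cut every section is empty or the image of a section of \<open>A\<close>, so the bound
    holds at all points of the Baire space.\<close>
  define C where "C = B \<inter> S \<times> S"
  have C: "C \<in> sets (baire \<Otimes>\<^sub>M baire)" unfolding C_def using B(1) \<phi>(2) by auto
  have sec: "{b. (\<phi> x, b) \<in> C} = \<phi> ` {y. (x, y) \<in> A}" if "x \<in> space M" for x
    using that AM B(2)[OF that] \<phi>(3) by (auto simp: C_def)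
  have "finite {b. (a, b) \<in> C} \<and> card {b. (a, b) \<in> C} \<le> m" for a
  proof (cases "a \<in> S")
    case True
    then obtain x where x: "x \<in> space M" "a = \<phi> x" using \<phi>(3) by blast
    show ?thesis using card[OF x(1)] card_image_le[of "{y. (x, y) \<in> A}" \<phi>]
      unfolding x(2) sec[OF x(1)] by (metis finite_imageI le_trans)
  next
    case False
    then have "{b. (a, b) \<in> C} = {}" by (auto simp: C_def)
    then show ?thesis by simp
  qed
  from projection_borel[OF C this]
  have [measurable]: "{a. \<exists>b. (a, b) \<in> C} \<in> sets baire" .
  have "{x \<in> space M. \<exists>y. (x, y) \<in> A} = {x \<in> space M. \<phi> x \<in> {a. \<exists>b. (a, b) \<in> C}}"
    using sec by blast
  also have "\<dots> \<in> sets M" by measurable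
  finally show ?thesis .
qed

section \<open>Measurable selection of neighbors\<close>

text \<open>Points are separated by the countably many entries of their codes, so equality is a
  countable conjunction of measurable conditions.\<close>

lemma standard_borel_equality:
  assumes M: "standard_borel M" and [measurable]: "f \<in> measurable N M" "g \<in> measurable N M"
  shows "Measurable.pred N (\<lambda>x. f x = g x)"
proof -
  obtain \<phi> :: "'a \<Rightarrow> nat \<Rightarrow> nat" and S where \<phi>: "\<phi> \<in> measurable M baire" "inj_on \<phi> (space M)"
    using standard_borel_embedding[OF M] by metis
  have [measurable]: "(\<lambda>x. \<phi> (f x) i) \<in> measurable N (count_space UNIV)"
    "(\<lambda>x. \<phi> (g x) i) \<in> measurable N (count_space UNIV)" for i
    using measurable_compose[OF assms(2) measurable_compose[OF \<phi>(1) measurable_component_singleton[of i]]]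
      measurable_compose[OF assms(3) measurable_compose[OF \<phi>(1) measurable_component_singleton[of i]]]
    by simp_all
  have "f x = g x \<longleftrightarrow> (\<forall>i j. \<phi> (f x) i = j \<longleftrightarrow> \<phi> (g x) i = j)" if "x \<in> space N" for x
  proof
    assume "\<forall>i j. \<phi> (f x) i = j \<longleftrightarrow> \<phi> (g x) i = j"
    then have "\<phi> (f x) = \<phi> (g x)" by (intro ext) blast
    then show "f x = g x"
      using inj_onD[OF \<phi>(2)] that measurable_space[OF assms(2)] measurable_space[OF assms(3)] by blast
  qed simp
  then have "Measurable.pred N (\<lambda>x. f x = g x) \<longleftrightarrow> 
      Measurable.pred N (\<lambda>x. \<forall>i j. \<phi> (f x) i = j \<longleftrightarrow> \<phi> (g x) i = j)"
    by (intro measurable_cong)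
  also have "\<dots>" by measurable
  finally show ?thesis .
qed

text \<open>Every point of a finite section is isolated in it by some cylinder of codes. The
  selected point is the one isolated by the first suitable cylinder in a fixed enumeration; all
  conditions involved are combinations of projections of \<open>A\<close> cut down to Borel
  sets.\<close>

lemma standard_borel_selection:
  assumes M: "standard_borel M" and A: "A \<in> sets (M \<Otimes>\<^sub>M M)"
    and card: "\<And>x. x \<in> space M \<Longrightarrow> finite {y. (x, y) \<in> A} \<and> card {y. (x, y) \<in> A} \<le> m"
  shows "\<exists>g\<in>measurable M M. \<forall>x\<in>space M. if \<exists>y. (x, y) \<in> A then (x, g x) \<in> A else g x = x"
proof -
  obtain \<phi> :: "'a \<Rightarrow> nat \<Rightarrow> nat" and S where \<phi>: "\<phi> \<in> measurable M baire" "inj_on \<phi> (space M)"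
    using standard_borel_embedding[OF M] by metis
  note [measurable] = \<phi>(1)
  have AM: "A \<subseteq> space M \<times> space M" using sets.sets_into_space[OF A] by (simp add: space_pair_measure)
  have U_sets: "{y \<in> space M. starts u (\<phi> y)} \<in> sets M" for u
    using measurable_sets[OF \<phi>(1) starts_measurable[of u]] by (simp add: vimage_def Int_def conj_commute)
  have proj: "{x \<in> space M. \<exists>y. (x, y) \<in> A \<and> y \<in> B} \<in> sets M" if "B \<in> sets M" for B
  proof -
    have "A \<inter> (space M \<times> B) \<in> sets (M \<Otimes>\<^sub>M M)" using A that by auto
    then have "{x \<in> space M. \<exists>y. (x, y) \<in> A \<inter> (space M \<times> B)} \<in> sets M"
    proof (rule standard_borel_projection[OF M, where m = m])
      fix x assume x: "x \<in> space M"
      have "{y. (x, y) \<in> A \<inter> (space M \<times> B)} \<subseteq> {y. (x, y) \<in> A}" by blast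
      then show "finite {y. (x, y) \<in> A \<inter> (space M \<times> B)} \<and> card {y. (x, y) \<in> A \<inter> (space M \<times> B)} \<le> m"
        using card[OF x] by (meson card_mono finite_subset le_trans)
    qed
    moreover have "{x \<in> space M. \<exists>y. (x, y) \<in> A \<inter> (space M \<times> B)} = {x \<in> space M. \<exists>y. (x, y) \<in> A \<and> y \<in> B}"
      by auto
    ultimately show ?thesis by simp
  qed
  define hit where "hit u v x \<longleftrightarrow> (\<exists>y. (x, y) \<in> A \<and> y \<in> {y \<in> space M. starts u (\<phi> y)} \<inter> {y \<in> space M. starts v (\<phi> y)})"
    for u v x
  \<comment> \<open>Says that exactly one point of the section has a code beginning with
    \<open>u\<close>: two such points would be told apart by prefixes \<open>v\<close> and
    \<open>w\<close> of equal length.\<close>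
  define one where "one u x \<longleftrightarrow> hit u u x \<and> \<not> (\<exists>v w. length v = length w \<and> v \<noteq> w \<and> hit u v x \<and> hit u w x)"
    for u x
  have hit_meas: "Measurable.pred M (hit u v)" for u v
    unfolding pred_def hit_def by (rule proj) (intro sets.Int U_sets)
  have [measurable]: "Measurable.pred M (one u)" for u
    unfolding one_def using hit_meas by measurable
  have one: "\<exists>!y. (x, y) \<in> A \<and> starts u (\<phi> y)" if "one u x" for u x
  proof -
    obtain y where y: "(x, y) \<in> A" "starts u (\<phi> y)" using \<open>one u x\<close> by (auto simp: one_def hit_def)
    have "y' = y" if y': "(x, y') \<in> A" "starts u (\<phi> y')" for y'
    proof (rule ccontr)
      assume "y' \<noteq> y"
      then have "\<phi> y' \<noteq> \<phi> y" using inj_onD[OF \<phi>(2)] y y' AM by blast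
      then obtain i where i: "\<phi> y' i \<noteq> \<phi> y i" by auto
      define v where "v z = map (\<phi> z) [0..<Suc i]" for z
      have "v y' \<noteq> v y" using i by (auto simp: v_def)
      moreover have "hit u (v z) x" if "(x, z) \<in> A" "starts u (\<phi> z)" for z
        using that AM unfolding hit_def by (intro exI[of _ z]) (auto simp: v_def starts_def simp del: upt_Suc)
      moreover have "length (v y') = length (v y)" by (simp add: v_def)
      ultimately show False using \<open>one u x\<close> y y' unfolding one_def by blast
    qed
    then show ?thesis using y by blast
  qed
  have ex_one: "\<exists>u. one u x" if x: "x \<in> space M" and ex: "\<exists>y. (x, y) \<in> A" for x
  proof -
    obtain y where y: "(x, y) \<in> A" using ex by blast
    \<comment> \<open>The place where the code of \<open>z\<close> first leaves that of
      \<open>y\<close>. At \<open>z = y\<close> the value is arbitrary and can only make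
      \<open>u\<close> longer.\<close>
    define d where "d z = (LEAST i. \<phi> z i \<noteq> \<phi> y i)" for z
    define N where "N = Suc (\<Sum>z\<in>{z. (x, z) \<in> A}. d z)"
    define u where "u = map (\<phi> y) [0..<N]"
    have uniq: "z = y" if z: "(x, z) \<in> A" "starts u (\<phi> z)" for z
    proof (rule ccontr)
      assume "z \<noteq> y"
      then have "\<phi> z \<noteq> \<phi> y" using inj_onD[OF \<phi>(2)] y z AM by blast
      then have "\<exists>i. \<phi> z i \<noteq> \<phi> y i" by auto
      then have "\<phi> z (d z) \<noteq> \<phi> y (d z)" unfolding d_def by (rule LeastI_ex)
      moreover have "d z < N" unfolding N_def using card[OF x] z member_le_sum[of z _ d]
        by (simp add: le_imp_less_Suc)
      ultimately show False using z(2) by (auto simp: u_def starts_def)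
    qed
    have "hit u u x" unfolding hit_def using y AM by (intro exI[of _ y]) (auto simp: u_def starts_def)
    moreover have "v = w" if "length v = length w" "hit u v x" "hit u w x" for v w
    proof -
      have "starts v (\<phi> y)" "starts w (\<phi> y)" using that(2,3) uniq unfolding hit_def by blast+
      then show ?thesis using that(1) by (intro nth_equalityI) (auto simp: starts_def)
    qed
    ultimately show ?thesis unfolding one_def by blast
  qed
  define first where "first u x \<longleftrightarrow> one u x \<and> (\<forall>v. to_nat v < to_nat u \<longrightarrow> \<not> one v x)" for u :: "nat list" and x
  have [measurable]: "Measurable.pred M (first u)" for u
    unfolding first_def by measurable
  have ex_first: "\<exists>u. first u x" if "one v x" for v x
    using ex_has_least_nat[of "\<lambda>u. one u x" v to_nat] that unfolding first_def by (metis linorder_not_less)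
  have first_unique: "u = v" if "first u x" "first v x" for u v x
    using that unfolding first_def by (metis linorder_neqE_nat to_nat_split)
  define g where "g x = (if \<exists>u. one u x then THE y. \<exists>u. first u x \<and> (x, y) \<in> A \<and> starts u (\<phi> y) else x)" for x
  have g_eq: "g x = y" if "first u x" "(x, y) \<in> A" "starts u (\<phi> y)" for u x y
  proof -
    have o: "one u x" using that(1) by (simp add: first_def)
    have "(THE y. \<exists>u. first u x \<and> (x, y) \<in> A \<and> starts u (\<phi> y)) = y"
    proof (rule the_equality)
      show "\<exists>u. first u x \<and> (x, y) \<in> A \<and> starts u (\<phi> y)" using that by blast
      fix z assume "\<exists>u. first u x \<and> (x, z) \<in> A \<and> starts u (\<phi> z)"
      then obtain v where v: "first v x" "(x, z) \<in> A" "starts v (\<phi> z)" by blast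
      have "v = u" using first_unique[OF v(1) that(1)] .
      then show "z = y" using one[OF o] v that by blast
    qed
    then show ?thesis unfolding g_def using o by auto
  qed
  have g: "if \<exists>y. (x, y) \<in> A then (x, g x) \<in> A else g x = x" if x: "x \<in> space M" for x
  proof (cases "\<exists>y. (x, y) \<in> A")
    case True
    then obtain u where u: "first u x" using ex_one[OF x] ex_first by blast
    then obtain y where "(x, y) \<in> A" "starts u (\<phi> y)" using one[of u x] by (auto simp: first_def)
    then show ?thesis using g_eq[OF u] True by simp
  next
    case False
    then have "\<not> one u x" for u using one[of u x] by blast
    then show ?thesis using False by (simp add: g_def)
  qed
  have "g \<in> measurable M M"
  proof (rule measurableI)
    fix x assume "x \<in> space M"
    then show "g x \<in> space M" using g[of x] AM by (auto split: if_splits)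
  next
    fix B assume B: "B \<in> sets M"
    have [measurable]: "Measurable.pred M (\<lambda>x. \<exists>y. (x, y) \<in> A \<and> y \<in> {y \<in> space M. starts u (\<phi> y)} \<inter> B)" for u
      unfolding pred_def by (rule proj) (intro sets.Int U_sets B)
    have "{x \<in> space M. (\<exists>u. first u x \<and> (\<exists>y. (x, y) \<in> A \<and> y \<in> {y \<in> space M. starts u (\<phi> y)} \<inter> B)) \<or>
        ((\<forall>u. \<not> one u x) \<and> x \<in> B)} \<in> sets M"
      using B by measurable
    moreover have "g x \<in> B \<longleftrightarrow> (\<exists>u. first u x \<and> (\<exists>y. (x, y) \<in> A \<and> y \<in> {y \<in> space M. starts u (\<phi> y)} \<inter> B)) \<or>
        ((\<forall>u. \<not> one u x) \<and> x \<in> B)" if x: "x \<in> space M" for x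
    proof (cases "\<exists>u. one u x")
      case True
      then obtain u where u: "first u x" using ex_first by blast
      then obtain y where y: "(x, y) \<in> A" "starts u (\<phi> y)" using one[of u x] by (auto simp: first_def)
      have gy: "g x = y" by (rule g_eq[OF u y])
      have "(\<exists>u. first u x \<and> (\<exists>y. (x, y) \<in> A \<and> y \<in> {y \<in> space M. starts u (\<phi> y)} \<inter> B)) \<longleftrightarrow> y \<in> B"
      proof
        assume "\<exists>u. first u x \<and> (\<exists>y. (x, y) \<in> A \<and> y \<in> {y \<in> space M. starts u (\<phi> y)} \<inter> B)"
        then obtain v z where "first v x" "(x, z) \<in> A" "starts v (\<phi> z)" "z \<in> B" by blast
        then show "y \<in> B" using g_eq[of v x z] gy by simp
      next
        assume "y \<in> B"
        then show "\<exists>u. first u x \<and> (\<exists>y. (x, y) \<in> A \<and> y \<in> {y \<in> space M. starts u (\<phi> y)} \<inter> B)"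
          using u y AM by blast
      qed
      then show ?thesis using True unfolding gy by blast
    next
      case False
      then have "\<not> first u x" for u unfolding first_def by blast
      then show ?thesis using False by (simp add: g_def)
    qed
    moreover from this have "g -` B \<inter> space M = {x \<in> space M.
        (\<exists>u. first u x \<and> (\<exists>y. (x, y) \<in> A \<and> y \<in> {y \<in> space M. starts u (\<phi> y)} \<inter> B)) \<or>
        ((\<forall>u. \<not> one u x) \<and> x \<in> B)}"
      by blast
    ultimately show "g -` B \<inter> space M \<in> sets M" by (simp only:)
  qed
  then show ?thesis using g by blast
qed

text \<open>A selected point is removed from its section, which lowers the bound by one. Once a
  section is exhausted, the remaining functions stay at \<open>x\<close>.\<close>

lemma standard_borel_enumeration:
  assumes M: "standard_borel M" and A: "A \<in> sets (M \<Otimes>\<^sub>M M)"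
    and card: "\<And>x. x \<in> space M \<Longrightarrow> finite {y. (x, y) \<in> A} \<and> card {y. (x, y) \<in> A} \<le> m"
  shows "\<exists>g :: nat \<Rightarrow> 'a \<Rightarrow> 'a. (\<forall>i<m. g i \<in> measurable M M) \<and>
    (\<forall>x\<in>space M. (\<forall>y. (x, y) \<in> A \<longrightarrow> (\<exists>i<m. g i x = y)) \<and> (\<forall>i<m. (x, g i x) \<in> A \<or> g i x = x))"
  using A card
proof (induction m arbitrary: A)
  case 0
  have "{y. (x, y) \<in> A} = {}" if "x \<in> space M" for x
  proof -
    have "finite {y. (x, y) \<in> A}" "card {y. (x, y) \<in> A} = 0" using 0(2)[OF that] by simp_all
    then show ?thesis by (simp only: card_0_eq)
  qed
  then show ?case by (auto intro!: exI[of _ "\<lambda>_ x. x"])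
next
  case (Suc m)
  obtain h where h[measurable]: "h \<in> measurable M M"
    and hA: "\<And>x. x \<in> space M \<Longrightarrow> if \<exists>y. (x, y) \<in> A then (x, h x) \<in> A else h x = x"
    using standard_borel_selection[OF M Suc.prems(1) Suc.prems(2)] by blast
  define A' where "A' = A - {z \<in> space (M \<Otimes>\<^sub>M M). h (fst z) = snd z}"
  have AM: "A \<subseteq> space (M \<Otimes>\<^sub>M M)" using sets.sets_into_space[OF Suc.prems(1)] .
  have "Measurable.pred (M \<Otimes>\<^sub>M M) (\<lambda>z. h (fst z) = snd z)"
    by (rule standard_borel_equality[OF M]) measurable
  then have A'_sets: "A' \<in> sets (M \<Otimes>\<^sub>M M)" unfolding A'_def pred_def using Suc.prems(1) by auto
  have sec: "{y. (x, y) \<in> A'} = {y. (x, y) \<in> A} - {h x}" for x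
    using AM by (auto simp: A'_def)
  have "finite {y. (x, y) \<in> A'} \<and> card {y. (x, y) \<in> A'} \<le> m" if x: "x \<in> space M" for x
  proof (cases "\<exists>y. (x, y) \<in> A")
    case True
    then have "h x \<in> {y. (x, y) \<in> A}" using hA[OF x] by simp
    then have "card ({y. (x, y) \<in> A} - {h x}) = card {y. (x, y) \<in> A} - 1"
      by (rule card_Diff_singleton)
    moreover have "finite {y. (x, y) \<in> A}" "card {y. (x, y) \<in> A} \<le> Suc m"
      using Suc.prems(2)[OF x] by simp_all
    ultimately show ?thesis unfolding sec by (intro conjI finite_Diff) linarith+
  next
    case False
    then have "{y. (x, y) \<in> A'} = {}" unfolding sec by blast
    then show ?thesis by (metis card.empty finite.emptyI le0)
  qed
  from Suc.IH[OF A'_sets this] obtain g :: "nat \<Rightarrow> 'a \<Rightarrow> 'a"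
    where g: "\<And>i. i < m \<Longrightarrow> g i \<in> measurable M M"
      "\<And>x y. x \<in> space M \<Longrightarrow> (x, y) \<in> A' \<Longrightarrow> \<exists>i<m. g i x = y"
      "\<And>x i. x \<in> space M \<Longrightarrow> i < m \<Longrightarrow> (x, g i x) \<in> A' \<or> g i x = x" by blast
  show ?case
  proof (intro exI[of _ "g(m := h)"] conjI ballI allI impI)
    fix i assume "i < Suc m"
    then show "(g(m := h)) i \<in> measurable M M" using g(1)[of i] h by (cases "i = m") auto
  next
    fix x y assume xy: "x \<in> space M" "(x, y) \<in> A"
    show "\<exists>i<Suc m. (g(m := h)) i x = y"
    proof (cases "y = h x")
      case True
      then show ?thesis by (intro exI[of _ m]) simp
    next
      case False
      then have "(x, y) \<in> A'" using sec[of x] xy by blast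
      then obtain i where "i < m" "g i x = y" using g(2)[OF xy(1)] by blast
      then show ?thesis by (intro exI[of _ i]) simp
    qed
  next
    fix x i assume "x \<in> space M" "i < Suc m"
    then show "(x, (g(m := h)) i x) \<in> A \<or> (g(m := h)) i x = x"
      using g(3)[of x i] hA[of x] by (cases "i = m") (auto simp: A'_def split: if_splits)
  qed
qed

text \<open>The codes \<open>c\<close> name the points \<open>z c\<close> redundantly. Dividing by
  the number of codes of a point, with \<open>w n\<close> as the inverse of \<open>n\<close>, turns
  a sum over a varying set into one over a fixed index set, where measurability is easy and no
  representative has to be chosen.\<close>

lemma sum_image_weight:
  fixes F :: "'b \<Rightarrow> 'c :: comm_semiring_1"
  assumes "finite C" and w: "\<And>n. n > 0 \<Longrightarrow> of_nat n * w n = 1"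
  shows "(\<Sum>y\<in>z ` {c \<in> C. P c}. F y) =
    (\<Sum>c\<in>C. if P c then w (card {c' \<in> C. P c' \<and> z c' = z c}) * F (z c) else 0)"
proof -
  let ?C = "{c \<in> C. P c}"
  have fin: "finite ?C" using assms(1) by simp
  have "(\<Sum>c\<in>C. if P c then w (card {c' \<in> C. P c' \<and> z c' = z c}) * F (z c) else 0) =
      (\<Sum>c\<in>?C. w (card {c' \<in> C. P c' \<and> z c' = z c}) * F (z c))"
    using assms(1) by (simp add: sum.inter_filter)
  also have "\<dots> = (\<Sum>y\<in>z ` ?C. \<Sum>c | c \<in> ?C \<and> z c = y. w (card {c' \<in> C. P c' \<and> z c' = z c}) * F (z c))"
    by (rule sum.image_gen[OF fin])
  also have "\<dots> = (\<Sum>y\<in>z ` ?C. F y)"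
  proof (rule sum.cong[OF refl])
    fix y assume y: "y \<in> z ` ?C"
    let ?D = "{c. c \<in> ?C \<and> z c = y}"
    have D: "finite ?D" using fin by (rule rev_finite_subset) auto
    have D': "?D \<noteq> {}" using y by auto
    have eqD: "{c' \<in> C. P c' \<and> z c' = y} = ?D" by auto
    have "(\<Sum>c\<in>?D. w (card {c' \<in> C. P c' \<and> z c' = z c}) * F (z c)) = (\<Sum>c\<in>?D. w (card ?D) * F y)"
    proof (rule sum.cong[OF refl])
      fix c assume "c \<in> ?D"
      then have "z c = y" by blast
      then show "w (card {c' \<in> C. P c' \<and> z c' = z c}) * F (z c) = w (card ?D) * F y"
        by (simp only: eqD)
    qed
    also have "\<dots> = of_nat (card ?D) * w (card ?D) * F y" by (simp add: mult.assoc)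
    also have "\<dots> = F y" using w[of "card ?D"] D D' by (simp add: card_gt_0_iff)
    finally show "(\<Sum>c\<in>?D. w (card {c' \<in> C. P c' \<and> z c' = z c}) * F (z c)) = F y" .
  qed
  finally show ?thesis by simp
qed

lemma of_nat_mult_ennreal_inverse: "n > 0 \<Longrightarrow> of_nat n * ennreal (1 / real n) = 1"
  by (simp add: ennreal_of_nat_eq_real_of_nat ennreal_mult'[symmetric])

text \<open>The image of a density on the product of \<open>M\<close> with the counting measure on
  \<open>C\<close>. Having a measure and not just a functional allows uniqueness on a generator to
  be used, as in \<open>edge_transport\<close>.\<close>

lemma exists_sum_kernel:
  assumes C: "finite C" and T: "\<And>c. c \<in> C \<Longrightarrow> T c \<in> measurable M N"
    and u: "\<And>c. c \<in> C \<Longrightarrow> u c \<in> borel_measurable M"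
  shows "\<exists>K. sets K = sets N \<and>
    (\<forall>f\<in>borel_measurable N. (\<integral>\<^sup>+y. f y \<partial>K) = (\<integral>\<^sup>+x. (\<Sum>c\<in>C. u c x * f (T c x)) \<partial>M))"
proof -
  let ?P = "M \<Otimes>\<^sub>M count_space C"
  have countable: "countable C" using C by (rule countable_finite)
  interpret C: sigma_finite_measure "count_space C"
    by (rule sigma_finite_measure_count_space_countable[OF countable])
  have Tm[measurable]: "(\<lambda>w. T (snd w) (fst w)) \<in> measurable ?P N"
    by (rule measurable_compose_countable'[where I = C])
      (use T countable in \<open>auto intro: measurable_compose[OF measurable_fst]\<close>)
  have um[measurable]: "(\<lambda>w. u (snd w) (fst w)) \<in> borel_measurable ?P"
    by (rule measurable_compose_countable'[where I = C])
      (use u countable in \<open>auto intro: measurable_compose[OF measurable_fst]\<close>)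
  define K where "K = distr (density ?P (\<lambda>w. u (snd w) (fst w))) N (\<lambda>w. T (snd w) (fst w))"
  have "(\<integral>\<^sup>+y. f y \<partial>K) = (\<integral>\<^sup>+x. (\<Sum>c\<in>C. u c x * f (T c x)) \<partial>M)"
    if f[measurable]: "f \<in> borel_measurable N" for f
  proof -
    have "(\<integral>\<^sup>+y. f y \<partial>K) = (\<integral>\<^sup>+w. u (snd w) (fst w) * f (T (snd w) (fst w)) \<partial>?P)"
      unfolding K_def by (subst nn_integral_distr) (auto simp: nn_integral_density)
    also have "\<dots> = (\<integral>\<^sup>+x. \<integral>\<^sup>+c. u c x * f (T c x) \<partial>count_space C \<partial>M)"
      by (subst C.nn_integral_fst[symmetric]) auto
    also have "\<dots> = (\<integral>\<^sup>+x. (\<Sum>c\<in>C. u c x * f (T c x)) \<partial>M)"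
      using C by (simp add: nn_integral_count_space_finite)
    finally show ?thesis .
  qed
  then show ?thesis by (intro exI[of _ K]) (simp add: K_def)
qed

section \<open>Balls in a graph\<close>

lemma ball_nodes_0: "ball_nodes E x 0 = {x}"
  by (auto simp: ball_nodes_def)

lemma ball_nodes_Suc: "ball_nodes E x (Suc r) = ball_nodes E x r \<union> {z. \<exists>y\<in>ball_nodes E x r. (y, z) \<in> E}"
proof (intro equalityI subsetI)
  fix z assume "z \<in> ball_nodes E x (Suc r)"
  then obtain n where n: "n \<le> Suc r" "(x, z) \<in> E ^^ n" by (auto simp: ball_nodes_def)
  show "z \<in> ball_nodes E x r \<union> {z. \<exists>y\<in>ball_nodes E x r. (y, z) \<in> E}"
  proof (cases "n \<le> r")
    case True
    then show ?thesis using n(2) by (auto simp: ball_nodes_def)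
  next
    case False
    then have "n = Suc r" using n(1) by simp
    then obtain y where "(x, y) \<in> E ^^ r" "(y, z) \<in> E" using n(2) by auto
    then show ?thesis by (auto simp: ball_nodes_def)
  qed
next
  fix z assume "z \<in> ball_nodes E x r \<union> {z. \<exists>y\<in>ball_nodes E x r. (y, z) \<in> E}"
  then consider "z \<in> ball_nodes E x r" | y n where "n \<le> r" "(x, y) \<in> E ^^ n" "(y, z) \<in> E"
    by (auto simp: ball_nodes_def)
  then show "z \<in> ball_nodes E x (Suc r)"
  proof cases
    case 1
    then show ?thesis unfolding ball_nodes_def using le_SucI by blast
  next
    case 2
    then have "(x, z) \<in> E ^^ Suc n" "Suc n \<le> Suc r" by auto
    then show ?thesis unfolding ball_nodes_def by blast
  qed
qed

lemma ball_nodes_mono: "r \<le> s \<Longrightarrow> ball_nodes E x r \<subseteq> ball_nodes E x s"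
  unfolding ball_nodes_def by (blast intro: le_trans)

lemma ball_nodes_refl [simp]: "x \<in> ball_nodes E x r"
  using ball_nodes_mono[of 0 r E x] by (auto simp: ball_nodes_0)

lemma ball_nodes_trans:
  assumes "y \<in> ball_nodes E x r" "z \<in> ball_nodes E y s"
  shows "z \<in> ball_nodes E x (r + s)"
  using assms(2)
proof (induction s arbitrary: z)
  case 0
  then show ?case using assms(1) by (simp add: ball_nodes_0)
next
  case (Suc s)
  then show ?case by (fastforce simp: ball_nodes_Suc)
qed

lemma ball_nodes_sym:
  assumes "sym E" "y \<in> ball_nodes E x r"
  shows "x \<in> ball_nodes E y r"
  using assms(2)
proof (induction r arbitrary: y)
  case 0
  then show ?case by (simp add: ball_nodes_0)
next
  case (Suc r)
  show ?case
  proof (cases "y \<in> ball_nodes E x r")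
    case True
    then show ?thesis using Suc.IH ball_nodes_mono[of r "Suc r" E y] by auto
  next
    case False
    then obtain z where z: "z \<in> ball_nodes E x r" "(z, y) \<in> E" using Suc.prems by (auto simp: ball_nodes_Suc)
    then have "z \<in> ball_nodes E y 1"
      using symD[OF assms(1)] by (auto simp: ball_nodes_Suc ball_nodes_0)
    then show ?thesis using ball_nodes_trans[OF _ Suc.IH[OF z(1)]] by fastforce
  qed
qed

lemma card_pred_measurable:
  assumes "finite C" "\<And>c. c \<in> C \<Longrightarrow> Measurable.pred N (P c)"
  shows "(\<lambda>x. card {c \<in> C. P c x}) \<in> measurable N (count_space UNIV)"
proof -
  have "card {c \<in> C. P c x} = (\<Sum>c\<in>C. if P c x then 1 else 0)" for x
    using assms(1) by (simp add: sum.inter_filter[symmetric])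
  moreover have "(\<lambda>x. \<Sum>c\<in>C. if P c x then 1 else 0 :: nat) \<in> measurable N (count_space UNIV)"
    using assms(1,2)
  proof (induction C rule: finite_induct)
    case (insert c C)
    have [measurable]: "Measurable.pred N (P c)" using insert by simp
    have [measurable]: "(\<lambda>x. \<Sum>c\<in>C. if P c x then 1 else 0 :: nat) \<in> measurable N (count_space UNIV)"
      using insert by simp
    show ?case using insert(1,2) by simp
  qed simp
  ultimately show ?thesis by simp
qed

section \<open>Neighbor functions, walks and transport across edges\<close>

context graphing
begin

lemma E_space: "(x, y) \<in> E \<Longrightarrow> x \<in> space M \<and> y \<in> space M"
  using sets.sets_into_space[OF edges_borel] by (auto simp: space_pair_measure)

lemma nbrs_bound: "x \<in> space M \<Longrightarrow> finite {y. (x, y) \<in> E} \<and> card {y. (x, y) \<in> E} \<le> D"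
proof -
  assume "x \<in> space M"
  moreover have "{y \<in> space M. (x, y) \<in> E} = {y. (x, y) \<in> E}" using E_space by blast
  ultimately show ?thesis using degree_bound[of x] by (simp add: deg_def)
qed

text \<open>Staying at \<open>x\<close> is the default that makes every \<open>neighbor i\<close>
  total on the nodes without leaving the ball. Distinct indices may give the same neighbor, hence
  the multiplicities in the sums below.\<close>

definition neighbor :: "nat \<Rightarrow> 'a \<Rightarrow> 'a" where
  "neighbor = (SOME g. (\<forall>i. g i \<in> measurable M M) \<and>
    (\<forall>x\<in>space M. (\<forall>y. (x, y) \<in> E \<longrightarrow> (\<exists>i<D. g i x = y)) \<and> (\<forall>i. (x, g i x) \<in> E \<or> g i x = x)))"

lemma neighbor: "(\<forall>i. neighbor i \<in> measurable M M) \<and>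
    (\<forall>x\<in>space M. (\<forall>y. (x, y) \<in> E \<longrightarrow> (\<exists>i<D. neighbor i x = y)) \<and> (\<forall>i. (x, neighbor i x) \<in> E \<or> neighbor i x = x))"
proof -
  obtain g :: "nat \<Rightarrow> 'a \<Rightarrow> 'a" where g: "\<forall>i<D. g i \<in> measurable M M"
    "\<forall>x\<in>space M. (\<forall>y. (x, y) \<in> E \<longrightarrow> (\<exists>i<D. g i x = y)) \<and> (\<forall>i<D. (x, g i x) \<in> E \<or> g i x = x)"
    using standard_borel_enumeration[OF standard edges_borel nbrs_bound] by blast
  show ?thesis unfolding neighbor_def
  proof (rule someI[of _ "\<lambda>i. if i < D then g i else (\<lambda>x. x)"], intro conjI allI ballI impI)
    fix x y assume "x \<in> space M" "(x, y) \<in> E"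
    then obtain i where "i < D" "g i x = y" using g by blast
    then show "\<exists>i<D. (if i < D then g i else (\<lambda>x. x)) x = y" by auto
  qed (use g in auto)
qed

lemma neighbor_meas [measurable]: "neighbor i \<in> measurable M M" using neighbor by blast

lemma neighbor_cover: "(x, y) \<in> E \<Longrightarrow> \<exists>i<D. neighbor i x = y" using neighbor E_space by blast

lemma neighbor_edge: "x \<in> space M \<Longrightarrow> (x, neighbor i x) \<in> E \<or> neighbor i x = x" using neighbor by blast

lemma eq_pred [measurable (raw)]:
  "f \<in> measurable N M \<Longrightarrow> g \<in> measurable N M \<Longrightarrow> Measurable.pred N (\<lambda>x. f x = g x)"
  by (rule standard_borel_equality[OF standard])

lemma edge_pred [measurable (raw)]:
  assumes [measurable]: "f \<in> measurable N M" "g \<in> measurable N M"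
  shows "Measurable.pred N (\<lambda>x. (f x, g x) \<in> E)"
  using edges_borel by measurable

fun walk :: "nat list \<Rightarrow> 'a \<Rightarrow> 'a" where
  "walk [] x = x" |
  "walk (i # l) x = neighbor i (walk l x)"

lemma walk_meas [measurable]: "walk l \<in> measurable M M"
proof (induction l)
  case Nil
  have "walk [] = (\<lambda>x. x)" by auto
  then show ?case by simp
next
  case (Cons i l)
  have "walk (i # l) = (\<lambda>x. neighbor i (walk l x))" by auto
  then show ?case using measurable_compose[OF Cons neighbor_meas] by simp
qed

lemma walk_space: "x \<in> space M \<Longrightarrow> walk l x \<in> space M"
  using measurable_space[OF walk_meas] by blast

definition words :: "nat \<Rightarrow> nat list set" where
  "words r = {l. set l \<subseteq> {..<D} \<and> length l \<le> r}"

lemma finite_words [simp]: "finite (words r)"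
  unfolding words_def by (rule finite_lists_length_le) simp

lemma ball_words:
  assumes x: "x \<in> space M"
  shows "ball_nodes E x r = (\<lambda>l. walk l x) ` words r"
proof (induction r)
  case 0
  have "words 0 = {[]}" by (auto simp: words_def)
  then show ?case by (simp add: ball_nodes_0)
next
  case (Suc r)
  show ?case
  proof (intro equalityI subsetI)
    fix z assume "z \<in> ball_nodes E x (Suc r)"
    then consider "z \<in> ball_nodes E x r" | y where "y \<in> ball_nodes E x r" "(y, z) \<in> E"
      by (auto simp: ball_nodes_Suc)
    then show "z \<in> (\<lambda>l. walk l x) ` words (Suc r)"
    proof cases
      case 1
      then show ?thesis unfolding Suc by (auto simp: words_def)
    next
      case 2
      then obtain l where l: "y = walk l x" "l \<in> words r" unfolding Suc by blast
      obtain i where "i < D" "neighbor i y = z" using neighbor_cover[OF 2(2)] by blast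
      then have "z = walk (i # l) x" "i # l \<in> words (Suc r)" using l by (auto simp: words_def)
      then show ?thesis by blast
    qed
  next
    fix z assume "z \<in> (\<lambda>l. walk l x) ` words (Suc r)"
    then obtain l where l: "z = walk l x" "l \<in> words (Suc r)" by blast
    show "z \<in> ball_nodes E x (Suc r)"
    proof (cases l)
      case Nil
      then show ?thesis using l by simp
    next
      case (Cons i l')
      have "walk l' x \<in> ball_nodes E x r" unfolding Suc using l Cons by (auto simp: words_def)
      then show ?thesis using neighbor_edge[OF walk_space[OF x], of l' i] l Cons by (auto simp: ball_nodes_Suc)
    qed
  qed
qed

lemma finite_ball [simp]: "x \<in> space M \<Longrightarrow> finite (ball_nodes E x r)"
  by (simp add: ball_words)

lemma ball_space: "x \<in> space M \<Longrightarrow> y \<in> ball_nodes E x r \<Longrightarrow> y \<in> space M"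
  by (auto simp: ball_words walk_space)

lemma ball_sym: "y \<in> ball_nodes E x r \<longleftrightarrow> x \<in> ball_nodes E y r"
  using ball_nodes_sym[OF edges_sym] by blast

lemma nbrs_neighbor:
  assumes "x \<in> space M"
  shows "{y. (x, y) \<in> E} = (\<lambda>i. neighbor i x) ` {i \<in> {..<D}. (x, neighbor i x) \<in> E}"
  using neighbor_cover by force

text \<open>\<open>h\<close> expresses \<open>T\<close> through the endpoints of an edge, so that
  one lemma serves both orientations.\<close>

lemma edge_sum_kernel:
  assumes T: "\<And>i. T i \<in> measurable M (M \<Otimes>\<^sub>M M)"
    and TT: "\<And>x i. x \<in> space M \<Longrightarrow> T i x = h x (neighbor i x)"
  shows "\<exists>K. sets K = sets (M \<Otimes>\<^sub>M M) \<and> (\<forall>f\<in>borel_measurable (M \<Otimes>\<^sub>M M).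
    (\<integral>\<^sup>+z. f z \<partial>K) = (\<integral>\<^sup>+x. (\<Sum>y\<in>{y. (x, y) \<in> E}. f (h x y)) \<partial>M))"
proof -
  define mult where "mult i x = card {j \<in> {..<D}. (x, neighbor j x) \<in> E \<and> neighbor j x = neighbor i x}" for i x
  have [measurable]: "mult i \<in> measurable M (count_space UNIV)" for i
    unfolding mult_def by (rule card_pred_measurable) auto
  define u where "u i x = (if (x, neighbor i x) \<in> E then ennreal (1 / real (mult i x)) else 0)" for i x
  have "u i \<in> borel_measurable M" for i unfolding u_def by measurable
  from exists_sum_kernel[of "{..<D}" T M "M \<Otimes>\<^sub>M M" u, OF _ T this]
  obtain K where K: "sets K = sets (M \<Otimes>\<^sub>M M)" "\<And>f. f \<in> borel_measurable (M \<Otimes>\<^sub>M M) \<Longrightarrow>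
    (\<integral>\<^sup>+z. f z \<partial>K) = (\<integral>\<^sup>+x. (\<Sum>i<D. u i x * f (T i x)) \<partial>M)" by auto
  have "(\<Sum>i<D. u i x * f (T i x)) = (\<Sum>y\<in>{y. (x, y) \<in> E}. f (h x y))"
    if x: "x \<in> space M" for x and f :: "'a \<times> 'a \<Rightarrow> ennreal"
    unfolding nbrs_neighbor[OF x]
    by (subst sum_image_weight[where w = "\<lambda>n. ennreal (1 / real n)"])
      (auto simp: of_nat_mult_ennreal_inverse u_def mult_def TT[OF x] intro!: sum.cong)
  then have "(\<integral>\<^sup>+x. (\<Sum>i<D. u i x * f (T i x)) \<partial>M) = (\<integral>\<^sup>+x. (\<Sum>y\<in>{y. (x, y) \<in> E}. f (h x y)) \<partial>M)"
    for f :: "'a \<times> 'a \<Rightarrow> ennreal"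
    by (rule nn_integral_cong)
  then show ?thesis using K by auto
qed

text \<open>Both sides are integrals against measures on pairs. These agree on rectangles by
  \<open>mass_transport\<close>, and the degree bound makes them finite, so they coincide.\<close>

lemma edge_transport:
  assumes f: "f \<in> borel_measurable (M \<Otimes>\<^sub>M M)"
  shows "(\<integral>\<^sup>+x. (\<Sum>y\<in>{y. (x, y) \<in> E}. f (x, y)) \<partial>M) =
    (\<integral>\<^sup>+x. (\<Sum>y\<in>{y. (x, y) \<in> E}. f (y, x)) \<partial>M)"
proof -
  obtain K where K: "sets K = sets (M \<Otimes>\<^sub>M M)" "\<And>f. f \<in> borel_measurable (M \<Otimes>\<^sub>M M) \<Longrightarrow>
      (\<integral>\<^sup>+z. f z \<partial>K) = (\<integral>\<^sup>+x. (\<Sum>y\<in>{y. (x, y) \<in> E}. f (x, y)) \<partial>M)"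
    using edge_sum_kernel[of "\<lambda>i x. (x, neighbor i x)" "\<lambda>x y. (x, y)"] by auto
  obtain L where L: "sets L = sets (M \<Otimes>\<^sub>M M)" "\<And>f. f \<in> borel_measurable (M \<Otimes>\<^sub>M M) \<Longrightarrow>
      (\<integral>\<^sup>+z. f z \<partial>L) = (\<integral>\<^sup>+x. (\<Sum>y\<in>{y. (x, y) \<in> E}. f (y, x)) \<partial>M)"
    using edge_sum_kernel[of "\<lambda>i x. (neighbor i x, x)" "\<lambda>x y. (y, x)"] by auto
  have deg_sum: "(\<Sum>y\<in>{y. (x, y) \<in> E}. indicator B y) = (of_nat (deg E B x) :: ennreal)"
    if "x \<in> space M" for x B
  proof -
    have "(\<Sum>y\<in>{y. (x, y) \<in> E}. indicator B y :: ennreal) = of_nat (card ({y. (x, y) \<in> E} \<inter> B))"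
      using nbrs_bound[OF that] by (simp add: indicator_def sum.If_cases)
    also have "{y. (x, y) \<in> E} \<inter> B = {y \<in> B. (x, y) \<in> E}" by blast
    finally show ?thesis by (simp add: deg_def)
  qed
  have K_rect: "emeasure K (A \<times> B) = (\<integral>\<^sup>+x\<in>A. of_nat (deg E B x) \<partial>M)"
    and L_rect: "emeasure L (A \<times> B) = (\<integral>\<^sup>+x\<in>B. of_nat (deg E A x) \<partial>M)"
    if [measurable]: "A \<in> sets M" "B \<in> sets M" for A B
  proof -
    have AB: "A \<times> B \<in> sets (M \<Otimes>\<^sub>M M)" by measurable
    have "emeasure K (A \<times> B) = (\<integral>\<^sup>+z. indicator (A \<times> B) z \<partial>K)" using AB K(1) by simp
    also have "\<dots> = (\<integral>\<^sup>+x. (\<Sum>y\<in>{y. (x, y) \<in> E}. indicator (A \<times> B) (x, y)) \<partial>M)"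
      using AB by (intro K(2)) auto
    also have "\<dots> = (\<integral>\<^sup>+x\<in>A. of_nat (deg E B x) \<partial>M)"
      by (rule nn_integral_cong)
        (simp add: indicator_times sum_distrib_left[symmetric] deg_sum mult.commute)
    finally show "emeasure K (A \<times> B) = (\<integral>\<^sup>+x\<in>A. of_nat (deg E B x) \<partial>M)" .
    have "emeasure L (A \<times> B) = (\<integral>\<^sup>+z. indicator (A \<times> B) z \<partial>L)" using AB L(1) by simp
    also have "\<dots> = (\<integral>\<^sup>+x. (\<Sum>y\<in>{y. (x, y) \<in> E}. indicator (A \<times> B) (y, x)) \<partial>M)"
      using AB by (intro L(2)) auto
    also have "\<dots> = (\<integral>\<^sup>+x\<in>B. of_nat (deg E A x) \<partial>M)"
      by (rule nn_integral_cong)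
        (simp add: indicator_times sum_distrib_right[symmetric] deg_sum)
    finally show "emeasure L (A \<times> B) = (\<integral>\<^sup>+x\<in>B. of_nat (deg E A x) \<partial>M)" .
  qed
  have "K = L"
  proof (rule measure_eqI_generator_eq[where E = "{a \<times> b |a b. a \<in> sets M \<and> b \<in> sets M}"
        and \<Omega> = "space M \<times> space M" and A = "\<lambda>_. space M \<times> space M"])
    show "Int_stable {a \<times> b |a b. a \<in> sets M \<and> b \<in> sets M}" by (rule Int_stable_pair_measure_generator)
    show "{a \<times> b |a b. a \<in> sets M \<and> b \<in> sets M} \<subseteq> Pow (space M \<times> space M)"
      by (rule pair_measure_closed)
    show "emeasure K X = emeasure L X" if "X \<in> {a \<times> b |a b. a \<in> sets M \<and> b \<in> sets M}" for X
      using that K_rect L_rect mass_transport by auto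
    show "sets K = sigma_sets (space M \<times> space M) {a \<times> b |a b. a \<in> sets M \<and> b \<in> sets M}"
      using K(1) by (simp add: sets_pair_measure)
    show "sets L = sigma_sets (space M \<times> space M) {a \<times> b |a b. a \<in> sets M \<and> b \<in> sets M}"
      using L(1) by (simp add: sets_pair_measure)
    have "emeasure K (space M \<times> space M) \<le> (\<integral>\<^sup>+x. of_nat D \<partial>M)"
      unfolding K_rect[OF sets.top sets.top]
      by (intro nn_integral_mono) (use degree_bound in auto)
    also have "\<dots> = of_nat D" by (simp add: emeasure_space_1)
    finally show "emeasure K (space M \<times> space M) \<noteq> \<infinity>"
      by (metis ennreal_of_nat_neq_top infinity_ennreal_def neq_top_trans)
  qed auto
  then show ?thesis using K(2)[OF f] L(2)[OF f] by simp
qed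

end

section \<open>Mass transport along walks\<close>

text \<open>The condition on \<open>F\<close> includes the test \<open>P c x\<close> because
  \<open>F\<close> need only be controlled where the code \<open>c\<close> is valid.\<close>

lemma measurable_image_sum_ennreal:
  fixes F :: "'x \<Rightarrow> 'y \<Rightarrow> ennreal"
  assumes C: "finite C" and P: "\<And>c. c \<in> C \<Longrightarrow> Measurable.pred N (P c)"
    and z: "\<And>c c'. c \<in> C \<Longrightarrow> c' \<in> C \<Longrightarrow> Measurable.pred N (\<lambda>x. z c' x = z c x)"
    and F: "\<And>c. c \<in> C \<Longrightarrow> (\<lambda>x. if P c x then F x (z c x) else 0) \<in> borel_measurable N"
  shows "(\<lambda>x. \<Sum>y\<in>(\<lambda>c. z c x) ` {c \<in> C. P c x}. F x y) \<in> borel_measurable N"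
proof -
  have [measurable]: "(\<lambda>x. card {c' \<in> C. P c' x \<and> z c' x = z c x}) \<in> measurable N (count_space UNIV)"
    if "c \<in> C" for c
    by (rule card_pred_measurable[OF C]) (use P z that in auto)
  have "(\<lambda>x. if P c x then ennreal (1 / real (card {c' \<in> C. P c' x \<and> z c' x = z c x})) * F x (z c x) else 0)
      \<in> borel_measurable N" if c: "c \<in> C" for c
  proof -
    note [measurable] = F[OF c]
    have "(\<lambda>x. ennreal (1 / real (card {c' \<in> C. P c' x \<and> z c' x = z c x})) * (if P c x then F x (z c x) else 0))
        \<in> borel_measurable N"
      using c by measurable
    then show ?thesis by (simp add: if_distrib cong: if_cong)
  qed
  then have "(\<lambda>x. \<Sum>c\<in>C. if P c x then ennreal (1 / real (card {c' \<in> C. P c' x \<and> z c' x = z c x})) * F x (z c x) else 0)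
      \<in> borel_measurable N" by (rule borel_measurable_sum)
  then show ?thesis
    by (subst sum_image_weight[OF C, where w = "\<lambda>n. ennreal (1 / real n)"])
      (simp_all add: of_nat_mult_ennreal_inverse)
qed

context graphing
begin

text \<open>By symmetry of the edges the start of a walk lies in the \<open>r\<close>-ball of its
  end, so preimages under walks are again named by words.\<close>

lemma preimage_words:
  assumes y: "y \<in> space M" and l: "l \<in> words r"
  shows "{x \<in> space M. walk l x = y} = (\<lambda>w. walk w y) ` {w \<in> words r. walk l (walk w y) = y}"
proof (intro equalityI subsetI)
  fix x assume "x \<in> {x \<in> space M. walk l x = y}"
  then have x: "x \<in> space M" "walk l x = y" by auto
  then have "y \<in> ball_nodes E x r" using ball_words[OF x(1)] l by blast
  then have "x \<in> ball_nodes E y r" using ball_sym by blast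
  then show "x \<in> (\<lambda>w. walk w y) ` {w \<in> words r. walk l (walk w y) = y}"
    using x unfolding ball_words[OF y] by blast
qed (use walk_space[OF y] in auto)

lemma preimage_ball:
  assumes y: "y \<in> space M" and l: "l \<in> words r"
  shows "{x \<in> space M. walk l x = y} = {x \<in> ball_nodes E y r. walk l x = y}"
  unfolding preimage_words[OF assms] unfolding ball_words[OF y] by auto

lemma preimage_sum_measurable:
  assumes f: "f \<in> borel_measurable (M \<Otimes>\<^sub>M M)" and l: "l \<in> words r"
  shows "(\<lambda>v. \<Sum>x\<in>{x \<in> space M. walk l x = fst v}. f (x, snd v) :: ennreal) \<in> borel_measurable (M \<Otimes>\<^sub>M M)"
proof -
  have "(\<lambda>v. \<Sum>x\<in>(\<lambda>w. walk w (fst v)) ` {w \<in> words r. walk l (walk w (fst v)) = fst v}. f (x, snd v))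
      \<in> borel_measurable (M \<Otimes>\<^sub>M M)"
    by (rule measurable_image_sum_ennreal) (use f in \<open>measurable; simp\<close>)+
  moreover have "(\<Sum>x\<in>(\<lambda>w. walk w (fst v)) ` {w \<in> words r. walk l (walk w (fst v)) = fst v}. f (x, snd v)) =
      (\<Sum>x\<in>{x \<in> space M. walk l x = fst v}. f (x, snd v))" if "v \<in> space (M \<Otimes>\<^sub>M M)" for v
    using preimage_words[OF _ l, of "fst v"] that by (simp add: space_pair_measure mem_Times_iff)
  ultimately show ?thesis by (subst measurable_cong[OF sym]) auto
qed

lemma words_Cons: "i # l \<in> words r \<Longrightarrow> i < D \<and> l \<in> words r"
  by (auto simp: words_def)

lemma edge_sum_measurable:
  assumes [measurable]: "f \<in> borel_measurable (M \<Otimes>\<^sub>M M)"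
  shows "(\<lambda>x. \<Sum>y\<in>{y. (x, y) \<in> E}. f (x, y) :: ennreal) \<in> borel_measurable M"
    and "(\<lambda>x. \<Sum>y\<in>{y. (x, y) \<in> E}. f (y, x) :: ennreal) \<in> borel_measurable M"
proof -
  have 1: "(\<lambda>x. \<Sum>y\<in>(\<lambda>i. neighbor i x) ` {i \<in> {..<D}. (x, neighbor i x) \<in> E}. f (x, y)) \<in> borel_measurable M"
    by (rule measurable_image_sum_ennreal) (measurable; simp)+
  have 2: "(\<lambda>x. \<Sum>y\<in>(\<lambda>i. neighbor i x) ` {i \<in> {..<D}. (x, neighbor i x) \<in> E}. f (y, x)) \<in> borel_measurable M"
    by (rule measurable_image_sum_ennreal) (measurable; simp)+
  show "(\<lambda>x. \<Sum>y\<in>{y. (x, y) \<in> E}. f (x, y)) \<in> borel_measurable M"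
    using 1 by (simp add: nbrs_neighbor cong: measurable_cong)
  show "(\<lambda>x. \<Sum>y\<in>{y. (x, y) \<in> E}. f (y, x)) \<in> borel_measurable M"
    using 2 by (simp add: nbrs_neighbor cong: measurable_cong)
qed

text \<open>\<open>neighbor i\<close> either follows an edge, where \<open>edge_transport\<close>
  applies, or fixes the node, where both sides agree pointwise. \<open>f1\<close> and
  \<open>f0\<close> separate the two cases; a loop counts as an edge.\<close>

lemma letter_transport:
  assumes f[measurable]: "f \<in> borel_measurable (M \<Otimes>\<^sub>M M)"
  shows "(\<integral>\<^sup>+x. f (x, neighbor i x) \<partial>M) = (\<integral>\<^sup>+y. (\<Sum>x\<in>{x \<in> space M. neighbor i x = y}. f (x, y)) \<partial>M)"
proof -
  define f1 where "f1 v = (if neighbor i (fst v) = snd v then f v else 0)" for v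
  define f0 where "f0 x = (if neighbor i x = x \<and> (x, x) \<notin> E then f (x, x) else 0)" for x
  have f1[measurable]: "f1 \<in> borel_measurable (M \<Otimes>\<^sub>M M)" unfolding f1_def by measurable
  have f0[measurable]: "f0 \<in> borel_measurable M" unfolding f0_def by measurable
  note [measurable] = edge_sum_measurable[OF f1]
  have "f (x, neighbor i x) = (\<Sum>y\<in>{y. (x, y) \<in> E}. f1 (x, y)) + f0 x" if x: "x \<in> space M" for x
  proof -
    have fin: "finite {y. (x, y) \<in> E}" using nbrs_bound[OF x] by simp
    have "(\<Sum>y\<in>{y. (x, y) \<in> E}. f1 (x, y)) = (if (x, neighbor i x) \<in> E then f (x, neighbor i x) else 0)"
      using fin by (simp add: f1_def)
    then show ?thesis using neighbor_edge[OF x, of i] by (auto simp: f0_def)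
  qed
  then have "(\<integral>\<^sup>+x. f (x, neighbor i x) \<partial>M) = (\<integral>\<^sup>+x. (\<Sum>y\<in>{y. (x, y) \<in> E}. f1 (x, y)) + f0 x \<partial>M)"
    by (rule nn_integral_cong)
  also have "\<dots> = (\<integral>\<^sup>+x. (\<Sum>y\<in>{y. (x, y) \<in> E}. f1 (x, y)) \<partial>M) + (\<integral>\<^sup>+x. f0 x \<partial>M)"
    by (rule nn_integral_add) measurable
  also have "(\<integral>\<^sup>+x. (\<Sum>y\<in>{y. (x, y) \<in> E}. f1 (x, y)) \<partial>M) = (\<integral>\<^sup>+x. (\<Sum>y\<in>{y. (x, y) \<in> E}. f1 (y, x)) \<partial>M)"
    by (rule edge_transport[OF f1])
  also have "(\<integral>\<^sup>+x. (\<Sum>y\<in>{y. (x, y) \<in> E}. f1 (y, x)) \<partial>M) + (\<integral>\<^sup>+x. f0 x \<partial>M) =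
      (\<integral>\<^sup>+x. (\<Sum>y\<in>{y. (x, y) \<in> E}. f1 (y, x)) + f0 x \<partial>M)"
    by (rule nn_integral_add[symmetric]) measurable
  also have "\<dots> = (\<integral>\<^sup>+y. (\<Sum>x\<in>{x \<in> space M. neighbor i x = y}. f (x, y)) \<partial>M)"
  proof (rule nn_integral_cong)
    fix x assume x: "x \<in> space M"
    have fin: "finite {y. (x, y) \<in> E}" using nbrs_bound[OF x] by simp
    let ?A = "{y. (x, y) \<in> E \<and> neighbor i y = x}" and ?B = "{y. y = x \<and> neighbor i x = x \<and> (x, x) \<notin> E}"
    have "{y \<in> space M. neighbor i y = x} = ?A \<union> ?B"
    proof (intro equalityI subsetI)
      fix y assume "y \<in> {y \<in> space M. neighbor i y = x}"
      then have y: "y \<in> space M" "neighbor i y = x" by auto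
      show "y \<in> ?A \<union> ?B"
      proof (cases "(y, x) \<in> E")
        case True
        then have "(x, y) \<in> E" by (rule symD[OF edges_sym])
        then show ?thesis using y by blast
      next
        case False
        then have "y = x" using neighbor_edge[OF y(1), of i] y(2) by simp
        then show ?thesis using False y by blast
      qed
    next
      fix y assume "y \<in> ?A \<union> ?B"
      then show "y \<in> {y \<in> space M. neighbor i y = x}" using E_space[of x y] x by auto
    qed
    moreover have "finite ?A" "finite ?B" using fin by (auto intro: rev_finite_subset)
    moreover have "?A \<inter> ?B = {}" by auto
    ultimately have "(\<Sum>y\<in>{y \<in> space M. neighbor i y = x}. f (y, x)) = (\<Sum>y\<in>?A. f (y, x)) + (\<Sum>y\<in>?B. f (y, x))"
      by (simp only: sum.union_disjoint)
    moreover have "(\<Sum>y\<in>?A. f (y, x)) = (\<Sum>y\<in>{y. (x, y) \<in> E}. f1 (y, x))"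
      using sum.inter_filter[OF fin, of "\<lambda>y. f (y, x)" "\<lambda>y. neighbor i y = x"] by (simp add: f1_def)
    moreover have "(\<Sum>y\<in>?B. f (y, x)) = f0 x" by (cases "neighbor i x = x \<and> (x, x) \<notin> E") (auto simp: f0_def)
    ultimately show "(\<Sum>y\<in>{y. (x, y) \<in> E}. f1 (y, x)) + f0 x = (\<Sum>x'\<in>{x' \<in> space M. neighbor i x' = x}. f (x', x))"
      by simp
  qed
  finally show ?thesis .
qed

text \<open>One letter is transported at a time. The induction hypothesis is applied to
  \<open>f\<close> with its second argument moved by the last letter, so \<open>f\<close> has to be
  arbitrary.\<close>

lemma word_transport:
  assumes "f \<in> borel_measurable (M \<Otimes>\<^sub>M M)" "l \<in> words r"
  shows "(\<integral>\<^sup>+x. f (x, walk l x) \<partial>M) = (\<integral>\<^sup>+y. (\<Sum>x\<in>{x \<in> space M. walk l x = y}. f (x, y)) \<partial>M)"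
  using assms
proof (induction l arbitrary: f)
  case Nil
  have "{x \<in> space M. x = y} = {y}" if "y \<in> space M" for y using that by auto
  then show ?case by (auto intro!: nn_integral_cong)
next
  case (Cons i l)
  note f[measurable] = Cons.prems(1)
  have l: "l \<in> words r" "i < D" using words_Cons[OF Cons.prems(2)] by auto
  define F where "F v = (\<Sum>x\<in>{x \<in> space M. walk l x = fst v}. f (x, snd v))" for v
  have F: "F \<in> borel_measurable (M \<Otimes>\<^sub>M M)" unfolding F_def by (rule preimage_sum_measurable[OF f l(1)])
  have "(\<integral>\<^sup>+x. f (x, walk (i # l) x) \<partial>M) = (\<integral>\<^sup>+x. (\<lambda>v. f (fst v, neighbor i (snd v))) (x, walk l x) \<partial>M)"
    by simp
  also have "\<dots> = (\<integral>\<^sup>+y. (\<Sum>x\<in>{x \<in> space M. walk l x = y}. (\<lambda>v. f (fst v, neighbor i (snd v))) (x, y)) \<partial>M)"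
    by (rule Cons.IH[OF _ l(1)]) measurable
  also have "\<dots> = (\<integral>\<^sup>+y. F (y, neighbor i y) \<partial>M)" by (simp add: F_def)
  also have "\<dots> = (\<integral>\<^sup>+z. (\<Sum>y\<in>{y \<in> space M. neighbor i y = z}. F (y, z)) \<partial>M)"
    by (rule letter_transport[OF F])
  also have "\<dots> = (\<integral>\<^sup>+z. (\<Sum>x\<in>{x \<in> space M. walk (i # l) x = z}. f (x, z)) \<partial>M)"
  proof (rule nn_integral_cong)
    fix z assume z: "z \<in> space M"
    have i: "[i] \<in> words 1" using l(2) by (simp add: words_def)
    have f1: "finite {y \<in> space M. neighbor i y = z}" using preimage_ball[OF z i] finite_ball[OF z, of 1] by simp
    have f2: "finite {x \<in> space M. walk l x = y}" if "y \<in> space M" for y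
      using preimage_ball[OF that l(1)] finite_ball[OF that, of r] by simp
    have "{x \<in> space M. walk (i # l) x = z} = (\<Union>y\<in>{y \<in> space M. neighbor i y = z}. {x \<in> space M. walk l x = y})"
      using walk_space by auto
    then have "(\<Sum>x\<in>{x \<in> space M. walk (i # l) x = z}. f (x, z)) =
        (\<Sum>y\<in>{y \<in> space M. neighbor i y = z}. \<Sum>x\<in>{x \<in> space M. walk l x = y}. f (x, z))"
      by (simp only:) (subst sum.UNION_disjoint; use f1 f2 in auto)
    then show "(\<Sum>y\<in>{y \<in> space M. neighbor i y = z}. F (y, z)) = (\<Sum>x\<in>{x \<in> space M. walk (i # l) x = z}. f (x, z))"
      by (simp add: F_def)
  qed
  finally show ?case .
qed

text \<open>Each word is transported separately. Dividing by the number of words that lead from one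
  node to the other makes every pair count once, and symmetry of balls matches the pairs on both
  sides.\<close>

lemma ball_transport:
  assumes f[measurable]: "f \<in> borel_measurable (M \<Otimes>\<^sub>M M)"
  shows "(\<integral>\<^sup>+x. (\<Sum>y\<in>ball_nodes E x r. f (x, y)) \<partial>M) = (\<integral>\<^sup>+x. (\<Sum>y\<in>ball_nodes E x r. f (y, x)) \<partial>M)"
proof -
  define mult where "mult v = card {w \<in> words r. walk w (fst v) = snd v}" for v
  have [measurable]: "mult \<in> measurable (M \<Otimes>\<^sub>M M) (count_space UNIV)"
    unfolding mult_def by (rule card_pred_measurable) auto
  define h where "h v = ennreal (1 / real (mult v)) * f v" for v
  have h[measurable]: "h \<in> borel_measurable (M \<Otimes>\<^sub>M M)" unfolding h_def by measurable
  have "(\<integral>\<^sup>+x. (\<Sum>y\<in>ball_nodes E x r. f (x, y)) \<partial>M) = (\<integral>\<^sup>+x. (\<Sum>w\<in>words r. h (x, walk w x)) \<partial>M)"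
  proof (rule nn_integral_cong)
    fix x assume x: "x \<in> space M"
    show "(\<Sum>y\<in>ball_nodes E x r. f (x, y)) = (\<Sum>w\<in>words r. h (x, walk w x))"
      unfolding ball_words[OF x] h_def mult_def
      using sum_image_weight[where C = "words r" and P = "\<lambda>_. True" and w = "\<lambda>n. ennreal (1 / real n)"
          and z = "\<lambda>w. walk w x" and F = "\<lambda>y. f (x, y)"]
      by (simp add: of_nat_mult_ennreal_inverse)
  qed
  also have "\<dots> = (\<Sum>w\<in>words r. \<integral>\<^sup>+x. h (x, walk w x) \<partial>M)"
    by (rule nn_integral_sum) measurable
  also have "\<dots> = (\<Sum>w\<in>words r. \<integral>\<^sup>+y. (\<Sum>x\<in>{x \<in> space M. walk w x = y}. h (x, y)) \<partial>M)"
    by (rule sum.cong[OF refl]) (rule word_transport[OF h])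
  also have "\<dots> = (\<integral>\<^sup>+y. (\<Sum>w\<in>words r. \<Sum>x\<in>{x \<in> space M. walk w x = y}. h (x, y)) \<partial>M)"
  proof (rule nn_integral_sum[symmetric])
    fix w assume "w \<in> words r"
    from measurable_compose[OF _ preimage_sum_measurable[OF h this], of "\<lambda>y. (y, y)" M]
    show "(\<lambda>y. \<Sum>x\<in>{x \<in> space M. walk w x = y}. h (x, y)) \<in> borel_measurable M" by simp
  qed
  also have "\<dots> = (\<integral>\<^sup>+x. (\<Sum>y\<in>ball_nodes E x r. f (y, x)) \<partial>M)"
  proof (rule nn_integral_cong)
    fix y assume y: "y \<in> space M"
    have "(\<Sum>w\<in>words r. \<Sum>x\<in>{x \<in> space M. walk w x = y}. h (x, y)) =
        (\<Sum>w\<in>words r. \<Sum>x\<in>{x. x \<in> ball_nodes E y r \<and> walk w x = y}. h (x, y))"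
      by (rule sum.cong[OF refl]) (use preimage_ball[OF y] in simp)
    also have "\<dots> = (\<Sum>x\<in>ball_nodes E y r. \<Sum>w\<in>{w. w \<in> words r \<and> walk w x = y}. h (x, y))"
      by (rule sum.swap_restrict) (use y in auto)
    also have "\<dots> = (\<Sum>x\<in>ball_nodes E y r. f (x, y))"
    proof (rule sum.cong[OF refl])
      fix x assume x: "x \<in> ball_nodes E y r"
      then have "y \<in> ball_nodes E x r" using ball_sym by blast
      then have "{w. w \<in> words r \<and> walk w x = y} \<noteq> {}"
        unfolding ball_words[OF ball_space[OF y x]] by auto
      then have m: "mult (x, y) > 0" by (simp add: mult_def card_gt_0_iff)
      have "(\<Sum>w\<in>{w. w \<in> words r \<and> walk w x = y}. h (x, y)) = of_nat (mult (x, y)) * ennreal (1 / real (mult (x, y))) * f (x, y)"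
        by (simp add: mult_def h_def mult.assoc)
      also have "\<dots> = f (x, y)" using of_nat_mult_ennreal_inverse[OF m] by simp
      finally show "(\<Sum>w\<in>{w. w \<in> words r \<and> walk w x = y}. h (x, y)) = f (x, y)" .
    qed
    finally show "(\<Sum>w\<in>words r. \<Sum>x\<in>{x \<in> space M. walk w x = y}. h (x, y)) = (\<Sum>x\<in>ball_nodes E y r. f (x, y))" .
  qed
  finally show ?thesis .
qed

end

section \<open>Isomorphism types of neighborhoods\<close>

definition nbhd :: "'v rel \<Rightarrow> 'v set \<Rightarrow> nat \<Rightarrow> 'v set" where
  "nbhd E Y r = (\<Union>x\<in>Y. ball_nodes E x r)"

fun marked_iso :: "'v set \<times> 'v rel \<times> 'v set \<Rightarrow> 'w set \<times> 'w rel \<times> 'w set \<Rightarrow> bool" where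
  "marked_iso (V, E, Y) (W, F, Z) \<longleftrightarrow> (\<exists>f. bij_betw f V W \<and> map_prod f f ` E = F \<and> f ` Y = Z)"

definition marked_nbhd :: "'v rel \<Rightarrow> 'v set \<Rightarrow> nat \<Rightarrow> 'v set \<times> 'v rel \<times> 'v set" where
  "marked_nbhd E Y r = (nbhd E Y r, E \<inter> nbhd E Y r \<times> nbhd E Y r, Y)"

text \<open>As in \<open>iso_class\<close>, a type is the set of all copies on \<open>nat\<close>,
  which makes types of different graphings comparable. A whole set is marked in place of a
  root.\<close>

definition mtype :: "'v rel \<Rightarrow> 'v set \<Rightarrow> nat \<Rightarrow> (nat set \<times> nat rel \<times> nat set) set" where
  "mtype E Y r = {H. marked_iso (marked_nbhd E Y r) H}"

lemma marked_iso_trans: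
  assumes "marked_iso (V, E, Y) (W, F, Z)" "marked_iso (W, F, Z) (W', F', Z')"
  shows "marked_iso (V, E, Y) (W', F', Z')"
proof -
  obtain f g where f: "bij_betw f V W" "map_prod f f ` E = F" "f ` Y = Z"
    and g: "bij_betw g W W'" "map_prod g g ` F = F'" "g ` Z = Z'" using assms by auto
  have "bij_betw (g \<circ> f) V W'" using f(1) g(1) by (rule bij_betw_trans)
  moreover have "map_prod (g \<circ> f) (g \<circ> f) ` E = F'" 
    by (simp only: map_prod.comp[symmetric] image_comp[symmetric] f(2) g(2))
  moreover have "(g \<circ> f) ` Y = Z'" by (simp only: image_comp[symmetric] f(3) g(3))
  ultimately show ?thesis unfolding marked_iso.simps by blast
qed

lemma marked_iso_sym:
  assumes "marked_iso (V, E, Y) (W, F, Z)" "E \<subseteq> V \<times> V" "Y \<subseteq> V"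
  shows "marked_iso (W, F, Z) (V, E, Y)"
proof -
  obtain f where f: "bij_betw f V W" "map_prod f f ` E = F" "f ` Y = Z" using assms(1) by auto
  let ?g = "inv_into V f"
  have inv: "?g (f u) = u" if "u \<in> V" for u using bij_betw_inv_into_left[OF f(1) that] .
  have "map_prod ?g ?g ` F = (\<lambda>e. e) ` E"
    unfolding f(2)[symmetric] image_image using assms(2) by (intro image_cong) (auto simp: inv)
  moreover have "?g ` Z = (\<lambda>u. u) ` Y"
    unfolding f(3)[symmetric] image_image using assms(3) by (intro image_cong) (auto simp: inv)
  ultimately show ?thesis using bij_betw_inv_into[OF f(1)] by auto
qed

lemma nbhd_0 [simp]: "nbhd E Y 0 = Y"
  by (auto simp: nbhd_def ball_nodes_0)

lemma nbhd_Suc: "nbhd E Y (Suc r) = nbhd E Y r \<union> {z. \<exists>y\<in>nbhd E Y r. (y, z) \<in> E}"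
  by (auto simp: nbhd_def ball_nodes_Suc)

lemma nbhd_mono: "r \<le> s \<Longrightarrow> nbhd E Y r \<subseteq> nbhd E Y s"
  unfolding nbhd_def by (intro UN_mono ball_nodes_mono subset_refl)

lemma subset_nbhd: "Y \<subseteq> nbhd E Y r"
  using nbhd_mono[of 0 r E Y] by simp

lemma nbhd_nbhd: "Y' \<subseteq> nbhd E Y a \<Longrightarrow> nbhd E Y' b \<subseteq> nbhd E Y (a + b)"
  unfolding nbhd_def using ball_nodes_trans[of _ E _ a _ b] by fastforce

text \<open>Finiteness provides a copy on \<open>nat\<close>, through which the two neighborhoods
  are compared.\<close>

lemma mtype_eq_iff:
  assumes fin: "finite (nbhd E1 Y1 r)"
  shows "mtype E1 Y1 r = mtype E2 Y2 r \<longleftrightarrow> marked_iso (marked_nbhd E1 Y1 r) (marked_nbhd E2 Y2 r)"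
proof
  assume eq: "mtype E1 Y1 r = mtype E2 Y2 r"
  obtain f where f: "bij_betw f (nbhd E1 Y1 r) {0..<card (nbhd E1 Y1 r)}"
    using ex_bij_betw_finite_nat[OF fin] by blast
  define H where "H = ({0..<card (nbhd E1 Y1 r)}, map_prod f f ` (E1 \<inter> nbhd E1 Y1 r \<times> nbhd E1 Y1 r), f ` Y1)"
  have 1: "marked_iso (marked_nbhd E1 Y1 r) H" using f by (auto simp: marked_nbhd_def H_def)
  then have "H \<in> mtype E2 Y2 r" using eq by (auto simp: mtype_def)
  then have 2: "marked_iso (marked_nbhd E2 Y2 r) H" by (simp add: mtype_def)
  have "marked_iso H (marked_nbhd E2 Y2 r)"
    unfolding marked_nbhd_def H_def
    by (rule marked_iso_sym[OF 2[unfolded marked_nbhd_def H_def]]) (rule Int_lower2, rule subset_nbhd)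
  then show "marked_iso (marked_nbhd E1 Y1 r) (marked_nbhd E2 Y2 r)"
    using marked_iso_trans[OF 1[unfolded marked_nbhd_def H_def]] unfolding marked_nbhd_def H_def by blast
next
  assume iso: "marked_iso (marked_nbhd E1 Y1 r) (marked_nbhd E2 Y2 r)"
  have iso': "marked_iso (marked_nbhd E2 Y2 r) (marked_nbhd E1 Y1 r)"
    unfolding marked_nbhd_def
    by (rule marked_iso_sym[OF iso[unfolded marked_nbhd_def]]) (rule Int_lower2, rule subset_nbhd)
  have "marked_iso (marked_nbhd E1 Y1 r) (A, B, C) \<longleftrightarrow> marked_iso (marked_nbhd E2 Y2 r) (A, B, C)"
    for A B C
    using marked_iso_trans[OF iso[unfolded marked_nbhd_def]] marked_iso_trans[OF iso'[unfolded marked_nbhd_def]]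
    unfolding marked_nbhd_def by blast
  then show "mtype E1 Y1 r = mtype E2 Y2 r" unfolding mtype_def by (auto simp del: marked_iso.simps)
qed

definition nbhd_iso :: "'v rel \<Rightarrow> 'v set \<Rightarrow> 'w rel \<Rightarrow> 'w set \<Rightarrow> nat \<Rightarrow> ('v \<Rightarrow> 'w) \<Rightarrow> bool" where
  "nbhd_iso E1 Y1 E2 Y2 r f \<longleftrightarrow> bij_betw f (nbhd E1 Y1 r) (nbhd E2 Y2 r) \<and> f ` Y1 = Y2 \<and>
     (\<forall>u\<in>nbhd E1 Y1 r. \<forall>v\<in>nbhd E1 Y1 r. (u, v) \<in> E1 \<longleftrightarrow> (f u, f v) \<in> E2)"

lemma marked_iso_nbhd_iso:
  "marked_iso (marked_nbhd E1 Y1 r) (marked_nbhd E2 Y2 r) \<longleftrightarrow> (\<exists>f. nbhd_iso E1 Y1 E2 Y2 r f)"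
proof -
  have "map_prod f f ` (E1 \<inter> V \<times> V) = E2 \<inter> W \<times> W \<longleftrightarrow>
      (\<forall>u\<in>V. \<forall>v\<in>V. (u, v) \<in> E1 \<longleftrightarrow> (f u, f v) \<in> E2)" if f: "bij_betw f V W"
    for f :: "'a \<Rightarrow> 'b" and V W
  proof
    assume eq: "map_prod f f ` (E1 \<inter> V \<times> V) = E2 \<inter> W \<times> W"
    show "\<forall>u\<in>V. \<forall>v\<in>V. (u, v) \<in> E1 \<longleftrightarrow> (f u, f v) \<in> E2"
    proof (intro ballI iffI)
      fix u v assume uv: "u \<in> V" "v \<in> V"
      show "(f u, f v) \<in> E2" if "(u, v) \<in> E1"
      proof -
        have "map_prod f f (u, v) \<in> map_prod f f ` (E1 \<inter> V \<times> V)" using that uv by blast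
        then show ?thesis unfolding eq by simp
      qed
      show "(u, v) \<in> E1" if fuv: "(f u, f v) \<in> E2"
      proof -
        have "(f u, f v) \<in> E2 \<inter> W \<times> W" using fuv uv f by (auto simp: bij_betw_def)
        then obtain u' v' where "(u', v') \<in> E1" "u' \<in> V" "v' \<in> V" "f u' = f u" "f v' = f v"
          unfolding eq[symmetric] by auto
        then show ?thesis using f uv by (metis bij_betw_def inj_onD)
      qed
    qed
  next
    assume iff: "\<forall>u\<in>V. \<forall>v\<in>V. (u, v) \<in> E1 \<longleftrightarrow> (f u, f v) \<in> E2"
    show "map_prod f f ` (E1 \<inter> V \<times> V) = E2 \<inter> W \<times> W"
    proof (intro equalityI subsetI)
      fix e assume "e \<in> map_prod f f ` (E1 \<inter> V \<times> V)"
      then show "e \<in> E2 \<inter> W \<times> W" using iff f by (auto simp: bij_betw_def)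
    next
      fix e assume e: "e \<in> E2 \<inter> W \<times> W"
      then obtain a b where ab: "e = (a, b)" "a \<in> f ` V" "b \<in> f ` V" using f by (auto simp: bij_betw_def)
      then obtain u v where uv: "u \<in> V" "v \<in> V" "e = (f u, f v)" by blast
      then have "(u, v) \<in> E1 \<inter> V \<times> V" using e iff by auto
      then show "e \<in> map_prod f f ` (E1 \<inter> V \<times> V)" using uv(3) by (auto intro: rev_image_eqI)
    qed
  qed
  then have "bij_betw f V W \<and> map_prod f f ` (E1 \<inter> V \<times> V) = E2 \<inter> W \<times> W \<and> f ` Y1 = Y2 \<longleftrightarrow>
      bij_betw f V W \<and> f ` Y1 = Y2 \<and> (\<forall>u\<in>V. \<forall>v\<in>V. (u, v) \<in> E1 \<longleftrightarrow> (f u, f v) \<in> E2)"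
    for f :: "'a \<Rightarrow> 'b" and V W
    by (cases "bij_betw f V W") (simp_all add: conj_commute)
  then show ?thesis unfolding marked_nbhd_def nbhd_iso_def marked_iso.simps by (rule iff_exI)
qed

lemma nbhd_iso_inv:
  assumes "nbhd_iso E1 Y1 E2 Y2 r f"
  shows "nbhd_iso E2 Y2 E1 Y1 r (inv_into (nbhd E1 Y1 r) f)"
proof -
  let ?V = "nbhd E1 Y1 r" and ?W = "nbhd E2 Y2 r"
  let ?g = "inv_into ?V f"
  have f: "bij_betw f ?V ?W" "f ` Y1 = Y2"
    "\<And>u v. u \<in> ?V \<Longrightarrow> v \<in> ?V \<Longrightarrow> (u, v) \<in> E1 \<longleftrightarrow> (f u, f v) \<in> E2"
    using assms by (auto simp: nbhd_iso_def)
  have "?g ` Y2 = (\<lambda>u. u) ` Y1"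
    unfolding f(2)[symmetric] image_image
    using subset_nbhd[of Y1 E1 r] bij_betw_inv_into_left[OF f(1)] by (intro image_cong) auto
  moreover have "(u, v) \<in> E2 \<longleftrightarrow> (?g u, ?g v) \<in> E1" if "u \<in> ?W" "v \<in> ?W" for u v
    using f(3)[of "?g u" "?g v"] bij_betw_inv_into_right[OF f(1)] that
      bij_betw_apply[OF bij_betw_inv_into[OF f(1)]] by metis
  ultimately show ?thesis using bij_betw_inv_into[OF f(1)] by (simp add: nbhd_iso_def)
qed

lemma nbhd_iso_nbhd_same:
  assumes f: "nbhd_iso E1 Y1 E2 Y2 R f" and "r \<le> R"
  shows "f ` nbhd E1 Y1 r = nbhd E2 Y2 r"
  using assms(2)
proof (induction r)
  case 0
  then show ?case using f by (simp add: nbhd_iso_def)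
next
  case (Suc r)
  have IH: "f ` nbhd E1 Y1 r = nbhd E2 Y2 r" using Suc by simp
  have sub: "nbhd E1 Y1 r \<subseteq> nbhd E1 Y1 R" "nbhd E1 Y1 (Suc r) \<subseteq> nbhd E1 Y1 R"
    "nbhd E2 Y2 (Suc r) \<subseteq> nbhd E2 Y2 R" using Suc.prems by (auto intro!: nbhd_mono)
  have bij: "f ` nbhd E1 Y1 R = nbhd E2 Y2 R"
    and edge: "\<And>u v. u \<in> nbhd E1 Y1 R \<Longrightarrow> v \<in> nbhd E1 Y1 R \<Longrightarrow> (u, v) \<in> E1 \<longleftrightarrow> (f u, f v) \<in> E2"
    using f by (auto simp: nbhd_iso_def bij_betw_def)
  show ?case
  proof (intro equalityI subsetI)
    fix z assume "z \<in> f ` nbhd E1 Y1 (Suc r)"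
    then obtain w where w: "z = f w" "w \<in> nbhd E1 Y1 (Suc r)" by blast
    then consider "w \<in> nbhd E1 Y1 r" | y where "y \<in> nbhd E1 Y1 r" "(y, w) \<in> E1"
      by (auto simp: nbhd_Suc)
    then show "z \<in> nbhd E2 Y2 (Suc r)"
    proof cases
      case 1
      then show ?thesis using IH w(1) by (auto simp: nbhd_Suc)
    next
      case 2
      then have "(f y, f w) \<in> E2" using edge[of y w] sub w(2) by blast
      moreover have "f y \<in> nbhd E2 Y2 r" using IH 2(1) by blast
      ultimately show ?thesis using w(1) by (auto simp: nbhd_Suc)
    qed
  next
    fix z assume z: "z \<in> nbhd E2 Y2 (Suc r)"
    then consider "z \<in> nbhd E2 Y2 r" | y where "y \<in> nbhd E2 Y2 r" "(y, z) \<in> E2"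
      by (auto simp: nbhd_Suc)
    then show "z \<in> f ` nbhd E1 Y1 (Suc r)"
    proof cases
      case 1
      then show ?thesis unfolding IH[symmetric] by (auto simp: nbhd_Suc)
    next
      case 2
      then obtain u where u: "u \<in> nbhd E1 Y1 r" "y = f u" unfolding IH[symmetric] by blast
      have "z \<in> f ` nbhd E1 Y1 R" using z sub bij by blast
      then obtain w where w: "w \<in> nbhd E1 Y1 R" "z = f w" by blast
      have "(u, w) \<in> E1" using edge[of u w] u w sub 2 by blast
      then show ?thesis using u w by (auto simp: nbhd_Suc)
    qed
  qed
qed

text \<open>Neighborhoods grow edge by edge, and \<open>a + b \<le> R\<close> keeps all edges in the
  region where \<open>f\<close> preserves and reflects adjacency. For the inclusion from right to
  left, \<open>nbhd_iso_nbhd_same\<close> ensures that a neighbor found in the second graph is in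
  the range of \<open>f\<close>.\<close>

lemma nbhd_iso_nbhd:
  assumes f: "nbhd_iso E1 Y1 E2 Y2 R f" and Y': "Y' \<subseteq> nbhd E1 Y1 a" and "a + b \<le> R"
  shows "f ` nbhd E1 Y' b = nbhd E2 (f ` Y') b"
  using assms(3)
proof (induction b)
  case (Suc b)
  have IH: "f ` nbhd E1 Y' b = nbhd E2 (f ` Y') b" using Suc by simp
  have sub: "nbhd E1 Y' b \<subseteq> nbhd E1 Y1 (a + b)" "nbhd E1 Y1 (a + b) \<subseteq> nbhd E1 Y1 R"
    "nbhd E1 Y' (Suc b) \<subseteq> nbhd E1 Y1 R"
    "nbhd E2 Y2 (Suc (a + b)) \<subseteq> nbhd E2 Y2 R"
    using nbhd_nbhd[OF Y', of b] nbhd_nbhd[OF Y', of "Suc b"] nbhd_mono[of "a + Suc b" R E1 Y1]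
      nbhd_mono[of "a + b" R E1 Y1] nbhd_mono[of "Suc (a + b)" R E2 Y2] Suc.prems by auto
  have same: "f ` nbhd E1 Y1 (a + b) = nbhd E2 Y2 (a + b)"
    using Suc.prems by (intro nbhd_iso_nbhd_same[OF f]) simp
  have bij: "f ` nbhd E1 Y1 R = nbhd E2 Y2 R"
    and edge: "\<And>u v. u \<in> nbhd E1 Y1 R \<Longrightarrow> v \<in> nbhd E1 Y1 R \<Longrightarrow> (u, v) \<in> E1 \<longleftrightarrow> (f u, f v) \<in> E2"
    using f by (auto simp: nbhd_iso_def bij_betw_def)
  show ?case
  proof (intro equalityI subsetI)
    fix z assume "z \<in> f ` nbhd E1 Y' (Suc b)"
    then obtain w where w: "z = f w" "w \<in> nbhd E1 Y' (Suc b)" by blast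
    then consider "w \<in> nbhd E1 Y' b" | y where "y \<in> nbhd E1 Y' b" "(y, w) \<in> E1"
      by (auto simp: nbhd_Suc)
    then show "z \<in> nbhd E2 (f ` Y') (Suc b)"
    proof cases
      case 1
      then show ?thesis using IH w(1) by (auto simp: nbhd_Suc)
    next
      case 2
      then have "(f y, f w) \<in> E2" using edge[of y w] sub w(2) by blast
      moreover have "f y \<in> nbhd E2 (f ` Y') b" using IH 2(1) by blast
      ultimately show ?thesis using w(1) by (auto simp: nbhd_Suc)
    qed
  next
    fix z assume "z \<in> nbhd E2 (f ` Y') (Suc b)"
    then consider "z \<in> nbhd E2 (f ` Y') b" | y where "y \<in> nbhd E2 (f ` Y') b" "(y, z) \<in> E2"
      by (auto simp: nbhd_Suc)
    then show "z \<in> f ` nbhd E1 Y' (Suc b)"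
    proof cases
      case 1
      then show ?thesis unfolding IH[symmetric] by (auto simp: nbhd_Suc)
    next
      case 2
      then obtain u where u: "u \<in> nbhd E1 Y' b" "y = f u" unfolding IH[symmetric] by blast
      have "y \<in> nbhd E2 Y2 (a + b)" using same sub u by blast
      then have "z \<in> nbhd E2 Y2 (Suc (a + b))" using 2(2) by (auto simp: nbhd_Suc)
      then have "z \<in> f ` nbhd E1 Y1 R" using sub bij by blast
      then obtain w where w: "w \<in> nbhd E1 Y1 R" "z = f w" by blast
      have "(u, w) \<in> E1" using edge[of u w] u w sub 2 by blast
      then show ?thesis using u w by (auto simp: nbhd_Suc)
    qed
  qed
qed simp

lemma nbhd_iso_restrict:
  assumes f: "nbhd_iso E1 Y1 E2 Y2 R f" and Y': "Y' \<subseteq> nbhd E1 Y1 a" and ab: "a + b \<le> R"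
  shows "nbhd_iso E1 Y' E2 (f ` Y') b f"
proof -
  have sub: "nbhd E1 Y' b \<subseteq> nbhd E1 Y1 R"
    using nbhd_nbhd[OF Y', of b] nbhd_mono[OF ab, of E1 Y1] by blast
  have "inj_on f (nbhd E1 Y' b)"
    using f sub by (auto simp: nbhd_iso_def bij_betw_def intro: inj_on_subset)
  then show ?thesis
    using nbhd_iso_nbhd[OF assms] f sub unfolding nbhd_iso_def bij_betw_def by blast
qed

lemma connected_image:
  assumes conn: "induces_connected E1 Y" and f: "\<And>u v. u \<in> Y \<Longrightarrow> v \<in> Y \<Longrightarrow> (u, v) \<in> E1 \<Longrightarrow> (f u, f v) \<in> E2"
  shows "induces_connected E2 (f ` Y)"
proof -
  have "(f u, f v) \<in> (E2 \<inter> f ` Y \<times> f ` Y)\<^sup>*" if "(u, v) \<in> (E1 \<inter> Y \<times> Y)\<^sup>*" for u v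
    using that
  proof induction
    case (step y z)
    then have "(f y, f z) \<in> E2 \<inter> f ` Y \<times> f ` Y" using f by auto
    then show ?case using step.IH by (rule rtrancl_into_rtrancl[rotated])
  qed auto
  then show ?thesis using conn unfolding induces_connected_def by blast
qed

text \<open>The radius \<open>k * k\<close> is crude: it bounds the number of edges inside
  \<open>Y\<close>, and hence the number of steps needed to get from \<open>x\<close> to any point
  of \<open>Y\<close>.\<close>

lemma connected_subset_ball:
  assumes conn: "induces_connected E Y" and Y: "finite Y" "card Y \<le> k" and x: "x \<in> Y"
  shows "Y \<subseteq> ball_nodes E x (k * k)"
proof
  fix y assume "y \<in> Y"
  let ?R = "E \<inter> Y \<times> Y"
  have fin: "finite ?R" using Y(1) by auto
  have "card ?R \<le> card (Y \<times> Y)" using Y(1) by (intro card_mono) auto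
  also have "\<dots> \<le> k * k" using Y(2) by (simp add: card_cartesian_product mult_le_mono)
  finally have card: "card ?R \<le> k * k" .
  have "(x, y) \<in> ?R\<^sup>*" using conn x \<open>y \<in> Y\<close> by (auto simp: induces_connected_def)
  then obtain n where n: "n \<le> card ?R" "(x, y) \<in> ?R ^^ n"
    unfolding rtrancl_finite_eq_relpow[OF fin] by blast
  have "(x, z) \<in> ?R ^^ m \<Longrightarrow> (x, z) \<in> E ^^ m" for z m
    by (induction m arbitrary: z) auto
  from this[OF n(2)] have "(x, y) \<in> E ^^ n" .
  then show "y \<in> ball_nodes E x (k * k)" using le_trans[OF n(1) card] unfolding ball_nodes_def by blast
qed

section \<open>Measurability on the space of connected sets\<close>

text \<open>If two families of names have the same coincidences and adjacencies, matching equally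
  named points is well defined and an isomorphism. So a type is decided by finitely many questions
  about words.\<close>

lemma nbhd_iso_of_table:
  assumes V: "nbhd E1 Y1 r = p1 ` J" "nbhd E2 Y2 r = p2 ` J" and Y: "Y1 = p1 ` J0" "Y2 = p2 ` J0"
    and J0: "J0 \<subseteq> J"
    and eq: "\<And>j j'. j \<in> J \<Longrightarrow> j' \<in> J \<Longrightarrow> p1 j = p1 j' \<longleftrightarrow> p2 j = p2 j'"
    and edge: "\<And>j j'. j \<in> J \<Longrightarrow> j' \<in> J \<Longrightarrow> (p1 j, p1 j') \<in> E1 \<longleftrightarrow> (p2 j, p2 j') \<in> E2"
  shows "\<exists>f. nbhd_iso E1 Y1 E2 Y2 r f"
proof -
  define f where "f u = p2 (SOME j. j \<in> J \<and> p1 j = u)" for u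
  have f: "f (p1 j) = p2 j" if "j \<in> J" for j
  proof -
    have "(SOME j'. j' \<in> J \<and> p1 j' = p1 j) \<in> J \<and> p1 (SOME j'. j' \<in> J \<and> p1 j' = p1 j) = p1 j"
      by (rule someI[of _ j]) (use that in simp)
    then show ?thesis unfolding f_def using eq that by blast
  qed
  have "inj_on f (p1 ` J)" using f eq by (auto simp: inj_on_def)
  moreover have "f ` p1 ` J = p2 ` J" unfolding image_image using f by (intro image_cong) auto
  moreover have "f ` p1 ` J0 = p2 ` J0" unfolding image_image using f J0 by (intro image_cong) auto
  moreover have "\<forall>u\<in>p1 ` J. \<forall>v\<in>p1 ` J. (u, v) \<in> E1 \<longleftrightarrow> (f u, f v) \<in> E2"
    using f edge by simp
  ultimately have "nbhd_iso E1 Y1 E2 Y2 r f" unfolding nbhd_iso_def bij_betw_def V unfolding Y by blast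
  then show ?thesis by blast
qed

lemma pair_Collect_eq_iff:
  "({(j, j'). j \<in> J \<and> j' \<in> J \<and> P j j'}, {(j, j'). j \<in> J \<and> j' \<in> J \<and> Q j j'}) =
   ({(j, j'). j \<in> J \<and> j' \<in> J \<and> P' j j'}, {(j, j'). j \<in> J \<and> j' \<in> J \<and> Q' j j'}) \<longleftrightarrow>
   (\<forall>j\<in>J. \<forall>j'\<in>J. (P j j' \<longleftrightarrow> P' j j') \<and> (Q j j' \<longleftrightarrow> Q' j j'))"
  unfolding prod.inject set_eq_iff by auto

definition conn_at :: "'a measure \<Rightarrow> 'a rel \<Rightarrow> nat \<Rightarrow> 'a \<Rightarrow> 'a set set" where
  "conn_at M E k x = {Y \<in> conn_sets M E k. x \<in> Y}"

context graphing
begin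

lemma finite_nbhd: "Y \<subseteq> space M \<Longrightarrow> finite Y \<Longrightarrow> finite (nbhd E Y r)"
  unfolding nbhd_def by (intro finite_UN_I) auto

lemma nbhd_space: "Y \<subseteq> space M \<Longrightarrow> nbhd E Y r \<subseteq> space M"
  unfolding nbhd_def using ball_space by blast

lemma conn_setsD:
  assumes "Y \<in> conn_sets M E k"
  shows "Y \<subseteq> space M" "finite Y" "card Y \<le> k" "0 < card Y" "induces_connected E Y"
  using assms by (auto simp: conn_sets_def)

lemma conn_at_ball: "Y \<in> conn_at M E k x \<Longrightarrow> Y \<subseteq> ball_nodes E x (k * k)"
  using connected_subset_ball[of E Y k x] by (auto simp: conn_at_def conn_sets_def)

lemma finite_conn_at [simp]: "x \<in> space M \<Longrightarrow> finite (conn_at M E k x)"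
  by (rule finite_subset[of _ "Pow (ball_nodes E x (k * k))"]) (use conn_at_ball in auto)

lemma singleton_conn: "x \<in> space M \<Longrightarrow> k \<ge> 1 \<Longrightarrow> {x} \<in> conn_sets M E k"
  by (auto simp: conn_sets_def induces_connected_def)

lemma mtype_eq_nbhd_iso:
  assumes "Y \<subseteq> space M" "finite Y"
  shows "mtype E Y r = mtype E2 Y2 r \<longleftrightarrow> (\<exists>f. nbhd_iso E Y E2 Y2 r f)"
  using mtype_eq_iff[OF finite_nbhd[OF assms]] marked_iso_nbhd_iso by blast

definition entry :: "nat \<times> nat list \<Rightarrow> (nat \<Rightarrow> 'a) \<Rightarrow> 'a" where
  "entry j v = walk (snd j) (v (fst j))"

text \<open>Everything on which the type of a listed set depends, by \<open>table_mtype\<close>.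
  Coincidences are recorded as well because one node has several names.\<close>

definition table :: "nat \<Rightarrow> nat \<Rightarrow> (nat \<Rightarrow> 'a) \<Rightarrow>
    ((nat \<times> nat list) \<times> (nat \<times> nat list)) set \<times> ((nat \<times> nat list) \<times> (nat \<times> nat list)) set" where
  "table n r v =
    ({(j, j'). j \<in> {..<n} \<times> words r \<and> j' \<in> {..<n} \<times> words r \<and> entry j v = entry j' v},
     {(j, j'). j \<in> {..<n} \<times> words r \<and> j' \<in> {..<n} \<times> words r \<and> (entry j v, entry j' v) \<in> E})"

lemma entry_measurable [measurable]:
  "j \<in> {..<n} \<times> words r \<Longrightarrow> entry j \<in> measurable (PiM {..<n} (\<lambda>_. M)) M"
  unfolding entry_def by measurable (auto simp: mem_Times_iff)

lemma finite_tables: "finite (table n r ` S)"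
proof (rule finite_subset)
  let ?J = "{..<n} \<times> words r"
  show "table n r ` S \<subseteq> Pow (?J \<times> ?J) \<times> Pow (?J \<times> ?J)" by (auto simp: table_def)
qed auto

lemma table_level_set:
  "{v \<in> space (PiM {..<n} (\<lambda>_. M)). table n r v = table n r v0} \<in> sets (PiM {..<n} (\<lambda>_. M))"
proof -
  let ?J = "{..<n} \<times> words r"
  have "{v \<in> space (PiM {..<n} (\<lambda>_. M)). \<forall>j\<in>?J. \<forall>j'\<in>?J. (entry j v = entry j' v \<longleftrightarrow> entry j v0 = entry j' v0) \<and>
     ((entry j v, entry j' v) \<in> E \<longleftrightarrow> (entry j v0, entry j' v0) \<in> E)} \<in> sets (PiM {..<n} (\<lambda>_. M))"
    by measurable
  also have "{v \<in> space (PiM {..<n} (\<lambda>_. M)). \<forall>j\<in>?J. \<forall>j'\<in>?J. (entry j v = entry j' v \<longleftrightarrow> entry j v0 = entry j' v0) \<and>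
     ((entry j v, entry j' v) \<in> E \<longleftrightarrow> (entry j v0, entry j' v0) \<in> E)} =
     {v \<in> space (PiM {..<n} (\<lambda>_. M)). table n r v = table n r v0}"
    unfolding table_def by (intro Collect_cong conj_cong refl pair_Collect_eq_iff[symmetric])
  finally show ?thesis .
qed

lemma listing_space: "v \<in> space (PiM {..<n} (\<lambda>_. M)) \<Longrightarrow> i < n \<Longrightarrow> v i \<in> space M"
  by (auto simp: space_PiM)

lemma table_mtype:
  assumes v: "v \<in> space (PiM {..<n} (\<lambda>_. M))" and v': "v' \<in> space (PiM {..<n} (\<lambda>_. M))"
    and eq: "table n r v = table n r v'"
  shows "mtype E (v ` {..<n}) r = mtype E (v' ` {..<n}) r"
proof -
  let ?J = "{..<n} \<times> words r"
  have neighbor: "nbhd E (v ` {..<n}) r = (\<lambda>j. entry j v) ` ?J" if "v \<in> space (PiM {..<n} (\<lambda>_. M))" for v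
  proof -
    have "nbhd E (v ` {..<n}) r = (\<Union>i<n. ball_nodes E (v i) r)" by (simp add: nbhd_def)
    also have "\<dots> = (\<Union>i<n. (\<lambda>l. walk l (v i)) ` words r)"
      by (rule SUP_cong[OF refl]) (use ball_words listing_space[OF that] in auto)
    also have "\<dots> = (\<lambda>j. entry j v) ` ?J"
    proof (intro equalityI subsetI)
      fix u assume "u \<in> (\<Union>i<n. (\<lambda>l. walk l (v i)) ` words r)"
      then obtain i l where "i < n" "l \<in> words r" "u = entry (i, l) v" by (auto simp: entry_def)
      then show "u \<in> (\<lambda>j. entry j v) ` ?J" by blast
    next
      fix u assume "u \<in> (\<lambda>j. entry j v) ` ?J"
      then obtain i l where "i < n" "l \<in> words r" "u = walk l (v i)" by (auto simp: entry_def)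
      then show "u \<in> (\<Union>i<n. (\<lambda>l. walk l (v i)) ` words r)" by blast
    qed
    finally show ?thesis .
  qed
  have Y: "v ` {..<n} = (\<lambda>j. entry j v) ` ({..<n} \<times> {[]})" for v :: "nat \<Rightarrow> 'a"
    unfolding entry_def by force
  have "\<exists>f. nbhd_iso E (v ` {..<n}) E (v' ` {..<n}) r f"
  proof (rule nbhd_iso_of_table[OF neighbor[OF v] neighbor[OF v'] Y Y])
    show "{..<n} \<times> {[]} \<subseteq> ?J" by (auto simp: words_def)
    fix j j' assume j: "j \<in> ?J" "j' \<in> ?J"
    have "(j, j') \<in> fst (table n r v) \<longleftrightarrow> (j, j') \<in> fst (table n r v')"
      "(j, j') \<in> snd (table n r v) \<longleftrightarrow> (j, j') \<in> snd (table n r v')" using eq by simp_all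
    then show "entry j v = entry j' v \<longleftrightarrow> entry j v' = entry j' v'"
      "(entry j v, entry j' v) \<in> E \<longleftrightarrow> (entry j v', entry j' v') \<in> E"
      using j by (simp_all add: table_def)
  qed
  moreover have "v ` {..<n} \<subseteq> space M" using listing_space[OF v] by auto
  ultimately show ?thesis using mtype_eq_nbhd_iso by blast
qed

lemma mtype_listing_sets:
  fixes n :: nat
  shows "{v \<in> space (PiM {..<n} (\<lambda>_. M)). mtype E (v ` {..<n}) r \<in> T} \<in> sets (PiM {..<n} (\<lambda>_. M))"
proof -
  let ?A = "{v \<in> space (PiM {..<n} (\<lambda>_. M)). mtype E (v ` {..<n}) r \<in> T}"
  have "?A = (\<Union>t\<in>table n r ` ?A. {v \<in> space (PiM {..<n} (\<lambda>_. M)). table n r v = t})" (is "_ = ?U")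
  proof (intro equalityI subsetI)
    fix v assume "v \<in> ?U"
    then obtain v' where "v' \<in> ?A" "v \<in> space (PiM {..<n} (\<lambda>_. M))" "table n r v = table n r v'" by blast
    then show "v \<in> ?A" using table_mtype[of v n v' r] by simp
  qed auto
  also have "\<dots> \<in> sets (PiM {..<n} (\<lambda>_. M))"
    by (rule sets.finite_UN[OF finite_tables]) (auto intro: table_level_set)
  finally show ?thesis .
qed

text \<open>Types factor through tables, and for each number of nodes there are finitely many
  tables. This makes averages over types finite sums.\<close>

lemma finite_mtypes: "finite ((\<lambda>Y. mtype E Y r) ` {Y. Y \<subseteq> space M \<and> finite Y \<and> card Y \<le> k})"
proof -
  let ?S = "\<lambda>n :: nat. space (PiM {..<n} (\<lambda>_. M))"
  have fin: "finite ((\<lambda>v. mtype E (v ` {..<n}) r) ` ?S n)" for n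
  proof -
    have "(\<lambda>v. mtype E (v ` {..<n}) r) ` ?S n \<subseteq>
        (\<lambda>t. mtype E ((SOME v. v \<in> ?S n \<and> table n r v = t) ` {..<n}) r) ` table n r ` ?S n"
    proof (rule image_subsetI)
      fix v assume v: "v \<in> ?S n"
      let ?v = "SOME w. w \<in> ?S n \<and> table n r w = table n r v"
      have "?v \<in> ?S n \<and> table n r ?v = table n r v" by (rule someI[of _ v]) (use v in simp)
      then have "mtype E (v ` {..<n}) r = mtype E (?v ` {..<n}) r" using table_mtype[of v n ?v r] v by simp
      then show "mtype E (v ` {..<n}) r \<in>
          (\<lambda>t. mtype E ((SOME v. v \<in> ?S n \<and> table n r v = t) ` {..<n}) r) ` table n r ` ?S n"
        using v by blast
    qed
    then show ?thesis using finite_tables finite_subset by blast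
  qed
  have "(\<lambda>Y. mtype E Y r) ` {Y. Y \<subseteq> space M \<and> finite Y \<and> card Y \<le> k} \<subseteq>
      (\<Union>n\<le>k. (\<lambda>v. mtype E (v ` {..<n}) r) ` ?S n)"
  proof (rule image_subsetI)
    fix Y assume "Y \<in> {Y. Y \<subseteq> space M \<and> finite Y \<and> card Y \<le> k}"
    then have Y: "Y \<subseteq> space M" "finite Y" "card Y \<le> k" by auto
    obtain h where "bij_betw h {0..<card Y} Y" using ex_bij_betw_nat_finite[OF Y(2)] by blast
    then have h: "h ` {..<card Y} = Y" by (simp add: bij_betw_def lessThan_atLeast0)
    define v where "v = restrict h {..<card Y}"
    have "v \<in> ?S (card Y)" using h Y by (auto simp: v_def space_PiM)
    moreover have "v ` {..<card Y} = Y" using h by (simp add: v_def)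
    ultimately show "mtype E Y r \<in> (\<Union>n\<le>k. (\<lambda>v. mtype E (v ` {..<n}) r) ` ?S n)"
      using Y(3) by (intro UN_I[of "card Y"] image_eqI[of _ _ v]) auto
  qed
  then show ?thesis using fin by (meson finite_UN_I finite_atMost finite_subset)
qed

lemma mtype_connected:
  assumes "Y \<subseteq> space M" "finite Y" "mtype E Y 0 = mtype E2 Y2 0" "induces_connected E Y"
  shows "induces_connected E2 Y2"
proof -
  obtain f where f: "nbhd_iso E Y E2 Y2 0 f" using mtype_eq_nbhd_iso assms by blast
  then have "f ` Y = Y2" "\<And>u v. u \<in> Y \<Longrightarrow> v \<in> Y \<Longrightarrow> (u, v) \<in> E \<Longrightarrow> (f u, f v) \<in> E2"
    by (auto simp: nbhd_iso_def)
  then show ?thesis using connected_image[OF assms(4), of f E2] by blast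
qed

lemma listings_eq:
  assumes "n \<in> {1..k}"
  shows "listings {Y \<in> conn_sets M E k. Q Y} n =
    {v \<in> space (PiM {..<n} (\<lambda>_. M)). inj_on v {..<n} \<and> induces_connected E (v ` {..<n}) \<and> Q (v ` {..<n})}"
proof (intro equalityI subsetI)
  fix v assume "v \<in> listings {Y \<in> conn_sets M E k. Q Y} n"
  then obtain Y where Y: "v \<in> extensional {..<n}" "Y \<in> conn_sets M E k" "Q Y" "bij_betw v {..<n} Y"
    by (auto simp: listings_def)
  then have "v ` {..<n} = Y" "inj_on v {..<n}" by (auto simp: bij_betw_def)
  then show "v \<in> {v \<in> space (PiM {..<n} (\<lambda>_. M)). inj_on v {..<n} \<and> induces_connected E (v ` {..<n}) \<and> Q (v ` {..<n})}"
    using Y(1,3) conn_setsD[OF Y(2)] by (auto simp: space_PiM PiE_def)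
next
  fix v assume "v \<in> {v \<in> space (PiM {..<n} (\<lambda>_. M)). inj_on v {..<n} \<and> induces_connected E (v ` {..<n}) \<and> Q (v ` {..<n})}"
  then have v: "v \<in> space (PiM {..<n} (\<lambda>_. M))" "inj_on v {..<n}" "induces_connected E (v ` {..<n})" "Q (v ` {..<n})"
    by auto
  have "v ` {..<n} \<in> conn_sets M E k"
    using listing_space[OF v(1)] v(2,3) assms by (auto simp: conn_sets_def card_image)
  then show "v \<in> listings {Y \<in> conn_sets M E k. Q Y} n"
    using v by (auto simp: listings_def space_PiM PiE_def bij_betw_def)
qed

text \<open>Connectedness is a property of the type of radius 0 and hence Borel by itself, so only
  \<open>Q\<close> remains to be checked, on injective listings.\<close>

lemma listings_sets:
  assumes n: "n \<in> {1..k}"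
    and Q: "{v \<in> space (PiM {..<n} (\<lambda>_. M)). inj_on v {..<n} \<and> Q (v ` {..<n})} \<in> sets (PiM {..<n} (\<lambda>_. M))"
  shows "listings {Y \<in> conn_sets M E k. Q Y} n \<in> sets (PiM {..<n} (\<lambda>_. M))"
proof -
  let ?T = "(\<lambda>Y. mtype E Y 0) ` {Y. Y \<subseteq> space M \<and> finite Y \<and> induces_connected E Y}"
  have "induces_connected E (v ` {..<n}) \<longleftrightarrow> mtype E (v ` {..<n}) 0 \<in> ?T"
    if v: "v \<in> space (PiM {..<n} (\<lambda>_. M))" for v
  proof
    assume "mtype E (v ` {..<n}) 0 \<in> ?T"
    then obtain Y where Y: "Y \<subseteq> space M" "finite Y" "induces_connected E Y" "mtype E Y 0 = mtype E (v ` {..<n}) 0"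
      by force
    then show "induces_connected E (v ` {..<n})" using mtype_connected by blast
  qed (use listing_space[OF v] in \<open>auto intro!: imageI\<close>)
  then have "listings {Y \<in> conn_sets M E k. Q Y} n =
      {v \<in> space (PiM {..<n} (\<lambda>_. M)). inj_on v {..<n} \<and> Q (v ` {..<n})} \<inter>
      {v \<in> space (PiM {..<n} (\<lambda>_. M)). mtype E (v ` {..<n}) 0 \<in> ?T}"
    unfolding listings_eq[OF n] by blast
  then show ?thesis using Q mtype_listing_sets[of n 0 ?T] by (simp only: sets.Int)
qed

lemma conn_space_sets:
  assumes "\<And>n. n \<in> {1..k} \<Longrightarrow>
    {v \<in> space (PiM {..<n} (\<lambda>_. M)). inj_on v {..<n} \<and> Q (v ` {..<n})} \<in> sets (PiM {..<n} (\<lambda>_. M))"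
  shows "{Y \<in> conn_sets M E k. Q Y} \<in> sets (conn_space M E k)"
  unfolding conn_space_def
  by (subst sets_measure_of) (use listings_sets assms in \<open>auto intro!: sigma_sets.Basic\<close>)

lemma space_conn_space [simp]: "space (conn_space M E k) = conn_sets M E k"
  unfolding conn_space_def by (rule space_measure_of) auto

lemma inj_listing_sets [measurable]:
  fixes n :: nat
  shows "Measurable.pred (PiM {..<n} (\<lambda>_. M)) (\<lambda>v. inj_on v {..<n})"
proof -
  have "(\<lambda>v. inj_on v {..<n}) = (\<lambda>v :: nat \<Rightarrow> 'a. \<forall>i\<in>{..<n}. \<forall>j\<in>{..<n}. v i = v j \<longrightarrow> i = j)"
    by (auto simp: inj_on_def)
  then show ?thesis by simp
qed

lemma conn_space_mtype_sets: "{Y \<in> conn_sets M E k. mtype E Y r \<in> T} \<in> sets (conn_space M E k)"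
proof (rule conn_space_sets)
  fix n :: nat
  have "{v \<in> space (PiM {..<n} (\<lambda>_. M)). inj_on v {..<n}} \<inter>
      {v \<in> space (PiM {..<n} (\<lambda>_. M)). mtype E (v ` {..<n}) r \<in> T} \<in> sets (PiM {..<n} (\<lambda>_. M))"
    using inj_listing_sets mtype_listing_sets by (intro sets.Int) auto
  also have "{v \<in> space (PiM {..<n} (\<lambda>_. M)). inj_on v {..<n}} \<inter>
      {v \<in> space (PiM {..<n} (\<lambda>_. M)). mtype E (v ` {..<n}) r \<in> T} =
      {v \<in> space (PiM {..<n} (\<lambda>_. M)). inj_on v {..<n} \<and> mtype E (v ` {..<n}) r \<in> T}" by blast
  finally show "{v \<in> space (PiM {..<n} (\<lambda>_. M)). inj_on v {..<n} \<and> mtype E (v ` {..<n}) r \<in> T} \<in> sets (PiM {..<n} (\<lambda>_. M))" .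
qed

lemma mtype_measurable [measurable]: "(\<lambda>Y. mtype E Y r) \<in> measurable (conn_space M E k) (count_space UNIV)"
proof (rule measurableI)
  fix T show "(\<lambda>Y. mtype E Y r) -` T \<inter> space (conn_space M E k) \<in> sets (conn_space M E k)"
    using conn_space_mtype_sets[of k r T] by (simp add: vimage_def Int_def conj_commute)
qed simp

lemma sum_measurable:
  fixes \<phi> :: "'a \<Rightarrow> 'c :: {second_countable_topology, topological_comm_monoid_add}"
  assumes [measurable]: "\<phi> \<in> borel_measurable M"
  shows "(\<lambda>Y. \<Sum>x\<in>Y. \<phi> x) \<in> borel_measurable (conn_space M E k)"
proof (rule measurableI)
  fix B :: "'c set" assume B[measurable]: "B \<in> sets borel"
  have "{Y \<in> conn_sets M E k. (\<Sum>x\<in>Y. \<phi> x) \<in> B} \<in> sets (conn_space M E k)"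
  proof (rule conn_space_sets)
    fix n assume "n \<in> {1..k}"
    have "{v \<in> space (PiM {..<n} (\<lambda>_. M)). inj_on v {..<n} \<and> (\<Sum>i<n. \<phi> (v i)) \<in> B} \<in> sets (PiM {..<n} (\<lambda>_. M))"
      by measurable
    also have "{v \<in> space (PiM {..<n} (\<lambda>_. M)). inj_on v {..<n} \<and> (\<Sum>i<n. \<phi> (v i)) \<in> B} =
        {v \<in> space (PiM {..<n} (\<lambda>_. M)). inj_on v {..<n} \<and> (\<Sum>x\<in>v ` {..<n}. \<phi> x) \<in> B}"
      by (intro Collect_cong conj_cong refl) (simp add: sum.reindex)
    finally show "{v \<in> space (PiM {..<n} (\<lambda>_. M)). inj_on v {..<n} \<and> (\<Sum>x\<in>v ` {..<n}. \<phi> x) \<in> B} \<in> sets (PiM {..<n} (\<lambda>_. M))" .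
  qed
  then show "(\<lambda>Y. \<Sum>x\<in>Y. \<phi> x) -` B \<inter> space (conn_space M E k) \<in> sets (conn_space M E k)"
    by (simp add: vimage_def Int_def conj_commute)
qed simp

lemma card_measurable [measurable]: "(\<lambda>Y. real (card Y)) \<in> borel_measurable (conn_space M E k)"
  using sum_measurable[of "\<lambda>_. 1 :: real" k] by simp

lemma mtype_function_measurable:
  assumes "\<And>Y Y'. Y \<in> conn_sets M E k \<Longrightarrow> Y' \<in> conn_sets M E k \<Longrightarrow> mtype E Y r = mtype E Y' r \<Longrightarrow> f Y = f Y'"
  shows "f \<in> borel_measurable (conn_space M E k)"
proof -
  define g where "g t = f (SOME Y. Y \<in> conn_sets M E k \<and> mtype E Y r = t)" for t
  have g: "g (mtype E Y r) = f Y" if Y: "Y \<in> conn_sets M E k" for Y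
  proof -
    let ?Z = "SOME Y'. Y' \<in> conn_sets M E k \<and> mtype E Y' r = mtype E Y r"
    have "?Z \<in> conn_sets M E k \<and> mtype E ?Z r = mtype E Y r" by (rule someI[of _ Y]) (use Y in simp)
    then show ?thesis unfolding g_def using assms Y by blast
  qed
  have "(\<lambda>Y. g (mtype E Y r)) \<in> borel_measurable (conn_space M E k)"
    by (rule measurable_compose[OF mtype_measurable]) simp
  then show ?thesis by (subst measurable_cong[OF g[symmetric]]) auto
qed

end

section \<open>The counting measure on connected sets\<close>

context graphing
begin

definition wset :: "nat list set \<Rightarrow> 'a \<Rightarrow> 'a set" where
  "wset c x = (\<lambda>l. walk l x) ` c"

text \<open>By \<open>connected_subset_ball\<close> every connected set at a node is named by a set
  of words of length at most \<open>k * k\<close>.\<close>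

definition cwords :: "nat \<Rightarrow> nat list set set" where
  "cwords k = Pow (words (k * k))"

lemma finite_cwords [simp]: "finite (cwords k)"
  by (simp add: cwords_def)

lemma finite_cword: "c \<in> cwords k \<Longrightarrow> finite c"
  unfolding cwords_def by (meson PowD finite_subset finite_words)

lemma wset_eq_pred:
  assumes "finite c" "finite c'"
  shows "Measurable.pred M (\<lambda>x. wset c x = wset c' x)"
proof -
  have "wset c x = wset c' x \<longleftrightarrow> (\<forall>l\<in>c. \<exists>l'\<in>c'. walk l x = walk l' x) \<and> (\<forall>l'\<in>c'. \<exists>l\<in>c. walk l' x = walk l x)" for x
    unfolding wset_def by (auto simp: set_eq_iff image_iff)
  moreover have "Measurable.pred M (\<lambda>x. (\<forall>l\<in>c. \<exists>l'\<in>c'. walk l x = walk l' x) \<and> (\<forall>l'\<in>c'. \<exists>l\<in>c. walk l' x = walk l x))"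
    using assms by measurable
  ultimately show ?thesis by simp
qed

text \<open>The Borel structure on sets is given through injective listings. So the named set is
  listed by a list \<open>d\<close> of words, one word for each element, and there are only
  countably many such lists.\<close>

lemma wset_member_pred:
  assumes S: "S \<subseteq> conn_sets M E k" and L: "\<And>n. n \<in> {1..k} \<Longrightarrow> listings S n \<in> sets (PiM {..<n} (\<lambda>_. M))"
    and c: "finite c"
  shows "Measurable.pred M (\<lambda>x. wset c x \<in> S)"
proof -
  define G where "G d x \<longleftrightarrow> set d \<subseteq> c \<and> length d \<in> {1..k} \<and>
      restrict (\<lambda>i. walk (d ! i) x) {..<length d} \<in> listings S (length d) \<and> wset c x = wset (set d) x" for d x
  have "Measurable.pred M (G d)" for d
  proof (cases "length d \<in> {1..k}")
    case True
    have "(\<lambda>x. restrict (\<lambda>i. walk (d ! i) x) {..<length d}) \<in> measurable M (PiM {..<length d} (\<lambda>_. M))"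
      by (rule measurable_restrict) measurable
    then have "Measurable.pred M (\<lambda>x. restrict (\<lambda>i. walk (d ! i) x) {..<length d} \<in> listings S (length d))"
      using L[OF True] by measurable
    moreover have "Measurable.pred M (\<lambda>x. wset c x = wset (set d) x)" by (rule wset_eq_pred) (use c in auto)
    ultimately show ?thesis unfolding G_def by measurable
  next
    case False
    then have "G d = (\<lambda>x. False)" unfolding G_def by blast
    then show ?thesis by simp
  qed
  then have "Measurable.pred M (\<lambda>x. \<exists>d. G d x)" by measurable
  moreover have "wset c x \<in> S \<longleftrightarrow> (\<exists>d. G d x)" for x
  proof
    assume WS: "wset c x \<in> S"
    let ?n = "card (wset c x)"
    have fin: "finite (wset c x)" and n: "?n \<in> {1..k}" using WS S by (auto simp: conn_sets_def)
    obtain h where h: "bij_betw h {0..<?n} (wset c x)" using ex_bij_betw_nat_finite[OF fin] by blast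
    have "\<exists>l\<in>c. walk l x = h i" if "i < ?n" for i
      using bij_betw_apply[OF h, of i] that by (auto simp: wset_def)
    then obtain g where g: "\<And>i. i < ?n \<Longrightarrow> g i \<in> c \<and> walk (g i) x = h i" by metis
    define d where "d = map g [0..<?n]"
    have len: "length d = ?n" by (simp add: d_def)
    have di: "walk (d ! i) x = h i" if "i < ?n" for i using that g by (simp add: d_def)
    have "bij_betw (restrict (\<lambda>i. walk (d ! i) x) {..<?n}) {..<?n} (wset c x) \<longleftrightarrow> bij_betw h {..<?n} (wset c x)"
      by (rule bij_betw_cong) (use di in auto)
    then have "bij_betw (restrict (\<lambda>i. walk (d ! i) x) {..<?n}) {..<?n} (wset c x)"
      using h by (simp add: lessThan_atLeast0)
    then have "restrict (\<lambda>i. walk (d ! i) x) {..<length d} \<in> listings S (length d)"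
      unfolding len listings_def using WS by auto
    moreover have "wset c x = wset (set d) x"
    proof -
      have "wset c x = h ` {0..<?n}" using h by (simp add: bij_betw_def)
      also have "\<dots> = (\<lambda>i. walk (g i) x) ` {0..<?n}" by (rule image_cong) (use g in auto)
      also have "\<dots> = wset (set d) x" by (simp add: wset_def d_def image_image)
      finally show ?thesis .
    qed
    moreover have "set d \<subseteq> c" using g by (auto simp: d_def)
    ultimately have "G d x" unfolding G_def using n len by simp
    then show "\<exists>d. G d x" by blast
  next
    assume "\<exists>d. G d x"
    then obtain d where d: "restrict (\<lambda>i. walk (d ! i) x) {..<length d} \<in> listings S (length d)"
      "wset c x = wset (set d) x" unfolding G_def by blast
    then obtain Y where Y: "Y \<in> S" "bij_betw (restrict (\<lambda>i. walk (d ! i) x) {..<length d}) {..<length d} Y"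
      by (auto simp: listings_def)
    have "Y = (\<lambda>i. walk (d ! i) x) ` {..<length d}" using Y(2) by (auto simp: bij_betw_def)
    also have "\<dots> = wset (set d) x" by (auto simp: wset_def set_conv_nth)
    finally show "wset c x \<in> S" using Y(1) d(2) by simp
  qed
  ultimately show ?thesis by simp
qed

lemma wset_conn_pred [measurable]:
  assumes "c \<in> cwords k"
  shows "Measurable.pred M (\<lambda>x. wset c x \<in> conn_at M E k x)"
proof -
  have "Measurable.pred M (\<lambda>x. wset c x \<in> {Y \<in> conn_sets M E k. True})"
  proof (rule wset_member_pred[OF _ _ finite_cword[OF assms]])
    fix n :: nat
    assume n: "n \<in> {1..k}"
    have "{v \<in> space (PiM {..<n} (\<lambda>_. M)). inj_on v {..<n} \<and> True} \<in> sets (PiM {..<n} (\<lambda>_. M))"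
      using inj_listing_sets[of n] by (simp add: pred_def)
    then show "listings {Y \<in> conn_sets M E k. True} n \<in> sets (PiM {..<n} (\<lambda>_. M))"
      by (rule listings_sets[OF n, where Q = "\<lambda>_. True"])
  qed simp
  moreover have "Measurable.pred M (\<lambda>x. \<exists>l\<in>c. walk l x = x)"
    using finite_cword[OF assms] by measurable
  moreover have "x \<in> wset c x \<longleftrightarrow> (\<exists>l\<in>c. walk l x = x)" for x
    unfolding wset_def by (auto simp: image_iff eq_commute)
  ultimately show ?thesis unfolding conn_at_def by simp
qed

lemma conn_at_wset:
  assumes x: "x \<in> space M"
  shows "conn_at M E k x = (\<lambda>c. wset c x) ` {c \<in> cwords k. wset c x \<in> conn_at M E k x}"
proof (intro equalityI subsetI)
  fix Y assume Y: "Y \<in> conn_at M E k x"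
  define c where "c = {l \<in> words (k * k). walk l x \<in> Y}"
  have "wset c x = Y" using conn_at_ball[OF Y] unfolding ball_words[OF x] by (auto simp: wset_def c_def)
  moreover have "c \<in> cwords k" by (auto simp: c_def cwords_def)
  ultimately show "Y \<in> (\<lambda>c. wset c x) ` {c \<in> cwords k. wset c x \<in> conn_at M E k x}" using Y by blast
qed auto

text \<open>The default \<open>{x}\<close> makes this a total map into the connected sets. Where it
  applies, the coefficient in \<open>conn_sum_formula\<close> is 0.\<close>

definition cset :: "nat \<Rightarrow> nat list set \<Rightarrow> 'a \<Rightarrow> 'a set" where
  "cset k c x = (if wset c x \<in> conn_at M E k x then wset c x else {x})"

lemma cset_measurable:
  assumes k: "k \<ge> 1" and c: "c \<in> cwords k"
  shows "cset k c \<in> measurable M (conn_space M E k)"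
  unfolding conn_space_def
proof (rule measurable_measure_of)
  show "cset k c \<in> space M \<rightarrow> conn_sets M E k"
    using singleton_conn[OF _ k] by (auto simp: cset_def conn_at_def)
  fix S assume "S \<in> {S. S \<subseteq> conn_sets M E k \<and> (\<forall>n\<in>{1..k}. listings S n \<in> sets (PiM {..<n} (\<lambda>_. M)))}"
  then have S: "S \<subseteq> conn_sets M E k" "\<And>n. n \<in> {1..k} \<Longrightarrow> listings S n \<in> sets (PiM {..<n} (\<lambda>_. M))" by auto
  have 1: "Measurable.pred M (\<lambda>x. wset c x \<in> S)" by (rule wset_member_pred[OF S finite_cword[OF c]])
  have 2: "Measurable.pred M (\<lambda>x. wset {[]} x \<in> S)" by (rule wset_member_pred[OF S]) auto
  have "Measurable.pred M (\<lambda>x. if wset c x \<in> conn_at M E k x then wset c x \<in> S else wset {[]} x \<in> S)"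
    using wset_conn_pred[OF c] 1 2 by measurable
  moreover have "cset k c x \<in> S \<longleftrightarrow> (if wset c x \<in> conn_at M E k x then wset c x \<in> S else wset {[]} x \<in> S)" for x
    by (simp add: cset_def) (simp add: wset_def)
  ultimately have "Measurable.pred M (\<lambda>x. cset k c x \<in> S)" by (simp only:)
  then show "cset k c -` S \<inter> space M \<in> sets M" by (simp add: pred_def vimage_def Int_def conj_commute)
qed auto

lemma conn_sum_formula:
  fixes F :: "'a set \<Rightarrow> 'c :: comm_semiring_1"
  assumes x: "x \<in> space M" and w: "\<And>n. n > 0 \<Longrightarrow> of_nat n * w n = (1 :: 'c)"
  shows "(\<Sum>Y\<in>conn_at M E k x. F Y) = (\<Sum>c\<in>cwords k. if wset c x \<in> conn_at M E k x then
     w (card {c' \<in> cwords k. wset c' x \<in> conn_at M E k x \<and> wset c' x = wset c x}) * F (cset k c x) else 0)"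
proof -
  have "(\<Sum>Y\<in>conn_at M E k x. F Y) = (\<Sum>Y\<in>(\<lambda>c. wset c x) ` {c \<in> cwords k. wset c x \<in> conn_at M E k x}. F Y)"
    using conn_at_wset[OF x, of k] by simp
  also have "\<dots> = (\<Sum>c\<in>cwords k. if wset c x \<in> conn_at M E k x then
     w (card {c' \<in> cwords k. wset c' x \<in> conn_at M E k x \<and> wset c' x = wset c x}) * F (wset c x) else 0)"
    by (rule sum_image_weight[OF finite_cwords w])
  also have "\<dots> = (\<Sum>c\<in>cwords k. if wset c x \<in> conn_at M E k x then
     w (card {c' \<in> cwords k. wset c' x \<in> conn_at M E k x \<and> wset c' x = wset c x}) * F (cset k c x) else 0)"
    by (rule sum.cong[OF refl]) (simp add: cset_def)
  finally show ?thesis .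
qed

definition kappa :: "nat \<Rightarrow> 'a set measure" where
  "kappa k = (SOME K. sets K = sets (conn_space M E k) \<and> (\<forall>f\<in>borel_measurable (conn_space M E k).
     (\<integral>\<^sup>+Y. f Y \<partial>K) = (\<integral>\<^sup>+x. (\<Sum>Y\<in>conn_at M E k x. f Y) \<partial>M)))"

lemma kappa:
  assumes k: "k \<ge> 1"
  shows sets_kappa: "sets (kappa k) = sets (conn_space M E k)"
    and nn_integral_kappa: "\<And>f. f \<in> borel_measurable (conn_space M E k) \<Longrightarrow>
      (\<integral>\<^sup>+Y. f Y \<partial>kappa k) = (\<integral>\<^sup>+x. (\<Sum>Y\<in>conn_at M E k x. f Y) \<partial>M)"
proof -
  define mult where "mult c x = card {c' \<in> cwords k. wset c' x \<in> conn_at M E k x \<and> wset c' x = wset c x}" for c x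
  have mult: "mult c \<in> measurable M (count_space UNIV)" if "c \<in> cwords k" for c
    unfolding mult_def
    by (rule card_pred_measurable) (use wset_conn_pred wset_eq_pred finite_cword that in auto)
  define u where "u c x = (if wset c x \<in> conn_at M E k x then ennreal (1 / real (mult c x)) else 0)" for c x
  have u: "u c \<in> borel_measurable M" if "c \<in> cwords k" for c
    unfolding u_def using mult[OF that] wset_conn_pred[OF that] by measurable
  obtain K where K: "sets K = sets (conn_space M E k)" "\<And>f. f \<in> borel_measurable (conn_space M E k) \<Longrightarrow>
      (\<integral>\<^sup>+Y. f Y \<partial>K) = (\<integral>\<^sup>+x. (\<Sum>c\<in>cwords k. u c x * f (cset k c x)) \<partial>M)"
    using exists_sum_kernel[of "cwords k" "cset k" M "conn_space M E k" u, OF _ cset_measurable[OF k] u] by auto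
  have "(\<Sum>c\<in>cwords k. u c x * f (cset k c x)) = (\<Sum>Y\<in>conn_at M E k x. f Y)" if x: "x \<in> space M" for x f
    using conn_sum_formula[OF x, where w = "\<lambda>n. ennreal (1 / real n)" and F = f and k = k]
    by (simp add: of_nat_mult_ennreal_inverse u_def mult_def if_distrib[of "\<lambda>t. t * _"] cong: if_cong)
  then have "(\<integral>\<^sup>+x. (\<Sum>c\<in>cwords k. u c x * f (cset k c x)) \<partial>M) = (\<integral>\<^sup>+x. (\<Sum>Y\<in>conn_at M E k x. f Y) \<partial>M)" for f
    by (rule nn_integral_cong)
  then have "sets K = sets (conn_space M E k) \<and> (\<forall>f\<in>borel_measurable (conn_space M E k).
     (\<integral>\<^sup>+Y. f Y \<partial>K) = (\<integral>\<^sup>+x. (\<Sum>Y\<in>conn_at M E k x. f Y) \<partial>M))" using K by simp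
  from someI[where P = "\<lambda>K. sets K = sets (conn_space M E k) \<and> (\<forall>f\<in>borel_measurable (conn_space M E k).
     (\<integral>\<^sup>+Y. f Y \<partial>K) = (\<integral>\<^sup>+x. (\<Sum>Y\<in>conn_at M E k x. f Y) \<partial>M))", OF this]
  have *: "sets (kappa k) = sets (conn_space M E k) \<and> (\<forall>f\<in>borel_measurable (conn_space M E k).
     (\<integral>\<^sup>+Y. f Y \<partial>kappa k) = (\<integral>\<^sup>+x. (\<Sum>Y\<in>conn_at M E k x. f Y) \<partial>M))" unfolding kappa_def .
  show "sets (kappa k) = sets (conn_space M E k)" using * by blast
  show "\<And>f. f \<in> borel_measurable (conn_space M E k) \<Longrightarrow>
      (\<integral>\<^sup>+Y. f Y \<partial>kappa k) = (\<integral>\<^sup>+x. (\<Sum>Y\<in>conn_at M E k x. f Y) \<partial>M)" using * by blast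
qed

lemma joint_sum_measurable:
  assumes k: "k \<ge> 1" and f: "f \<in> borel_measurable (conn_space M E k)"
  shows "(\<lambda>v. \<Sum>Y\<in>{Y \<in> conn_at M E k (fst v). snd v \<in> Y}. f Y :: ennreal) \<in> borel_measurable (M \<Otimes>\<^sub>M M)"
proof -
  have "(\<lambda>v. \<Sum>Y\<in>(\<lambda>c. wset c (fst v)) ` {c \<in> cwords k. wset c (fst v) \<in> conn_at M E k (fst v) \<and> snd v \<in> wset c (fst v)}. f Y)
    \<in> borel_measurable (M \<Otimes>\<^sub>M M)"
  proof (rule measurable_image_sum_ennreal)
    fix c assume c: "c \<in> cwords k"
    have [measurable]: "Measurable.pred (M \<Otimes>\<^sub>M M) (\<lambda>v. wset c (fst v) \<in> conn_at M E k (fst v))"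
      using measurable_compose[OF measurable_fst wset_conn_pred[OF c]] .
    have "Measurable.pred (M \<Otimes>\<^sub>M M) (\<lambda>v. \<exists>l\<in>c. snd v = walk l (fst v))"
      using finite_cword[OF c] by measurable
    then have [measurable]: "Measurable.pred (M \<Otimes>\<^sub>M M) (\<lambda>v. snd v \<in> wset c (fst v))"
      by (simp add: wset_def image_iff)
    show P: "Measurable.pred (M \<Otimes>\<^sub>M M) (\<lambda>v. wset c (fst v) \<in> conn_at M E k (fst v) \<and> snd v \<in> wset c (fst v))"
      by measurable
    have [measurable]: "(\<lambda>v. f (cset k c (fst v))) \<in> borel_measurable (M \<Otimes>\<^sub>M M)"
      using measurable_compose[OF measurable_compose[OF measurable_fst cset_measurable[OF k c]] f] .
    have "(\<lambda>v. if wset c (fst v) \<in> conn_at M E k (fst v) \<and> snd v \<in> wset c (fst v) then f (cset k c (fst v)) else 0)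
        \<in> borel_measurable (M \<Otimes>\<^sub>M M)"
      by measurable
    then show "(\<lambda>v. if wset c (fst v) \<in> conn_at M E k (fst v) \<and> snd v \<in> wset c (fst v) then f (wset c (fst v)) else 0)
        \<in> borel_measurable (M \<Otimes>\<^sub>M M)"
      by (simp add: cset_def cong: if_cong conj_cong)
    fix c' assume c': "c' \<in> cwords k"
    show "Measurable.pred (M \<Otimes>\<^sub>M M) (\<lambda>v. wset c' (fst v) = wset c (fst v))"
      using measurable_compose[OF measurable_fst wset_eq_pred[OF finite_cword[OF c'] finite_cword[OF c]]] .
  qed simp
  moreover have "(\<lambda>c. wset c (fst v)) ` {c \<in> cwords k. wset c (fst v) \<in> conn_at M E k (fst v) \<and> snd v \<in> wset c (fst v)} =
      {Y \<in> conn_at M E k (fst v). snd v \<in> Y}" if "v \<in> space (M \<Otimes>\<^sub>M M)" for v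
  proof -
    have "fst v \<in> space M" using that by (auto simp: space_pair_measure)
    from conn_at_wset[OF this, of k] show ?thesis by blast
  qed
  ultimately show ?thesis by (subst measurable_cong[OF sum.cong[OF sym refl]]) auto
qed

lemma conn_sum_measurable:
  assumes "k \<ge> 1" "f \<in> borel_measurable (conn_space M E k)"
  shows "(\<lambda>x. \<Sum>Y\<in>conn_at M E k x. f Y :: ennreal) \<in> borel_measurable M"
proof -
  have "(\<lambda>x. \<Sum>Y\<in>{Y \<in> conn_at M E k x. x \<in> Y}. f Y) \<in> borel_measurable M"
    using measurable_compose[OF _ joint_sum_measurable[OF assms], of "\<lambda>x. (x, x)" M] by simp
  moreover have "{Y \<in> conn_at M E k x. x \<in> Y} = conn_at M E k x" for x by (auto simp: conn_at_def)
  ultimately show ?thesis by simp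
qed

text \<open>Each \<open>y \<in> Y\<close> sends the mass \<open>\<phi> y * f Y / card Y\<close> to
  each node of \<open>Y\<close>. Summed over what is received this is the right side. Summed over
  what is sent, a node \<open>x\<close> gives to each of the \<open>card Y\<close> nodes of
  \<open>Y\<close>, in total \<open>\<phi> x * f Y\<close>, which is the left side.\<close>

lemma kappa_transport:
  assumes k: "k \<ge> 1" and \<phi>[measurable]: "\<phi> \<in> borel_measurable M"
    and f[measurable]: "f \<in> borel_measurable (conn_space M E k)"
  shows "(\<integral>\<^sup>+x. \<phi> x * (\<Sum>Y\<in>conn_at M E k x. f Y) \<partial>M) =
    (\<integral>\<^sup>+Y. f Y * ((\<Sum>x\<in>Y. \<phi> x) * ennreal (1 / real (card Y))) \<partial>kappa k)"
proof -
  define g where "g Y = f Y * ennreal (1 / real (card Y))" for Y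
  have g[measurable]: "g \<in> borel_measurable (conn_space M E k)" unfolding g_def by measurable
  define a where "a v = (\<Sum>Y\<in>{Y \<in> conn_at M E k (fst v). snd v \<in> Y}. g Y)" for v
  have a[measurable]: "a \<in> borel_measurable (M \<Otimes>\<^sub>M M)" unfolding a_def by (rule joint_sum_measurable[OF k g])
  have a_sym: "a (x, y) = a (y, x)" for x y
    unfolding a_def conn_at_def by (rule sum.cong) auto
  note [measurable] = sum_measurable[OF \<phi>, of k]
  have swap: "(\<Sum>y\<in>ball_nodes E x (k * k). \<psi> y * a (x, y)) = (\<Sum>Y\<in>conn_at M E k x. g Y * (\<Sum>y\<in>Y. \<psi> y))"
    if x: "x \<in> space M" for x \<psi>
  proof -
    have "(\<Sum>y\<in>ball_nodes E x (k * k). \<psi> y * a (x, y)) =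
        (\<Sum>y\<in>ball_nodes E x (k * k). \<Sum>Y\<in>{Y. Y \<in> conn_at M E k x \<and> y \<in> Y}. g Y * \<psi> y)"
      by (simp add: a_def sum_distrib_left mult.commute)
    also have "\<dots> = (\<Sum>Y\<in>conn_at M E k x. \<Sum>y\<in>{y. y \<in> ball_nodes E x (k * k) \<and> y \<in> Y}. g Y * \<psi> y)"
      by (rule sum.swap_restrict) (use x in auto)
    also have "\<dots> = (\<Sum>Y\<in>conn_at M E k x. g Y * (\<Sum>y\<in>Y. \<psi> y))"
    proof (rule sum.cong[OF refl])
      fix Y assume "Y \<in> conn_at M E k x"
      then have "{y. y \<in> ball_nodes E x (k * k) \<and> y \<in> Y} = Y" using conn_at_ball by blast
      then show "(\<Sum>y\<in>{y. y \<in> ball_nodes E x (k * k) \<and> y \<in> Y}. g Y * \<psi> y) = g Y * (\<Sum>y\<in>Y. \<psi> y)"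
        by (simp add: sum_distrib_left)
    qed
    finally show ?thesis .
  qed
  have "(\<integral>\<^sup>+Y. f Y * ((\<Sum>x\<in>Y. \<phi> x) * ennreal (1 / real (card Y))) \<partial>kappa k) = (\<integral>\<^sup>+Y. g Y * (\<Sum>x\<in>Y. \<phi> x) \<partial>kappa k)"
    by (simp add: g_def mult_ac)
  also have "\<dots> = (\<integral>\<^sup>+x. (\<Sum>Y\<in>conn_at M E k x. g Y * (\<Sum>y\<in>Y. \<phi> y)) \<partial>M)"
    by (rule nn_integral_kappa[OF k]) measurable
  also have "\<dots> = (\<integral>\<^sup>+x. (\<Sum>y\<in>ball_nodes E x (k * k). (\<lambda>v. \<phi> (snd v) * a v) (x, y)) \<partial>M)"
    by (rule nn_integral_cong) (simp add: swap)
  also have "\<dots> = (\<integral>\<^sup>+x. (\<Sum>y\<in>ball_nodes E x (k * k). (\<lambda>v. \<phi> (snd v) * a v) (y, x)) \<partial>M)"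
    by (rule ball_transport) measurable
  also have "\<dots> = (\<integral>\<^sup>+x. \<phi> x * (\<Sum>Y\<in>conn_at M E k x. f Y) \<partial>M)"
  proof (rule nn_integral_cong)
    fix x assume x: "x \<in> space M"
    have "g Y * of_nat (card Y) = f Y" if "Y \<in> conn_at M E k x" for Y
    proof -
      have "card Y > 0" using that conn_setsD(4) by (auto simp: conn_at_def)
      then have "of_nat (card Y) * ennreal (1 / real (card Y)) = 1" by (rule of_nat_mult_ennreal_inverse)
      then show ?thesis unfolding g_def by (metis mult.assoc mult.commute mult.right_neutral)
    qed
    then have "(\<Sum>Y\<in>conn_at M E k x. g Y * (\<Sum>y\<in>Y. 1)) = (\<Sum>Y\<in>conn_at M E k x. f Y)" by simp
    then have "(\<Sum>y\<in>ball_nodes E x (k * k). a (x, y)) = (\<Sum>Y\<in>conn_at M E k x. f Y)"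
      using swap[OF x, of "\<lambda>_. 1"] by simp
    then show "(\<Sum>y\<in>ball_nodes E x (k * k). (\<lambda>v. \<phi> (snd v) * a v) (y, x)) = \<phi> x * (\<Sum>Y\<in>conn_at M E k x. f Y)"
      by (simp add: a_sym[of _ x] sum_distrib_left[symmetric])
  qed
  finally show ?thesis by simp
qed

end

section \<open>Functions determined by local types\<close>

lemma mtype_restrict:
  assumes G: "graphing D1 M1 E1" and f: "nbhd_iso E1 Y1 E2 Y2 R f" and Y1: "Y1 \<subseteq> space M1"
    and Y': "Y' \<subseteq> nbhd E1 Y1 a" "finite Y'" and ab: "a + b \<le> R"
  shows "mtype E1 Y' b = mtype E2 (f ` Y') b"
proof -
  have "Y' \<subseteq> space M1" using graphing.nbhd_space[OF G Y1] Y'(1) by blast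
  then show ?thesis
    using graphing.mtype_eq_nbhd_iso[OF G _ Y'(2)] nbhd_iso_restrict[OF f Y'(1) ab] by blast
qed

lemma mtype_mono:
  assumes G: "graphing D1 M1 E1" and Y: "Y1 \<subseteq> space M1" "finite Y1"
    and eq: "mtype E1 Y1 r = mtype E2 Y2 r" and q: "q \<le> r"
  shows "mtype E1 Y1 q = mtype E2 Y2 q"
proof -
  obtain f where f: "nbhd_iso E1 Y1 E2 Y2 r f" using graphing.mtype_eq_nbhd_iso[OF G Y] eq by blast
  then have "f ` Y1 = Y2" by (simp add: nbhd_iso_def)
  then show ?thesis using mtype_restrict[OF G f Y(1), of Y1 0 q] Y(2) q by simp
qed

lemma mtype_card:
  assumes G: "graphing D1 M1 E1" and Y: "Y1 \<subseteq> space M1" "finite Y1"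
    and eq: "mtype E1 Y1 r = mtype E2 Y2 r"
  shows "card Y1 = card Y2"
proof -
  obtain f where f: "nbhd_iso E1 Y1 E2 Y2 r f" using graphing.mtype_eq_nbhd_iso[OF G Y] eq by blast
  have "inj_on f Y1" "f ` Y1 = Y2"
    using f subset_nbhd[of Y1 E1 r] by (auto simp: nbhd_iso_def bij_betw_def intro: inj_on_subset)
  then show ?thesis using card_image[of f Y1] by simp
qed

lemma mtype_sum:
  fixes \<phi>1 :: "'a \<Rightarrow> real"
  assumes G: "graphing D1 M1 E1" and Y: "Y1 \<subseteq> space M1" "finite Y1"
    and eq: "mtype E1 Y1 r = mtype E2 Y2 r" and q: "q \<le> r"
    and \<phi>: "\<And>x y. x \<in> Y1 \<Longrightarrow> y \<in> Y2 \<Longrightarrow> mtype E1 {x} q = mtype E2 {y} q \<Longrightarrow> \<phi>1 x = \<phi>2 y"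
  shows "(\<Sum>x\<in>Y1. \<phi>1 x) = (\<Sum>y\<in>Y2. \<phi>2 y)"
proof -
  obtain f where f: "nbhd_iso E1 Y1 E2 Y2 r f" using graphing.mtype_eq_nbhd_iso[OF G Y] eq by blast
  have bij: "bij_betw f Y1 Y2"
    using f subset_nbhd[of Y1 E1 r] by (auto simp: nbhd_iso_def bij_betw_def intro: inj_on_subset)
  have "\<phi>1 x = \<phi>2 (f x)" if x: "x \<in> Y1" for x
  proof (rule \<phi>[OF x])
    show "f x \<in> Y2" using bij x by (auto simp: bij_betw_def)
    show "mtype E1 {x} q = mtype E2 {f x} q"
      using mtype_restrict[OF G f Y(1), of "{x}" 0 q] x q by simp
  qed
  then have "(\<Sum>x\<in>Y1. \<phi>1 x) = (\<Sum>x\<in>Y1. \<phi>2 (f x))" by (rule sum.cong[OF refl])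
  also have "\<dots> = (\<Sum>y\<in>Y2. \<phi>2 y)" by (rule sum.reindex_bij_betw[OF bij])
  finally show ?thesis .
qed

lemma edge_boundary_eq:
  assumes "graphing D M E"
  shows "edge_boundary M E Y = {(u, v) \<in> E. u \<in> Y \<and> v \<notin> Y}"
  using graphing.E_space[OF assms] by (auto simp: edge_boundary_def)

text \<open>Boundary edges end at distance 1 from the set, outside the neighborhood of radius 0,
  whence \<open>1 \<le> r\<close>.\<close>

lemma mtype_expansion:
  assumes G1: "graphing D1 M1 E1" and G2: "graphing D2 M2 E2" and Y: "Y1 \<subseteq> space M1" "finite Y1"
    and eq: "mtype E1 Y1 r = mtype E2 Y2 r" and r: "1 \<le> r"
  shows "expansion M1 E1 Y1 = expansion M2 E2 Y2"
proof -
  have "mtype E1 Y1 1 = mtype E2 Y2 1" by (rule mtype_mono[OF G1 Y eq r])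
  then obtain f where f: "nbhd_iso E1 Y1 E2 Y2 1 f" using graphing.mtype_eq_nbhd_iso[OF G1 Y] by blast
  have bij: "bij_betw f (nbhd E1 Y1 1) (nbhd E2 Y2 1)" and fY: "f ` Y1 = Y2"
    and edge: "\<And>u v. u \<in> nbhd E1 Y1 1 \<Longrightarrow> v \<in> nbhd E1 Y1 1 \<Longrightarrow> (u, v) \<in> E1 \<longleftrightarrow> (f u, f v) \<in> E2"
    using f by (auto simp: nbhd_iso_def)
  have inj: "inj_on f (nbhd E1 Y1 1)" using bij by (simp add: bij_betw_def)
  have nb1: "u \<in> nbhd E1 Y1 1 \<and> v \<in> nbhd E1 Y1 1" if "(u, v) \<in> E1" "u \<in> Y1" for u v
    using that nbhd_Suc[of E1 Y1 0] by auto
  have nb2: "u \<in> nbhd E2 Y2 1 \<and> v \<in> nbhd E2 Y2 1" if "(u, v) \<in> E2" "u \<in> Y2" for u v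
    using that nbhd_Suc[of E2 Y2 0] by auto
  have "card (edge_boundary M1 E1 Y1) = card (edge_boundary M2 E2 Y2)"
    unfolding edge_boundary_eq[OF G1] edge_boundary_eq[OF G2]
  proof (rule bij_betw_same_card[of "map_prod f f"])
    let ?B1 = "{(u, v) \<in> E1. u \<in> Y1 \<and> v \<notin> Y1}" and ?B2 = "{(u, v) \<in> E2. u \<in> Y2 \<and> v \<notin> Y2}"
    have "inj_on (map_prod f f) (nbhd E1 Y1 1 \<times> nbhd E1 Y1 1)"
      using inj by (intro map_prod_inj_on)
    moreover have "?B1 \<subseteq> nbhd E1 Y1 1 \<times> nbhd E1 Y1 1" using nb1 by blast
    ultimately have "inj_on (map_prod f f) ?B1" by (rule inj_on_subset)
    moreover have "map_prod f f ` ?B1 = ?B2"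
    proof (intro equalityI subsetI)
      fix e assume "e \<in> map_prod f f ` ?B1"
      then obtain u v where uv: "e = (f u, f v)" "(u, v) \<in> E1" "u \<in> Y1" "v \<notin> Y1" by auto
      have "f v \<notin> Y2"
      proof
        assume "f v \<in> Y2"
        then obtain w where "w \<in> Y1" "f w = f v" unfolding fY[symmetric] by auto
        moreover have "w \<in> nbhd E1 Y1 1" using subset_nbhd[of Y1 E1 1] \<open>w \<in> Y1\<close> by blast
        ultimately have "w = v" using inj nb1[OF uv(2,3)] by (auto dest: inj_onD)
        then show False using \<open>w \<in> Y1\<close> uv(4) by simp
      qed
      then show "e \<in> ?B2" using uv edge[of u v] nb1[OF uv(2,3)] fY by auto
    next
      fix e assume "e \<in> ?B2"
      then obtain a b where ab: "e = (a, b)" "(a, b) \<in> E2" "a \<in> Y2" "b \<notin> Y2" by auto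
      obtain u where u: "u \<in> Y1" "a = f u" using ab(3) unfolding fY[symmetric] by auto
      have "b \<in> f ` nbhd E1 Y1 1" using nb2[OF ab(2,3)] bij by (simp add: bij_betw_def)
      then obtain v where v: "v \<in> nbhd E1 Y1 1" "b = f v" by blast
      have "u \<in> nbhd E1 Y1 1" using subset_nbhd[of Y1 E1 1] u(1) by blast
      then have "(u, v) \<in> E1" using edge[of u v] ab(2) u v by simp
      moreover have "v \<notin> Y1" using ab(4) v(2) fY by blast
      ultimately have "(u, v) \<in> ?B1" using u(1) by blast
      then have "map_prod f f (u, v) \<in> map_prod f f ` ?B1" by (rule imageI)
      then show "e \<in> map_prod f f ` ?B1" using ab(1) u(2) v(2) by simp
    qed
    ultimately show "bij_betw (map_prod f f) ?B1 ?B2" by (simp add: bij_betw_def)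
  qed
  then show ?thesis unfolding expansion_def using mtype_card[OF G1 Y eq] by simp
qed

lemma conn_at_image:
  assumes G1: "graphing D1 M1 E1" and G2: "graphing D2 M2 E2" and f: "nbhd_iso E1 {x} E2 {y} R f"
    and xy: "x \<in> space M1" "y \<in> space M2" and R: "k * k \<le> R" and Y: "Y \<in> conn_at M1 E1 k x"
  shows "f ` Y \<in> conn_at M2 E2 k y"
proof -
  have Yc: "Y \<in> conn_sets M1 E1 k" "x \<in> Y" using Y by (auto simp: conn_at_def)
  note Y' = graphing.conn_setsD[OF G1 Yc(1)]
  have bij: "bij_betw f (nbhd E1 {x} R) (nbhd E2 {y} R)" and fx: "f x = y"
    and edge: "\<And>u v. u \<in> nbhd E1 {x} R \<Longrightarrow> v \<in> nbhd E1 {x} R \<Longrightarrow> (u, v) \<in> E1 \<longleftrightarrow> (f u, f v) \<in> E2"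
    using f by (auto simp: nbhd_iso_def)
  have YR: "Y \<subseteq> nbhd E1 {x} R"
    using graphing.conn_at_ball[OF G1 Y] ball_nodes_mono[OF R, of E1 x] by (auto simp: nbhd_def)
  have "f ` Y \<subseteq> space M2"
    using YR bij graphing.nbhd_space[OF G2, of "{y}" R] xy by (auto simp: bij_betw_def)
  moreover have "card (f ` Y) = card Y"
    using bij YR by (intro card_image) (auto simp: bij_betw_def intro: inj_on_subset)
  moreover have "induces_connected E2 (f ` Y)"
    using connected_image[OF Y'(5), of f E2] edge YR by blast
  ultimately show ?thesis using Y' Yc fx by (auto simp: conn_at_def conn_sets_def)
qed

text \<open>A connected set at \<open>x\<close> stays within distance \<open>k * k\<close>, so its
  \<open>q\<close>-neighborhood lies in the ball of radius \<open>k * k + q\<close>. An isomorphism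
  of the balls therefore matches the connected sets at \<open>x\<close> with those at
  \<open>y\<close> and preserves their \<open>q\<close>-types.\<close>

lemma local_sum_eq:
  fixes F1 :: "'a set \<Rightarrow> real"
  assumes G1: "graphing D1 M1 E1" and G2: "graphing D2 M2 E2" and xy: "x \<in> space M1" "y \<in> space M2"
    and eq: "mtype E1 {x} R = mtype E2 {y} R" and R: "k * k + q \<le> R"
    and F: "\<And>Y1 Y2. Y1 \<in> conn_sets M1 E1 k \<Longrightarrow> Y2 \<in> conn_sets M2 E2 k \<Longrightarrow>
      mtype E1 Y1 q = mtype E2 Y2 q \<Longrightarrow> F1 Y1 = F2 Y2"
  shows "(\<Sum>Y\<in>conn_at M1 E1 k x. F1 Y) = (\<Sum>Y\<in>conn_at M2 E2 k y. F2 Y)"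
proof -
  have x1: "{x} \<subseteq> space M1" "finite {x}" using xy by auto
  obtain f where f: "nbhd_iso E1 {x} E2 {y} R f" using graphing.mtype_eq_nbhd_iso[OF G1 x1] eq by blast
  let ?g = "inv_into (nbhd E1 {x} R) f"
  have g: "nbhd_iso E2 {y} E1 {x} R ?g" by (rule nbhd_iso_inv[OF f])
  have bij: "bij_betw f (nbhd E1 {x} R) (nbhd E2 {y} R)" using f by (simp add: nbhd_iso_def)
  have kR: "k * k \<le> R" using R by simp
  have sub1: "Y \<subseteq> nbhd E1 {x} (k * k)" "Y \<subseteq> nbhd E1 {x} R" if "Y \<in> conn_at M1 E1 k x" for Y
    using graphing.conn_at_ball[OF G1 that] ball_nodes_mono[OF kR, of E1 x] by (auto simp: nbhd_def)
  have sub2: "Y \<subseteq> nbhd E2 {y} R" if "Y \<in> conn_at M2 E2 k y" for Y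
    using graphing.conn_at_ball[OF G2 that] ball_nodes_mono[OF kR, of E2 y] by (auto simp: nbhd_def)
  have fin: "finite Y" if "Y \<in> conn_at M1 E1 k x" for Y
    using that by (auto simp: conn_at_def conn_sets_def)
  have "bij_betw ((`) f) (conn_at M1 E1 k x) (conn_at M2 E2 k y)"
  proof (rule bij_betw_byWitness[where f' = "(`) ?g"])
    show "\<forall>Y\<in>conn_at M1 E1 k x. ?g ` f ` Y = Y"
    proof
      fix Y assume "Y \<in> conn_at M1 E1 k x"
      then have "?g ` f ` Y = (\<lambda>u. u) ` Y" unfolding image_image
        using sub1(2) bij_betw_inv_into_left[OF bij] by (intro image_cong) auto
      then show "?g ` f ` Y = Y" by simp
    qed
    show "\<forall>Y\<in>conn_at M2 E2 k y. f ` ?g ` Y = Y"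
    proof
      fix Y assume "Y \<in> conn_at M2 E2 k y"
      then have "f ` ?g ` Y = (\<lambda>u. u) ` Y" unfolding image_image
        using sub2 bij_betw_inv_into_right[OF bij] by (intro image_cong) auto
      then show "f ` ?g ` Y = Y" by simp
    qed
    show "(`) f ` conn_at M1 E1 k x \<subseteq> conn_at M2 E2 k y"
      using conn_at_image[OF G1 G2 f xy kR] by blast
    show "(`) ?g ` conn_at M2 E2 k y \<subseteq> conn_at M1 E1 k x"
      using conn_at_image[OF G2 G1 g xy(2,1) kR] by blast
  qed
  then have "(\<Sum>Y\<in>conn_at M2 E2 k y. F2 Y) = (\<Sum>Y\<in>conn_at M1 E1 k x. F2 (f ` Y))"
    by (rule sum.reindex_bij_betw[symmetric])
  also have "\<dots> = (\<Sum>Y\<in>conn_at M1 E1 k x. F1 Y)"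
  proof (rule sum.cong[OF refl], rule F[symmetric])
    fix Y assume Y: "Y \<in> conn_at M1 E1 k x"
    show "Y \<in> conn_sets M1 E1 k" "f ` Y \<in> conn_sets M2 E2 k"
      using Y conn_at_image[OF G1 G2 f xy kR Y] by (auto simp: conn_at_def)
    show "mtype E1 Y q = mtype E2 (f ` Y) q"
      by (rule mtype_restrict[OF G1 f x1(1) sub1(1)[OF Y] fin[OF Y] R])
  qed
  finally show ?thesis by simp
qed

section \<open>Types of balls and integrals of local functions\<close>

lemma nbhd_singleton: "nbhd E {x} r = ball_nodes E x r"
  by (simp add: nbhd_def)

lemma rooted_iso_marked_iso:
  "rooted_iso (rooted_ball E x r) (V, F, y) \<longleftrightarrow> marked_iso (marked_nbhd E {x} r) (V, F, {y})"
  by (simp add: rooted_ball_def marked_nbhd_def nbhd_singleton)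

lemma iso_class_mtype:
  "iso_class (rooted_ball E x r) = {(V, F, y). (V, F, {y}) \<in> mtype E {x} r}"
  unfolding iso_class_def mtype_def mem_Collect_eq rooted_iso_marked_iso[symmetric] by auto

text \<open>Rooted balls and marked singletons carry the same information.
  \<open>iso_class_mtype\<close> yields measurability of the classes; this converse lets equality of
  classes be read as equality of types.\<close>

lemma mtype_iso_class:
  "mtype E {x} r = {(V, F, {y}) | V F y. (V, F, y) \<in> iso_class (rooted_ball E x r)}"
proof (intro equalityI subsetI)
  fix H assume H: "H \<in> mtype E {x} r"
  obtain V F Z where VFZ: "H = (V, F, Z)" by (cases H)
  obtain f where "f ` {x} = Z" using H unfolding VFZ mtype_def marked_nbhd_def by auto
  then have "Z = {f x}" by auto
  then show "H \<in> {(V, F, {y}) | V F y. (V, F, y) \<in> iso_class (rooted_ball E x r)}"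
    using H unfolding VFZ iso_class_mtype by blast
qed (auto simp: iso_class_mtype)

context graphing
begin

lemma singleton_measurable:
  shows "(\<lambda>x. {x}) \<in> measurable M (conn_space M E 1)"
proof -
  have c: "{[]} \<in> cwords 1" by (auto simp: cwords_def words_def)
  have eq: "cset 1 {[]} = (\<lambda>x. {x})" by (rule ext) (simp add: cset_def wset_def)
  show ?thesis using cset_measurable[OF order_refl c] unfolding eq .
qed

lemma root_mtype_measurable [measurable]: "(\<lambda>x. mtype E {x} r) \<in> measurable M (count_space UNIV)"
  using measurable_compose[OF singleton_measurable mtype_measurable] .

lemma iso_class_measurable: "(\<lambda>x. iso_class (rooted_ball E x r)) \<in> measurable M (count_space UNIV)"
  unfolding iso_class_mtype by (rule measurable_compose[OF root_mtype_measurable]) simp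

lemma root_mtype_function_measurable:
  assumes "\<And>x y. x \<in> space M \<Longrightarrow> y \<in> space M \<Longrightarrow> mtype E {x} r = mtype E {y} r \<Longrightarrow> f x = f y"
  shows "f \<in> borel_measurable M"
proof -
  define g where "g t = f (SOME x. x \<in> space M \<and> mtype E {x} r = t)" for t
  have g: "g (mtype E {x} r) = f x" if x: "x \<in> space M" for x
  proof -
    let ?z = "SOME z. z \<in> space M \<and> mtype E {z} r = mtype E {x} r"
    have "?z \<in> space M \<and> mtype E {?z} r = mtype E {x} r" by (rule someI[of _ x]) (use x in simp)
    then show ?thesis unfolding g_def using assms x by blast
  qed
  have "(\<lambda>x. g (mtype E {x} r)) \<in> borel_measurable M"
    by (rule measurable_compose[OF root_mtype_measurable]) simp
  then show ?thesis by (subst measurable_cong[OF g[symmetric]]) auto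
qed

end

text \<open>Both integrands factor through the class of the ball by one function \<open>g\<close>,
  so both integrals are integrals of \<open>g\<close> against the same ball distribution. A class
  may occur in one graphing only; hence the two alternatives in \<open>g\<close> and the assumptions
  \<open>c11\<close> and \<open>c22\<close> beside \<open>c12\<close>.\<close>

lemma local_integral_eq:
  fixes \<psi>1 :: "'a \<Rightarrow> real" and \<psi>2 :: "'b \<Rightarrow> real"
  assumes G1: "graphing D1 M1 E1" and G2: "graphing D2 M2 E2"
    and le: "locally_equivalent M1 E1 M2 E2"
    and c12: "\<And>x y. x \<in> space M1 \<Longrightarrow> y \<in> space M2 \<Longrightarrow> mtype E1 {x} r = mtype E2 {y} r \<Longrightarrow> \<psi>1 x = \<psi>2 y"
    and c11: "\<And>x y. x \<in> space M1 \<Longrightarrow> y \<in> space M1 \<Longrightarrow> mtype E1 {x} r = mtype E1 {y} r \<Longrightarrow> \<psi>1 x = \<psi>1 y"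
    and c22: "\<And>x y. x \<in> space M2 \<Longrightarrow> y \<in> space M2 \<Longrightarrow> mtype E2 {x} r = mtype E2 {y} r \<Longrightarrow> \<psi>2 x = \<psi>2 y"
  shows "(\<integral>x. \<psi>1 x \<partial>M1) = (\<integral>y. \<psi>2 y \<partial>M2)"
proof -
  let ?i1 = "\<lambda>x. iso_class (rooted_ball E1 x r)" and ?i2 = "\<lambda>y. iso_class (rooted_ball E2 y r)"
  define g where "g c = (if \<exists>x. x \<in> space M1 \<and> ?i1 x = c then \<psi>1 (SOME x. x \<in> space M1 \<and> ?i1 x = c)
      else \<psi>2 (SOME y. y \<in> space M2 \<and> ?i2 y = c))" for c
  have mt11: "mtype E1 {x} r = mtype E1 {y} r" if "?i1 x = ?i1 y" for x y
    using that by (simp add: mtype_iso_class)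
  have mt12: "mtype E1 {x} r = mtype E2 {y} r" if "?i1 x = ?i2 y" for x y
    using that by (simp add: mtype_iso_class)
  have mt22: "mtype E2 {x} r = mtype E2 {y} r" if "?i2 x = ?i2 y" for x y
    using that by (simp add: mtype_iso_class)
  have s1: "(SOME z. z \<in> space M1 \<and> ?i1 z = c) \<in> space M1 \<and> ?i1 (SOME z. z \<in> space M1 \<and> ?i1 z = c) = c"
    if "\<exists>x. x \<in> space M1 \<and> ?i1 x = c" for c using someI_ex[OF that] .
  have s2: "(SOME z. z \<in> space M2 \<and> ?i2 z = c) \<in> space M2 \<and> ?i2 (SOME z. z \<in> space M2 \<and> ?i2 z = c) = c"
    if "\<exists>x. x \<in> space M2 \<and> ?i2 x = c" for c using someI_ex[OF that] .
  have g1: "g (?i1 x) = \<psi>1 x" if x: "x \<in> space M1" for x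
  proof -
    have ex: "\<exists>z. z \<in> space M1 \<and> ?i1 z = ?i1 x" using x by blast
    then show ?thesis unfolding g_def using c11[OF _ x mt11] s1[OF ex] by simp
  qed
  have g2: "g (?i2 y) = \<psi>2 y" if y: "y \<in> space M2" for y
  proof (cases "\<exists>x. x \<in> space M1 \<and> ?i1 x = ?i2 y")
    case True
    then show ?thesis unfolding g_def using c12[OF _ y mt12] s1[OF True] by simp
  next
    case False
    have ex: "\<exists>z. z \<in> space M2 \<and> ?i2 z = ?i2 y" using y by blast
    have "g (?i2 y) = \<psi>2 (SOME z. z \<in> space M2 \<and> ?i2 z = ?i2 y)"
      unfolding g_def using False by (rule if_not_P)
    then show ?thesis using c22[OF _ y mt22] s2[OF ex] by simp
  qed
  have "(\<integral>x. \<psi>1 x \<partial>M1) = (\<integral>x. g (?i1 x) \<partial>M1)"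
    by (rule Bochner_Integration.integral_cong) (use g1 in auto)
  also have "\<dots> = (\<integral>c. g c \<partial>ball_distr M1 E1 r)" unfolding ball_distr_def
    by (rule integral_distr[symmetric]) (use graphing.iso_class_measurable[OF G1] in auto)
  also have "\<dots> = (\<integral>c. g c \<partial>ball_distr M2 E2 r)"
    using le by (simp add: locally_equivalent_def)
  also have "\<dots> = (\<integral>y. g (?i2 y) \<partial>M2)" unfolding ball_distr_def
    by (rule integral_distr) (use graphing.iso_class_measurable[OF G2] in auto)
  also have "\<dots> = (\<integral>y. \<psi>2 y \<partial>M2)"
    by (rule Bochner_Integration.integral_cong) (use g2 in auto)
  finally show ?thesis .
qed

section \<open>Fractional partitions from weights\<close>

context graphing
begin

abbreviation conn_sum :: "nat \<Rightarrow> ('a set \<Rightarrow> real) \<Rightarrow> 'a \<Rightarrow> real" where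
  "conn_sum k f x \<equiv> (\<Sum>Y\<in>conn_at M E k x. f Y)"

lemma conn_at_sets: "Y \<in> conn_at M E k x \<Longrightarrow> Y \<in> conn_sets M E k"
  by (simp add: conn_at_def)

lemma conn_sum_measurable_real:
  assumes "k \<ge> 1" and f[measurable]: "f \<in> borel_measurable (conn_space M E k)"
    and pos: "\<And>Y. Y \<in> conn_sets M E k \<Longrightarrow> 0 \<le> f Y"
  shows "conn_sum k f \<in> borel_measurable M"
proof -
  have "conn_sum k f x = enn2real (\<Sum>Y\<in>conn_at M E k x. ennreal (f Y))" for x
  proof -
    have "(\<Sum>Y\<in>conn_at M E k x. ennreal (f Y)) = ennreal (conn_sum k f x)"
      by (rule sum_ennreal) (use pos conn_at_sets in auto)
    moreover have "0 \<le> conn_sum k f x" by (rule sum_nonneg) (use pos conn_at_sets in auto)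
    ultimately show ?thesis by simp
  qed
  moreover have "(\<lambda>x. enn2real (\<Sum>Y\<in>conn_at M E k x. ennreal (f Y))) \<in> borel_measurable M"
    using conn_sum_measurable[OF assms(1), of "\<lambda>Y. ennreal (f Y)"] by measurable
  ultimately show ?thesis by simp
qed

lemma space_kappa: "k \<ge> 1 \<Longrightarrow> space (kappa k) = conn_sets M E k"
  using sets_eq_imp_space_eq[OF sets_kappa] by simp

lemma measurable_kappa: "k \<ge> 1 \<Longrightarrow> borel_measurable (kappa k) = borel_measurable (conn_space M E k)"
  by (rule measurable_cong_sets[OF sets_kappa]) auto

lemma integral_kappa:
  assumes k: "k \<ge> 1" and f[measurable]: "f \<in> borel_measurable (conn_space M E k)"
    and pos: "\<And>Y. Y \<in> conn_sets M E k \<Longrightarrow> 0 \<le> f Y"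
  shows "(\<integral>Y. f Y \<partial>kappa k) = (\<integral>x. conn_sum k f x \<partial>M)"
proof -
  have "(\<integral>Y. f Y \<partial>kappa k) = enn2real (\<integral>\<^sup>+Y. ennreal (f Y) \<partial>kappa k)"
    by (rule integral_eq_nn_integral) (use f pos space_kappa[OF k] in \<open>auto simp: measurable_kappa[OF k]\<close>)
  also have "(\<integral>\<^sup>+Y. ennreal (f Y) \<partial>kappa k) = (\<integral>\<^sup>+x. (\<Sum>Y\<in>conn_at M E k x. ennreal (f Y)) \<partial>M)"
    by (rule nn_integral_kappa[OF k]) measurable
  also have "\<dots> = (\<integral>\<^sup>+x. ennreal (conn_sum k f x) \<partial>M)"
    by (rule nn_integral_cong, rule sum_ennreal) (use pos conn_at_sets in auto)
  also have "enn2real \<dots> = (\<integral>x. conn_sum k f x \<partial>M)"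
    by (rule integral_eq_nn_integral[symmetric])
      (use conn_sum_measurable_real[OF k f pos] pos conn_at_sets in \<open>auto intro!: sum_nonneg\<close>)
  finally show ?thesis .
qed

lemma integral_kappa_transport:
  assumes k: "k \<ge> 1" and \<phi>[measurable]: "\<phi> \<in> borel_measurable M"
    and f[measurable]: "f \<in> borel_measurable (conn_space M E k)"
    and \<phi>0: "\<And>x. x \<in> space M \<Longrightarrow> 0 \<le> \<phi> x" and pos: "\<And>Y. Y \<in> conn_sets M E k \<Longrightarrow> 0 \<le> f Y"
  shows "(\<integral>x. \<phi> x * conn_sum k f x \<partial>M) = (\<integral>Y. f Y * ((\<Sum>x\<in>Y. \<phi> x) / real (card Y)) \<partial>kappa k)"
proof -
  note [measurable] = conn_sum_measurable_real[OF k f pos] sum_measurable[OF \<phi>, of k]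
  have sum0: "0 \<le> conn_sum k f x" for x by (rule sum_nonneg) (use pos conn_at_sets in auto)
  have \<phi>sum: "0 \<le> (\<Sum>x\<in>Y. \<phi> x)" if "Y \<in> conn_sets M E k" for Y
    using conn_setsD(1)[OF that] \<phi>0 by (intro sum_nonneg) auto
  have "(\<integral>x. \<phi> x * conn_sum k f x \<partial>M) = enn2real (\<integral>\<^sup>+x. ennreal (\<phi> x * conn_sum k f x) \<partial>M)"
    by (rule integral_eq_nn_integral) (use \<phi>0 sum0 in auto)
  also have "(\<integral>\<^sup>+x. ennreal (\<phi> x * conn_sum k f x) \<partial>M) =
      (\<integral>\<^sup>+x. ennreal (\<phi> x) * (\<Sum>Y\<in>conn_at M E k x. ennreal (f Y)) \<partial>M)"
  proof (rule nn_integral_cong)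
    fix x assume x: "x \<in> space M"
    have "(\<Sum>Y\<in>conn_at M E k x. ennreal (f Y)) = ennreal (conn_sum k f x)"
      by (rule sum_ennreal) (use pos conn_at_sets in auto)
    then show "ennreal (\<phi> x * conn_sum k f x) = ennreal (\<phi> x) * (\<Sum>Y\<in>conn_at M E k x. ennreal (f Y))"
      using ennreal_mult[OF \<phi>0[OF x] sum0] by simp
  qed
  also have "\<dots> = (\<integral>\<^sup>+Y. ennreal (f Y) * ((\<Sum>x\<in>Y. ennreal (\<phi> x)) * ennreal (1 / real (card Y))) \<partial>kappa k)"
    by (rule kappa_transport[OF k]) measurable
  also have "\<dots> = (\<integral>\<^sup>+Y. ennreal (f Y * ((\<Sum>x\<in>Y. \<phi> x) / real (card Y))) \<partial>kappa k)"
  proof (rule nn_integral_cong)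
    fix Y assume "Y \<in> space (kappa k)"
    then have Y: "Y \<in> conn_sets M E k" using space_kappa[OF k] by simp
    have "(\<Sum>x\<in>Y. ennreal (\<phi> x)) = ennreal (\<Sum>x\<in>Y. \<phi> x)"
      by (rule sum_ennreal) (use conn_setsD(1)[OF Y] \<phi>0 in auto)
    then have "(\<Sum>x\<in>Y. ennreal (\<phi> x)) * ennreal (1 / real (card Y)) = ennreal ((\<Sum>x\<in>Y. \<phi> x) * (1 / real (card Y)))"
      using ennreal_mult[OF \<phi>sum[OF Y], of "1 / real (card Y)"] by simp
    then show "ennreal (f Y) * ((\<Sum>x\<in>Y. ennreal (\<phi> x)) * ennreal (1 / real (card Y))) =
        ennreal (f Y * ((\<Sum>x\<in>Y. \<phi> x) / real (card Y)))"
      using ennreal_mult[OF pos[OF Y], of "(\<Sum>x\<in>Y. \<phi> x) * (1 / real (card Y))"] \<phi>sum[OF Y] by simp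
  qed
  also have "enn2real \<dots> = (\<integral>Y. f Y * ((\<Sum>x\<in>Y. \<phi> x) / real (card Y)) \<partial>kappa k)"
    by (rule integral_eq_nn_integral[symmetric])
      (use pos \<phi>sum space_kappa[OF k] in \<open>auto simp: measurable_kappa[OF k] intro!: mult_nonneg_nonneg divide_nonneg_nonneg\<close>)
  finally show ?thesis .
qed

text \<open>The number of names for connected sets at a node, used as a bound both for the number of
  connected sets at a node and for the total mass of \<open>kappa\<close>.\<close>

definition cbound :: "nat \<Rightarrow> real" where
  "cbound k = real (card (cwords k))"

lemma cbound_ge_1: "1 \<le> cbound k"
proof -
  have "{} \<in> cwords k" by (simp add: cwords_def)
  then have "0 < card (cwords k)" unfolding card_gt_0_iff using finite_cwords by blast
  then show ?thesis by (simp add: cbound_def)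
qed

lemma card_conn_at: "x \<in> space M \<Longrightarrow> real (card (conn_at M E k x)) \<le> cbound k"
proof -
  assume x: "x \<in> space M"
  have "card (conn_at M E k x) = card ((\<lambda>c. wset c x) ` {c \<in> cwords k. wset c x \<in> conn_at M E k x})"
    by (rule arg_cong[OF conn_at_wset[OF x]])
  also have "\<dots> \<le> card {c \<in> cwords k. wset c x \<in> conn_at M E k x}"
    by (rule card_image_le) simp
  also have "\<dots> \<le> card (cwords k)" by (rule card_mono) auto
  finally show ?thesis by (simp add: cbound_def)
qed

lemma conn_sum_bound:
  assumes x: "x \<in> space M" and f: "\<And>Y. Y \<in> conn_sets M E k \<Longrightarrow> f Y \<le> B" and "0 \<le> B"
  shows "conn_sum k f x \<le> cbound k * B"
proof -
  have "conn_sum k f x \<le> real (card (conn_at M E k x)) * B"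
    by (rule sum_bounded_above) (use f conn_at_sets in auto)
  also have "\<dots> \<le> cbound k * B" using card_conn_at[OF x] assms(3) by (rule mult_right_mono)
  finally show ?thesis .
qed

lemma conn_sum_nonneg:
  assumes "\<And>Y. Y \<in> conn_sets M E k \<Longrightarrow> 0 \<le> f Y"
  shows "0 \<le> conn_sum k f x"
  by (rule sum_nonneg) (use assms conn_at_sets in auto)

lemma emeasure_kappa_space: "k \<ge> 1 \<Longrightarrow> emeasure (kappa k) (space (kappa k)) \<le> ennreal (cbound k)"
proof -
  assume k: "k \<ge> 1"
  have "emeasure (kappa k) (space (kappa k)) = (\<integral>\<^sup>+Y. 1 \<partial>kappa k)" by simp
  also have "\<dots> = (\<integral>\<^sup>+x. (\<Sum>Y\<in>conn_at M E k x. 1) \<partial>M)" by (rule nn_integral_kappa[OF k]) simp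
  also have "\<dots> \<le> (\<integral>\<^sup>+x. ennreal (cbound k) \<partial>M)"
    by (rule nn_integral_mono) (use card_conn_at in \<open>simp add: ennreal_of_nat_eq_real_of_nat ennreal_leI\<close>)
  also have "\<dots> = ennreal (cbound k)" by (simp add: emeasure_space_1)
  finally show ?thesis .
qed

lemma finite_measure_kappa: "k \<ge> 1 \<Longrightarrow> finite_measure (kappa k)"
  using emeasure_kappa_space[of k] by (intro finite_measureI) (auto simp: top_unique)

lemma bounded_integrable:
  fixes f :: "'a \<Rightarrow> real"
  assumes "f \<in> borel_measurable M" "\<And>x. x \<in> space M \<Longrightarrow> \<bar>f x\<bar> \<le> B"
  shows "integrable M f"
  by (rule integrable_const_bound[of _ B]) (use assms in auto)

lemma expansion_nonneg: "0 \<le> expansion M E Y"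
  by (simp add: expansion_def)

lemma expansion_bound:
  assumes "Y \<in> conn_sets M E k"
  shows "expansion M E Y \<le> real D"
proof -
  note Y = conn_setsD[OF assms]
  have "edge_boundary M E Y \<subseteq> (SIGMA x:Y. {y. (x, y) \<in> E})" by (auto simp: edge_boundary_def)
  moreover have fin: "finite (SIGMA x:Y. {y. (x, y) \<in> E})"
    by (rule finite_SigmaI) (use Y nbrs_bound in auto)
  ultimately have "card (edge_boundary M E Y) \<le> card (SIGMA x:Y. {y. (x, y) \<in> E})" by (rule card_mono[rotated])
  also have "\<dots> = (\<Sum>x\<in>Y. card {y. (x, y) \<in> E})"
    by (rule card_SigmaI) (use Y nbrs_bound in auto)
  also have "\<dots> \<le> card Y * D" using sum_bounded_above[of Y "\<lambda>x. card {y. (x, y) \<in> E}" D] Y nbrs_bound by auto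
  finally have "real (card (edge_boundary M E Y)) \<le> real (card Y) * real D"
    by (metis of_nat_le_iff of_nat_mult)
  then show ?thesis using Y(4) by (simp add: expansion_def field_simps)
qed

lemma expansion_measurable [measurable]: "expansion M E \<in> borel_measurable (conn_space M E k)"
proof (rule mtype_function_measurable)
  fix Y Y' assume "Y \<in> conn_sets M E k" "mtype E Y 1 = mtype E Y' 1"
  then show "expansion M E Y = expansion M E Y'"
    using mtype_expansion[OF graphing_axioms graphing_axioms conn_setsD(1,2)] by blast
qed

text \<open>By \<open>kappa_transport\<close> with an indicator as \<open>\<phi>\<close>, the
  marginal of the measure with density \<open>W\<close> has the node sums of \<open>W\<close> as its
  own density.\<close>

lemma fractional_partition_of_weight:
  assumes k: "k \<ge> 1" and W[measurable]: "W \<in> borel_measurable (conn_space M E k)"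
    and pos: "\<And>Y. Y \<in> conn_sets M E k \<Longrightarrow> 0 \<le> W Y"
    and one: "\<And>x. x \<in> space M \<Longrightarrow> conn_sum k W x = 1"
  shows "fractional_partition M E k (density (kappa k) (\<lambda>Y. ennreal (W Y)))"
    and "(\<integral>Y. expansion M E Y \<partial>density (kappa k) (\<lambda>Y. ennreal (W Y))) =
      (\<integral>x. conn_sum k (\<lambda>Y. expansion M E Y * W Y) x \<partial>M)"
proof -
  let ?\<tau> = "density (kappa k) (\<lambda>Y. ennreal (W Y))"
  have Wk[measurable]: "W \<in> borel_measurable (kappa k)" unfolding measurable_kappa[OF k] by (rule W)
  have ennsum: "(\<Sum>Y\<in>conn_at M E k x. ennreal (W Y)) = 1" if "x \<in> space M" for x
    using sum_ennreal[of "conn_at M E k x" W] one[OF that] pos conn_at_sets by auto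
  have marg: "(\<integral>\<^sup>+Y. ((\<Sum>x\<in>Y. indicator X x) * ennreal (1 / real (card Y))) \<partial>?\<tau>) = emeasure M X"
    if X: "X \<in> sets M" for X
  proof -
    have [measurable]: "(\<lambda>Y. \<Sum>x\<in>Y. indicator X x :: ennreal) \<in> borel_measurable (conn_space M E k)"
      by (rule sum_measurable) (use X in measurable)
    have m: "(\<lambda>Y. (\<Sum>x\<in>Y. indicator X x) * ennreal (1 / real (card Y))) \<in> borel_measurable (kappa k)"
      unfolding measurable_kappa[OF k] by measurable
    have "(\<integral>\<^sup>+Y. ((\<Sum>x\<in>Y. indicator X x) * ennreal (1 / real (card Y))) \<partial>?\<tau>) =
        (\<integral>\<^sup>+Y. ennreal (W Y) * ((\<Sum>x\<in>Y. indicator X x) * ennreal (1 / real (card Y))) \<partial>kappa k)"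
      by (rule nn_integral_density[OF _ m]) measurable
    also have "\<dots> = (\<integral>\<^sup>+x. indicator X x * (\<Sum>Y\<in>conn_at M E k x. ennreal (W Y)) \<partial>M)"
      by (rule kappa_transport[OF k, symmetric]) (use X in measurable)
    also have "\<dots> = (\<integral>\<^sup>+x. indicator X x \<partial>M)" by (rule nn_integral_cong) (simp add: ennsum)
    also have "\<dots> = emeasure M X" using X by simp
    finally show ?thesis .
  qed
  have "emeasure ?\<tau> (space ?\<tau>) = (\<integral>\<^sup>+Y. ennreal (W Y) \<partial>kappa k)"
    by (subst emeasure_density) (auto intro!: nn_integral_cong)
  also have "\<dots> = (\<integral>\<^sup>+x. (\<Sum>Y\<in>conn_at M E k x. ennreal (W Y)) \<partial>M)"
    by (rule nn_integral_kappa[OF k]) measurable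
  also have "\<dots> = (\<integral>\<^sup>+x. 1 \<partial>M)" by (rule nn_integral_cong) (rule ennsum)
  finally have "prob_space ?\<tau>" by (intro prob_spaceI) (simp add: emeasure_space_1)
  moreover have "marginal ?\<tau> X = emeasure M X" if "X \<in> sets M" for X
  proof -
    have "marginal ?\<tau> X = (\<integral>\<^sup>+Y. ((\<Sum>x\<in>Y. indicator X x) * ennreal (1 / real (card Y))) \<partial>?\<tau>)"
      unfolding marginal_def
    proof (rule nn_integral_cong)
      fix Y assume "Y \<in> space ?\<tau>"
      then have "finite Y" using space_kappa[OF k] conn_setsD(2) by auto
      then have "(\<Sum>x\<in>Y. indicator X x :: ennreal) = of_nat (card (X \<inter> Y))"
        by (simp add: indicator_def sum.If_cases Int_commute)
      then show "ennreal (real (card (X \<inter> Y)) / real (card Y)) = (\<Sum>x\<in>Y. indicator X x) * ennreal (1 / real (card Y))"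
        by (simp add: ennreal_of_nat_eq_real_of_nat ennreal_mult'[symmetric])
    qed
    then show ?thesis using marg[OF that] by simp
  qed
  ultimately show "fractional_partition M E k ?\<tau>"
    unfolding fractional_partition_def using sets_kappa[OF k] by simp
  have "(\<integral>Y. expansion M E Y \<partial>?\<tau>) = (\<integral>Y. W Y * expansion M E Y \<partial>kappa k)"
    by (subst integral_density) (use pos space_kappa[OF k] in \<open>auto simp: measurable_kappa[OF k]\<close>)
  also have "\<dots> = (\<integral>x. conn_sum k (\<lambda>Y. W Y * expansion M E Y) x \<partial>M)"
    by (rule integral_kappa[OF k]) (use pos expansion_nonneg in \<open>auto intro!: mult_nonneg_nonneg\<close>)
  finally show "(\<integral>Y. expansion M E Y \<partial>?\<tau>) = (\<integral>x. conn_sum k (\<lambda>Y. expansion M E Y * W Y) x \<partial>M)"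
    by (simp add: mult.commute)
qed

text \<open>An approximate fractional partition is repaired by scaling down the sets that meet overloaded
  nodes and covering what is then missing by singletons.\<close>

lemma fractional_partition_repair:
  assumes k: "k \<ge> 1" and W[measurable]: "W \<in> borel_measurable (conn_space M E k)"
    and W01: "\<And>Y. Y \<in> conn_sets M E k \<Longrightarrow> 0 \<le> W Y \<and> W Y \<le> 1"
  shows "\<exists>\<tau>. fractional_partition M E k \<tau> \<and> (\<integral>Y. expansion M E Y \<partial>\<tau>) \<le>
    (\<integral>x. conn_sum k (\<lambda>Y. expansion M E Y * W Y) x \<partial>M) +
    real D * (1 + real k * cbound k) * (\<integral>x. \<bar>conn_sum k W x - 1\<bar> \<partial>M)"
proof -
  define s where "s = conn_sum k W"
  have s[measurable]: "s \<in> borel_measurable M"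
    unfolding s_def by (rule conn_sum_measurable_real[OF k W]) (use W01 in auto)
  have s0: "0 \<le> s x" for x unfolding s_def by (rule conn_sum_nonneg) (use W01 in auto)
  have sB: "s x \<le> cbound k" if "x \<in> space M" for x
    using conn_sum_bound[OF that, of k W 1] W01 by (auto simp: s_def)
  define \<delta> where "\<delta> x = \<bar>s x - 1\<bar>" for x
  have \<delta>[measurable]: "\<delta> \<in> borel_measurable M" unfolding \<delta>_def by measurable
  have \<delta>0: "0 \<le> \<delta> x" for x by (simp add: \<delta>_def)
  have \<delta>B: "\<delta> x \<le> cbound k + 1" if "x \<in> space M" for x
    using s0[of x] sB[OF that] by (simp add: \<delta>_def)
  define \<Delta> where "\<Delta> Y = (\<Sum>x\<in>Y. \<delta> x)" for Y
  have \<Delta>[measurable]: "\<Delta> \<in> borel_measurable (conn_space M E k)"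
    unfolding \<Delta>_def by (rule sum_measurable) measurable
  have \<Delta>0: "0 \<le> \<Delta> Y" for Y unfolding \<Delta>_def by (rule sum_nonneg) (rule \<delta>0)
  have \<Delta>B: "\<Delta> Y \<le> real k * (cbound k + 1)" if Y: "Y \<in> conn_sets M E k" for Y
  proof -
    have "\<Delta> Y \<le> real (card Y) * (cbound k + 1)"
      unfolding \<Delta>_def by (rule sum_bounded_above) (use conn_setsD[OF Y] \<delta>B in auto)
    also have "\<dots> \<le> real k * (cbound k + 1)"
      using conn_setsD(3)[OF Y] cbound_ge_1[of k] by (intro mult_right_mono) auto
    finally show ?thesis .
  qed
  \<comment> \<open>For \<open>x \<in> Y\<close> one has \<open>\<delta> x \<le> \<Delta> Y\<close>,
    so the new node sum at \<open>x\<close> is at most \<open>s x / (1 + \<delta> x)\<close>, and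
    this is at most 1 because \<open>s x \<le> 1 + \<delta> x\<close>. The loss on \<open>Y\<close>
    is at most \<open>\<Delta> Y\<close>.\<close>
  define W' where "W' Y = W Y / (1 + \<Delta> Y)" for Y
  have W'[measurable]: "W' \<in> borel_measurable (conn_space M E k)" unfolding W'_def by measurable
  have W'0: "0 \<le> W' Y" "W' Y \<le> W Y" "W Y - W' Y \<le> \<Delta> Y" if Y: "Y \<in> conn_sets M E k" for Y
  proof -
    have d: "0 < 1 + \<Delta> Y" using \<Delta>0[of Y] by simp
    show "0 \<le> W' Y" using W01[OF Y] d by (simp add: W'_def)
    have "W Y * 1 \<le> W Y * (1 + \<Delta> Y)" using W01[OF Y] \<Delta>0[of Y] by (intro mult_left_mono) auto
    then show "W' Y \<le> W Y" using d by (simp add: W'_def divide_le_eq)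
    have "W Y - W' Y = W' Y * \<Delta> Y" using d by (simp add: W'_def field_simps)
    also have "\<dots> \<le> 1 * \<Delta> Y"
      using \<open>W' Y \<le> W Y\<close> W01[OF Y] \<Delta>0[of Y] by (intro mult_right_mono) auto
    finally show "W Y - W' Y \<le> \<Delta> Y" by simp
  qed
  define s' where "s' = conn_sum k W'"
  have s'[measurable]: "s' \<in> borel_measurable M"
    unfolding s'_def by (rule conn_sum_measurable_real[OF k W']) (use W'0 in auto)
  have s'1: "s' x \<le> 1" for x
  proof -
    have "s' x \<le> (\<Sum>Y\<in>conn_at M E k x. W Y / (1 + \<delta> x))"
      unfolding s'_def
    proof (rule sum_mono)
      fix Y assume Y: "Y \<in> conn_at M E k x"
      then have Yc: "Y \<in> conn_sets M E k" "x \<in> Y" by (auto simp: conn_at_def)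
      have "\<delta> x \<le> \<Delta> Y" unfolding \<Delta>_def
        by (rule member_le_sum) (use Yc \<delta>0 conn_setsD(2)[OF Yc(1)] in auto)
      then show "W' Y \<le> W Y / (1 + \<delta> x)"
        unfolding W'_def using W01[OF Yc(1)] \<delta>0[of x] by (intro divide_left_mono) (auto intro!: mult_pos_pos)
    qed
    also have "\<dots> = s x / (1 + \<delta> x)" by (simp add: s_def sum_divide_distrib)
    also have "\<dots> \<le> 1"
    proof -
      have "s x \<le> 1 + \<delta> x" unfolding \<delta>_def by linarith
      moreover have "0 < 1 + \<delta> x" using \<delta>0[of x] by linarith
      ultimately show ?thesis by simp
    qed
    finally show ?thesis .
  qed
  \<comment> \<open>The singleton at \<open>x\<close> receives the deficit \<open>1 - s' x\<close>.
    Written as a sum over \<open>Y\<close>, the deficit is measurable by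
    \<open>sum_measurable\<close>.\<close>
  define V where "V Y = W' Y + (if card Y = 1 then \<Sum>x\<in>Y. 1 - s' x else 0)" for Y
  have [measurable]: "(\<lambda>Y. \<Sum>x\<in>Y. 1 - s' x) \<in> borel_measurable (conn_space M E k)"
    by (rule sum_measurable) measurable
  have cm: "Measurable.pred (conn_space M E k) (\<lambda>Y. real (card Y) = 1)" by measurable
  then have [measurable]: "Measurable.pred (conn_space M E k) (\<lambda>Y. card Y = 1)" by simp
  have V[measurable]: "V \<in> borel_measurable (conn_space M E k)" unfolding V_def by measurable
  have V0: "0 \<le> V Y" if "Y \<in> conn_sets M E k" for Y
    unfolding V_def using W'0(1)[OF that] s'1 by (auto intro!: add_nonneg_nonneg sum_nonneg)
  have single: "(\<Sum>Y\<in>conn_at M E k x. g Y * (if card Y = 1 then \<Sum>x\<in>Y. 1 - s' x else 0)) = g {x} * (1 - s' x)"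
    if x: "x \<in> space M" for x and g :: "'a set \<Rightarrow> real"
  proof -
    have "(\<Sum>Y\<in>conn_at M E k x. g Y * (if card Y = 1 then \<Sum>x\<in>Y. 1 - s' x else 0)) =
        (\<Sum>Y\<in>conn_at M E k x. if Y = {x} then g {x} * (1 - s' x) else 0)"
    proof (rule sum.cong[OF refl])
      fix Y assume "Y \<in> conn_at M E k x"
      then have "x \<in> Y" by (simp add: conn_at_def)
      then have "card Y = 1 \<longleftrightarrow> Y = {x}" by (auto simp: card_1_singleton_iff)
      then show "g Y * (if card Y = 1 then \<Sum>x\<in>Y. 1 - s' x else 0) = (if Y = {x} then g {x} * (1 - s' x) else 0)"
        by auto
    qed
    also have "\<dots> = g {x} * (1 - s' x)"
    proof -
      have "{x} \<in> conn_at M E k x" using singleton_conn[OF x k] by (simp add: conn_at_def)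
      then show ?thesis using finite_conn_at[OF x, of k] by simp
    qed
    finally show ?thesis .
  qed
  have V1: "conn_sum k V x = 1" if x: "x \<in> space M" for x
    using single[OF x, of "\<lambda>_. 1"] by (simp add: V_def sum.distrib s'_def)
  let ?\<tau> = "density (kappa k) (\<lambda>Y. ennreal (V Y))"
  have \<tau>: "fractional_partition M E k ?\<tau>"
    and cost: "(\<integral>Y. expansion M E Y \<partial>?\<tau>) = (\<integral>x. conn_sum k (\<lambda>Y. expansion M E Y * V Y) x \<partial>M)"
    by (rule fractional_partition_of_weight[OF k V V0 V1]; assumption)+
  have pw: "conn_sum k (\<lambda>Y. expansion M E Y * V Y) x \<le>
      conn_sum k (\<lambda>Y. expansion M E Y * W Y) x + real D * (\<delta> x + conn_sum k \<Delta> x)" if x: "x \<in> space M" for x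
  proof -
    have "conn_sum k (\<lambda>Y. expansion M E Y * V Y) x =
        conn_sum k (\<lambda>Y. expansion M E Y * W' Y) x + expansion M E {x} * (1 - s' x)"
      unfolding V_def distrib_left sum.distrib single[OF x] ..
    also have "conn_sum k (\<lambda>Y. expansion M E Y * W' Y) x \<le> conn_sum k (\<lambda>Y. expansion M E Y * W Y) x"
      by (rule sum_mono) (use W'0(2) conn_at_sets expansion_nonneg in \<open>auto intro!: mult_left_mono\<close>)
    also have "expansion M E {x} * (1 - s' x) \<le> real D * (1 - s' x)"
      using expansion_bound[OF singleton_conn[OF x k]] s'1[of x] by (intro mult_right_mono) auto
    also have "1 - s' x \<le> \<delta> x + conn_sum k \<Delta> x"
    proof -
      have "s x - s' x = (\<Sum>Y\<in>conn_at M E k x. W Y - W' Y)" by (simp add: s_def s'_def sum_subtractf)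
      also have "\<dots> \<le> conn_sum k \<Delta> x" by (rule sum_mono) (use W'0(3) conn_at_sets in auto)
      finally show ?thesis by (simp add: \<delta>_def)
    qed
    finally show ?thesis by (simp add: mult_left_mono)
  qed
  have i1: "integrable M (conn_sum k (\<lambda>Y. expansion M E Y * W Y))"
  proof (rule bounded_integrable[where B = "cbound k * real D"])
    have p: "0 \<le> expansion M E Y * W Y" "expansion M E Y * W Y \<le> real D" if "Y \<in> conn_sets M E k" for Y
      using expansion_bound[OF that] expansion_nonneg W01[OF that] mult_mono[of "expansion M E Y" "real D" "W Y" 1]
      by auto
    show "conn_sum k (\<lambda>Y. expansion M E Y * W Y) \<in> borel_measurable M"
      by (rule conn_sum_measurable_real[OF k]) (use p in auto)
    show "\<bar>conn_sum k (\<lambda>Y. expansion M E Y * W Y) x\<bar> \<le> cbound k * real D" if "x \<in> space M" for x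
      using conn_sum_bound[OF that, of k "\<lambda>Y. expansion M E Y * W Y" "real D"] p
        conn_sum_nonneg[of k "\<lambda>Y. expansion M E Y * W Y" x] by auto
  qed
  have i2: "integrable M \<delta>" by (rule bounded_integrable[OF \<delta>, of "cbound k + 1"]) (use \<delta>0 \<delta>B in auto)
  have csB: "\<bar>conn_sum k \<Delta> x\<bar> \<le> cbound k * (real k * (cbound k + 1))" if "x \<in> space M" for x
    using conn_sum_bound[OF that, of k \<Delta> "real k * (cbound k + 1)"] \<Delta>B cbound_ge_1[of k]
      conn_sum_nonneg[of k \<Delta> x] \<Delta>0 by auto
  have [measurable]: "conn_sum k \<Delta> \<in> borel_measurable M"
    by (rule conn_sum_measurable_real[OF k \<Delta>]) (rule \<Delta>0)
  have i3: "integrable M (conn_sum k \<Delta>)" by (rule bounded_integrable[OF _ csB]) measurable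
  have crd[measurable]: "conn_sum k (\<lambda>Y. real (card Y)) \<in> borel_measurable M"
    by (rule conn_sum_measurable_real[OF k]) auto
  have crdB: "conn_sum k (\<lambda>Y. real (card Y)) x \<le> cbound k * real k" if "x \<in> space M" for x
    by (rule conn_sum_bound[OF that]) (use conn_setsD(3) in auto)
  have crd0: "0 \<le> conn_sum k (\<lambda>Y. real (card Y)) x" for x by (rule conn_sum_nonneg) simp
  have le: "\<delta> x * conn_sum k (\<lambda>Y. real (card Y)) x \<le> (cbound k * real k) * \<delta> x" if "x \<in> space M" for x
    using mult_left_mono[OF crdB[OF that] \<delta>0[of x]] by (simp add: mult.commute)
  \<comment> \<open>Transport moves the sum of \<open>\<delta>\<close> over a set back to single
    nodes. A node lies in at most \<open>cbound k\<close> sets of size at most \<open>k\<close>;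
    this is the factor \<open>real k * cbound k\<close> of the statement, while
    \<open>real D\<close> bounds the expansion of the added singletons.\<close>
  have "(\<integral>x. conn_sum k \<Delta> x \<partial>M) = (\<integral>Y. \<Delta> Y \<partial>kappa k)"
    by (rule integral_kappa[OF k \<Delta>, symmetric]) (rule \<Delta>0)
  also have "\<dots> = (\<integral>Y. real (card Y) * ((\<Sum>x\<in>Y. \<delta> x) / real (card Y)) \<partial>kappa k)"
    by (rule Bochner_Integration.integral_cong[OF refl])
      (use space_kappa[OF k] conn_setsD(4) in \<open>auto simp: \<Delta>_def\<close>)
  also have "\<dots> = (\<integral>x. \<delta> x * conn_sum k (\<lambda>Y. real (card Y)) x \<partial>M)"
    by (rule integral_kappa_transport[OF k, symmetric]) (use \<delta>0 in auto)
  also have "\<dots> \<le> (\<integral>x. (cbound k * real k) * \<delta> x \<partial>M)"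
  proof (rule integral_mono)
    show "integrable M (\<lambda>x. (cbound k * real k) * \<delta> x)" using i2 by simp
    show "integrable M (\<lambda>x. \<delta> x * conn_sum k (\<lambda>Y. real (card Y)) x)"
      by (rule Bochner_Integration.integrable_bound[of M "\<lambda>x. (cbound k * real k) * \<delta> x"])
        (use i2 le \<delta>0 crd0 cbound_ge_1[of k] in \<open>auto simp: abs_mult\<close>)
  qed (rule le)
  finally have \<Delta>int: "(\<integral>x. conn_sum k \<Delta> x \<partial>M) \<le> (cbound k * real k) * (\<integral>x. \<delta> x \<partial>M)" by simp
  have "(\<integral>x. conn_sum k (\<lambda>Y. expansion M E Y * V Y) x \<partial>M) \<le>
      (\<integral>x. conn_sum k (\<lambda>Y. expansion M E Y * W Y) x + real D * (\<delta> x + conn_sum k \<Delta> x) \<partial>M)"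
  proof (rule integral_mono')
    show "integrable M (\<lambda>x. conn_sum k (\<lambda>Y. expansion M E Y * W Y) x + real D * (\<delta> x + conn_sum k \<Delta> x))"
      using i1 i2 i3 by simp
    show "0 \<le> conn_sum k (\<lambda>Y. expansion M E Y * W Y) x + real D * (\<delta> x + conn_sum k \<Delta> x)" for x
      using \<delta>0[of x] conn_sum_nonneg[of k \<Delta> x] \<Delta>0
        conn_sum_nonneg[of k "\<lambda>Y. expansion M E Y * W Y" x] expansion_nonneg W01
      by (auto intro!: add_nonneg_nonneg mult_nonneg_nonneg)
  qed (rule pw)
  also have "\<dots> = (\<integral>x. conn_sum k (\<lambda>Y. expansion M E Y * W Y) x \<partial>M) +
      real D * ((\<integral>x. \<delta> x \<partial>M) + (\<integral>x. conn_sum k \<Delta> x \<partial>M))"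
    using i1 i2 i3 by simp
  also have "\<dots> \<le> (\<integral>x. conn_sum k (\<lambda>Y. expansion M E Y * W Y) x \<partial>M) +
      real D * ((\<integral>x. \<delta> x \<partial>M) + (cbound k * real k) * (\<integral>x. \<delta> x \<partial>M))"
    using \<Delta>int by (intro add_left_mono mult_left_mono) auto
  finally have "(\<integral>Y. expansion M E Y \<partial>?\<tau>) \<le> (\<integral>x. conn_sum k (\<lambda>Y. expansion M E Y * W Y) x \<partial>M) +
      real D * (1 + real k * cbound k) * (\<integral>x. \<delta> x \<partial>M)"
    unfolding cost by (simp add: algebra_simps)
  then show ?thesis using \<tau> unfolding \<delta>_def s_def by blast
qed

end

section \<open>Averaging over types\<close>

lemma integral_finite_range:
  fixes g :: "'t \<Rightarrow> real"
  assumes "finite_measure \<mu>" and T: "T \<in> measurable \<mu> (count_space UNIV)" and fin: "finite (T ` space \<mu>)"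
  shows "(\<integral>Y. g (T Y) \<partial>\<mu>) = (\<Sum>t\<in>T ` space \<mu>. g t * measure \<mu> {Y \<in> space \<mu>. T Y = t})"
proof -
  interpret finite_measure \<mu> by fact
  have [measurable]: "{Y \<in> space \<mu>. T Y = t} \<in> sets \<mu>" for t
    using measurable_sets[OF T, of "{t}"] by (simp add: vimage_def Int_def conj_commute)
  have "g (T Y) = (\<Sum>t\<in>T ` space \<mu>. g t * indicator {Y \<in> space \<mu>. T Y = t} Y)" if "Y \<in> space \<mu>" for Y
  proof -
    have "(\<Sum>t\<in>T ` space \<mu>. g t * indicator {Y \<in> space \<mu>. T Y = t} Y) =
        (\<Sum>t\<in>T ` space \<mu>. if t = T Y then g (T Y) else 0)"
      by (rule sum.cong[OF refl]) (use that in \<open>auto simp: indicator_def\<close>)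
    then show ?thesis using fin that by simp
  qed
  then have "(\<integral>Y. g (T Y) \<partial>\<mu>) = (\<integral>Y. (\<Sum>t\<in>T ` space \<mu>. g t * indicator {Y \<in> space \<mu>. T Y = t} Y) \<partial>\<mu>)"
    by (rule Bochner_Integration.integral_cong[OF refl])
  also have "\<dots> = (\<Sum>t\<in>T ` space \<mu>. \<integral>Y. g t * indicator {Y \<in> space \<mu>. T Y = t} Y \<partial>\<mu>)"
    by (rule Bochner_Integration.integral_sum) (auto intro!: integrable_mult_right integrable_real_indicator simp: emeasure_eq_measure)
  also have "\<dots> = (\<Sum>t\<in>T ` space \<mu>. g t * measure \<mu> {Y \<in> space \<mu>. T Y = t})"
    by (rule sum.cong[OF refl]) simp
  finally show ?thesis .
qed

context graphing
begin

text \<open>\<open>X\<close> is the set of nodes covered by members of \<open>A\<close>. Every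
  member lies inside \<open>X\<close>, so the \<open>\<tau>\<close>-mass of \<open>A\<close> is at
  most the marginal of \<open>X\<close>. This is the measure of \<open>X\<close>, which is at most
  the expected number of members of \<open>A\<close> at a node.\<close>

lemma fractional_partition_le_kappa:
  assumes k: "k \<ge> 1" and \<tau>: "fractional_partition M E k \<tau>" and A: "A \<in> sets (conn_space M E k)"
  shows "emeasure \<tau> A \<le> emeasure (kappa k) A"
proof -
  have sets: "sets \<tau> = sets (conn_space M E k)" and marg: "\<And>X. X \<in> sets M \<Longrightarrow> marginal \<tau> X = emeasure M X"
    using \<tau> by (auto simp: fractional_partition_def)
  have AC: "A \<subseteq> conn_sets M E k" using sets.sets_into_space[OF A] by simp
  define h where "h x = (\<Sum>Y\<in>conn_at M E k x. indicator A Y :: ennreal)" for x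
  have hm[measurable]: "h \<in> borel_measurable M"
    unfolding h_def by (rule conn_sum_measurable[OF k]) (use A in measurable)
  define X where "X = {x \<in> space M. 1 \<le> h x}"
  have X[measurable]: "X \<in> sets M" unfolding X_def by measurable
  have "emeasure \<tau> A = (\<integral>\<^sup>+Y. indicator A Y \<partial>\<tau>)" using A sets by simp
  also have "\<dots> \<le> marginal \<tau> X" unfolding marginal_def
  proof (rule nn_integral_mono)
    fix Y
    show "indicator A Y \<le> ennreal (real (card (X \<inter> Y)) / real (card Y))"
    proof (cases "Y \<in> A")
      case True
      then have Y: "Y \<in> conn_sets M E k" using AC by blast
      have "Y \<subseteq> X"
      proof
        fix x assume x: "x \<in> Y"
        then have xs: "x \<in> space M" using conn_setsD(1)[OF Y] by blast
        have "Y \<in> conn_at M E k x" using Y x by (simp add: conn_at_def)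
        then have "(indicator A Y :: ennreal) \<le> h x" unfolding h_def
          by (rule member_le_sum) (use finite_conn_at[OF xs] in auto)
        then show "x \<in> X" using True xs by (simp add: X_def)
      qed
      then have "X \<inter> Y = Y" by blast
      then show ?thesis using conn_setsD(4)[OF Y] True by simp
    qed simp
  qed
  also have "\<dots> = (\<integral>\<^sup>+x. indicator X x \<partial>M)" using marg[OF X] X by simp
  also have "\<dots> \<le> (\<integral>\<^sup>+x. h x \<partial>M)"
    by (rule nn_integral_mono) (auto simp: X_def indicator_def)
  also have "\<dots> = (\<integral>\<^sup>+Y. indicator A Y \<partial>kappa k)"
    unfolding h_def by (rule nn_integral_kappa[OF k, symmetric]) (use A in measurable)
  also have "\<dots> = emeasure (kappa k) A" using A sets_kappa[OF k] by simp
  finally show ?thesis .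
qed

lemma finite_root_range:
  assumes "\<And>x y. x \<in> space M \<Longrightarrow> y \<in> space M \<Longrightarrow> mtype E {x} r = mtype E {y} r \<Longrightarrow> f x = f y"
  shows "finite (f ` space M)"
proof -
  have "(\<lambda>x. mtype E {x} r) ` space M \<subseteq> (\<lambda>Y. mtype E Y r) ` {Y. Y \<subseteq> space M \<and> finite Y \<and> card Y \<le> 1}"
    by auto
  then have fin: "finite ((\<lambda>x. mtype E {x} r) ` space M)" by (rule finite_subset[OF _ finite_mtypes])
  have "f ` space M \<subseteq> (\<lambda>t. f (SOME x. x \<in> space M \<and> mtype E {x} r = t)) ` (\<lambda>x. mtype E {x} r) ` space M"
  proof (rule image_subsetI)
    fix x assume x: "x \<in> space M"
    let ?z = "SOME z. z \<in> space M \<and> mtype E {z} r = mtype E {x} r"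
    have z: "?z \<in> space M \<and> mtype E {?z} r = mtype E {x} r" by (rule someI[of _ x]) (use x in simp)
    have "f x = f ?z" by (rule assms[OF x conjunct1[OF z] conjunct2[OF z, symmetric]])
    then show "f x \<in> (\<lambda>t. f (SOME x. x \<in> space M \<and> mtype E {x} r = t)) ` (\<lambda>x. mtype E {x} r) ` space M"
      using x by blast
  qed
  then show ?thesis by (rule finite_subset[OF _ finite_imageI[OF fin]])
qed

text \<open>The marginal condition passes from sets to functions by splitting into level sets. With
  a finite range no limit is involved.\<close>

lemma fractional_partition_average:
  fixes \<phi> :: "'a \<Rightarrow> real"
  assumes \<tau>: "fractional_partition M E k \<tau>" and fin: "finite (\<phi> ` space M)"
    and \<phi>[measurable]: "\<phi> \<in> borel_measurable M"
  shows "(\<integral>Y. (\<Sum>x\<in>Y. \<phi> x) / real (card Y) \<partial>\<tau>) = (\<integral>x. \<phi> x \<partial>M)"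
proof -
  have sets: "sets \<tau> = sets (conn_space M E k)" and marg: "\<And>X. X \<in> sets M \<Longrightarrow> marginal \<tau> X = emeasure M X"
    and "prob_space \<tau>"
    using \<tau> by (auto simp: fractional_partition_def)
  interpret \<tau>: prob_space \<tau> by fact
  have sp: "space \<tau> = conn_sets M E k" using sets_eq_imp_space_eq[OF sets] by simp
  let ?L = "\<lambda>c. {x \<in> space M. \<phi> x = c}"
  have L[measurable]: "?L c \<in> sets M" for c by measurable
  define \<alpha> where "\<alpha> c Y = real (card (?L c \<inter> Y)) / real (card Y)" for c Y
  have \<alpha>_sum: "\<alpha> c Y = (\<Sum>x\<in>Y. indicator (?L c) x) / real (card Y)" if "Y \<in> conn_sets M E k" for c Y
    using conn_setsD(2)[OF that] by (simp add: \<alpha>_def indicator_def sum.If_cases Int_commute Int_def conj_commute)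
  have \<alpha>m: "\<alpha> c \<in> borel_measurable \<tau>" for c
  proof -
    have [measurable]: "(\<lambda>Y. \<Sum>x\<in>Y. indicator (?L c) x :: real) \<in> borel_measurable (conn_space M E k)"
      by (rule sum_measurable) measurable
    have "(\<lambda>Y. (\<Sum>x\<in>Y. indicator (?L c) x) / real (card Y)) \<in> borel_measurable (conn_space M E k)"
      by measurable
    then have "\<alpha> c \<in> borel_measurable (conn_space M E k)"
      by (subst measurable_cong[OF \<alpha>_sum]) auto
    then show ?thesis using measurable_cong_sets[OF sets refl] by blast
  qed
  have \<alpha>B: "0 \<le> \<alpha> c Y" "\<alpha> c Y \<le> 1" if "Y \<in> conn_sets M E k" for c Y
  proof -
    have "card (?L c \<inter> Y) \<le> card Y" using conn_setsD(2)[OF that] by (intro card_mono) auto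
    then show "0 \<le> \<alpha> c Y" "\<alpha> c Y \<le> 1" using conn_setsD(4)[OF that] by (auto simp: \<alpha>_def divide_le_eq)
  qed
  have \<alpha>i: "integrable \<tau> (\<alpha> c)" for c
    by (rule \<tau>.integrable_const_bound[of _ 1]) (use \<alpha>m \<alpha>B sp in auto)
  have \<alpha>int: "(\<integral>Y. \<alpha> c Y \<partial>\<tau>) = measure M (?L c)" for c
  proof -
    have "(\<integral>Y. \<alpha> c Y \<partial>\<tau>) = enn2real (\<integral>\<^sup>+Y. ennreal (\<alpha> c Y) \<partial>\<tau>)"
      by (rule integral_eq_nn_integral) (use \<alpha>m \<alpha>B sp in auto)
    also have "(\<integral>\<^sup>+Y. ennreal (\<alpha> c Y) \<partial>\<tau>) = marginal \<tau> (?L c)" by (simp add: marginal_def \<alpha>_def)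
    also have "\<dots> = emeasure M (?L c)" by (rule marg[OF L])
    finally show ?thesis by (simp add: measure_def)
  qed
  have dec: "\<phi> x = (\<Sum>c\<in>\<phi> ` space M. c * indicator (?L c) x)" if "x \<in> space M" for x
  proof -
    have "(\<Sum>c\<in>\<phi> ` space M. c * indicator (?L c) x) = (\<Sum>c\<in>\<phi> ` space M. if c = \<phi> x then \<phi> x else 0)"
      by (rule sum.cong[OF refl]) (use that in \<open>auto simp: indicator_def\<close>)
    then show ?thesis using fin that by simp
  qed
  have "(\<Sum>x\<in>Y. \<phi> x) / real (card Y) = (\<Sum>c\<in>\<phi> ` space M. c * \<alpha> c Y)" if Y: "Y \<in> space \<tau>" for Y
  proof -
    have Yc: "Y \<in> conn_sets M E k" using Y sp by simp
    have "(\<Sum>x\<in>Y. \<phi> x) = (\<Sum>x\<in>Y. \<Sum>c\<in>\<phi> ` space M. c * indicator (?L c) x)"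
      by (rule sum.cong[OF refl]) (use dec conn_setsD(1)[OF Yc] in blast)
    also have "\<dots> = (\<Sum>c\<in>\<phi> ` space M. c * (\<Sum>x\<in>Y. indicator (?L c) x))"
      by (subst sum.swap) (simp add: sum_distrib_left)
    finally have "(\<Sum>x\<in>Y. \<phi> x) / real (card Y) =
        (\<Sum>c\<in>\<phi> ` space M. c * (\<Sum>x\<in>Y. indicator (?L c) x)) / real (card Y)" by (rule arg_cong)
    also have "\<dots> = (\<Sum>c\<in>\<phi> ` space M. c * (\<Sum>x\<in>Y. indicator (?L c) x) / real (card Y))"
      by (rule sum_divide_distrib)
    finally show ?thesis unfolding \<alpha>_sum[OF Yc] by (simp only: times_divide_eq_right)
  qed
  then have "(\<integral>Y. (\<Sum>x\<in>Y. \<phi> x) / real (card Y) \<partial>\<tau>) = (\<integral>Y. (\<Sum>c\<in>\<phi> ` space M. c * \<alpha> c Y) \<partial>\<tau>)"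
    by (rule Bochner_Integration.integral_cong[OF refl])
  also have "\<dots> = (\<Sum>c\<in>\<phi> ` space M. \<integral>Y. c * \<alpha> c Y \<partial>\<tau>)"
    by (rule Bochner_Integration.integral_sum) (use \<alpha>i in auto)
  also have "\<dots> = (\<Sum>c\<in>\<phi> ` space M. c * measure M (?L c))" using \<alpha>int by simp
  also have "\<dots> = (\<Sum>c\<in>\<phi> ` space M. \<integral>x. c * indicator (?L c) x \<partial>M)" using L by simp
  also have "\<dots> = (\<integral>x. (\<Sum>c\<in>\<phi> ` space M. c * indicator (?L c) x) \<partial>M)"
    by (rule Bochner_Integration.integral_sum[symmetric])
      (auto intro!: integrable_mult_right integrable_real_indicator simp: emeasure_eq_measure)
  also have "\<dots> = (\<integral>x. \<phi> x \<partial>M)"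
    by (rule Bochner_Integration.integral_cong[OF refl]) (simp add: dec[symmetric])
  finally show ?thesis .
qed

definition type_weight :: "nat \<Rightarrow> 'a set measure \<Rightarrow> nat \<Rightarrow> (nat set \<times> nat rel \<times> nat set) set \<Rightarrow> real" where
  "type_weight k \<tau> r t = measure \<tau> {Y \<in> conn_sets M E k. mtype E Y r = t} /
     measure (kappa k) {Y \<in> conn_sets M E k. mtype E Y r = t}"

lemma type_sets: "{Y \<in> conn_sets M E k. mtype E Y r = t} \<in> sets (conn_space M E k)"
  using conn_space_mtype_sets[of k r "{t}"] by simp

lemma measure_le_kappa:
  assumes k: "k \<ge> 1" and \<tau>: "fractional_partition M E k \<tau>" and A: "A \<in> sets (conn_space M E k)"
  shows "measure \<tau> A \<le> measure (kappa k) A"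
proof -
  interpret K: finite_measure "kappa k" by (rule finite_measure_kappa[OF k])
  show ?thesis unfolding measure_def
    by (rule enn2real_mono[OF fractional_partition_le_kappa[OF assms]]) (simp add: less_top[symmetric])
qed

lemma type_weight_bounds:
  assumes "k \<ge> 1" and "fractional_partition M E k \<tau>"
  shows "0 \<le> type_weight k \<tau> r t" "type_weight k \<tau> r t \<le> 1"
proof -
  let ?A = "{Y \<in> conn_sets M E k. mtype E Y r = t}"
  have le: "measure \<tau> ?A \<le> measure (kappa k) ?A" by (rule measure_le_kappa[OF assms type_sets])
  have pos: "0 \<le> measure (kappa k) ?A" by (rule measure_nonneg)
  show "0 \<le> type_weight k \<tau> r t"
    unfolding type_weight_def by (rule divide_nonneg_nonneg) (rule measure_nonneg)+
  show "type_weight k \<tau> r t \<le> 1"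
  proof (cases "measure (kappa k) ?A = 0")
    case False
    then have "0 < measure (kappa k) ?A" using pos by linarith
    then show ?thesis unfolding type_weight_def using le by (simp only: divide_le_eq_1_pos)
  qed (simp add: type_weight_def)
qed

text \<open>\<open>type_weight\<close> is the conditional expectation of the density of \<open>\<tau>\<close> with respect to
  \<open>kappa\<close>, given the type of the \<open>r\<close>-neighborhood.\<close>

lemma type_weight_integral:
  assumes k: "k \<ge> 1" and \<tau>: "fractional_partition M E k \<tau>"
    and f: "\<And>Y Y'. Y \<in> conn_sets M E k \<Longrightarrow> Y' \<in> conn_sets M E k \<Longrightarrow> mtype E Y r = mtype E Y' r \<Longrightarrow> f Y = f Y'"
  shows "(\<integral>Y. type_weight k \<tau> r (mtype E Y r) * f Y \<partial>kappa k) = (\<integral>Y. f Y \<partial>\<tau>)"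
proof -
  have sets: "sets \<tau> = sets (conn_space M E k)" and "prob_space \<tau>"
    using \<tau> by (auto simp: fractional_partition_def)
  interpret \<tau>: prob_space \<tau> by fact
  interpret K: finite_measure "kappa k" by (rule finite_measure_kappa[OF k])
  have sp: "space \<tau> = conn_sets M E k" using sets_eq_imp_space_eq[OF sets] by simp
  let ?T = "\<lambda>Y. mtype E Y r" and ?w = "type_weight k \<tau> r"
  let ?A = "\<lambda>t. {Y \<in> conn_sets M E k. mtype E Y r = t}"
  have fin: "finite (?T ` conn_sets M E k)"
    by (rule finite_subset[OF _ finite_mtypes[of r k]]) (auto simp: conn_sets_def)
  have Tk: "?T \<in> measurable (kappa k) (count_space UNIV)"
    unfolding measurable_cong_sets[OF sets_kappa[OF k] refl] by (rule mtype_measurable)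
  have T\<tau>: "?T \<in> measurable \<tau> (count_space UNIV)"
    unfolding measurable_cong_sets[OF sets refl] by (rule mtype_measurable)
  define g where "g t = f (SOME Y. Y \<in> conn_sets M E k \<and> ?T Y = t)" for t
  have g: "g (?T Y) = f Y" if Y: "Y \<in> conn_sets M E k" for Y
  proof -
    let ?Z = "SOME Y'. Y' \<in> conn_sets M E k \<and> mtype E Y' r = mtype E Y r"
    have "?Z \<in> conn_sets M E k \<and> mtype E ?Z r = mtype E Y r" by (rule someI[of _ Y]) (use Y in simp)
    then show ?thesis unfolding g_def using f Y by blast
  qed
  \<comment> \<open>A type of \<open>kappa\<close>-mass 0 has \<open>\<tau>\<close>-mass 0 by
    domination, so the weight 0 that division by 0 assigns to it is consistent.\<close>
  have cancel: "?w t * measure (kappa k) (?A t) = measure \<tau> (?A t)" for t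
  proof (cases "measure (kappa k) (?A t) = 0")
    case True
    then have "measure \<tau> (?A t) = 0"
      using measure_le_kappa[OF k \<tau> type_sets, of r t] measure_nonneg[of \<tau> "?A t"] by linarith
    then show ?thesis using True by simp
  qed (simp add: type_weight_def)
  have "(\<integral>Y. ?w (?T Y) * f Y \<partial>kappa k) = (\<integral>Y. (\<lambda>t. ?w t * g t) (?T Y) \<partial>kappa k)"
    by (rule Bochner_Integration.integral_cong) (use g space_kappa[OF k] in auto)
  also have "\<dots> = (\<Sum>t\<in>?T ` conn_sets M E k. ?w t * g t * measure (kappa k) (?A t))"
    using integral_finite_range[OF K.finite_measure_axioms Tk, of "\<lambda>t. ?w t * g t"] fin
    unfolding space_kappa[OF k] by blast
  also have "\<dots> = (\<Sum>t\<in>?T ` conn_sets M E k. g t * measure \<tau> (?A t))"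
  proof (rule sum.cong[OF refl])
    fix t
    have "?w t * g t * measure (kappa k) (?A t) = g t * (?w t * measure (kappa k) (?A t))" by simp
    then show "?w t * g t * measure (kappa k) (?A t) = g t * measure \<tau> (?A t)" unfolding cancel .
  qed
  also have "\<dots> = (\<integral>Y. g (?T Y) \<partial>\<tau>)"
    using integral_finite_range[OF \<tau>.finite_measure_axioms T\<tau>, of g] fin unfolding sp by simp
  also have "\<dots> = (\<integral>Y. f Y \<partial>\<tau>)"
    by (rule Bochner_Integration.integral_cong) (use g sp in auto)
  finally show ?thesis .
qed

end

section \<open>Convergence of the averaged weights\<close>

lemma abs_le_square_bound: "0 < d \<Longrightarrow> \<bar>u :: real\<bar> \<le> d + u\<^sup>2 / d"
proof -
  assume d: "0 < d"
  have "0 \<le> (\<bar>u\<bar> - d)\<^sup>2" "0 \<le> \<bar>u\<bar> * d" using d by auto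
  then have "\<bar>u\<bar> * d \<le> d\<^sup>2 + u\<^sup>2" by (simp add: power2_diff)
  then have "\<bar>u\<bar> \<le> (d\<^sup>2 + u\<^sup>2) / d" using d by (simp add: pos_le_divide_eq)
  then show ?thesis using d by (simp add: add_divide_distrib power2_eq_square)
qed

context graphing
begin

lemma type_weight_measurable [measurable]:
  "(\<lambda>Y. w (mtype E Y r) :: real) \<in> borel_measurable (conn_space M E k)"
  by (rule measurable_compose[OF mtype_measurable]) simp

text \<open>Pythagoras for martingales. \<open>type_weight_integral\<close> evaluates the mixed
  integral and the square of the coarser weight to the same number, the
  \<open>\<tau>\<close>-integral of the coarser weight.\<close>

lemma type_weight_square_increment:
  assumes k: "k \<ge> 1" and \<tau>: "fractional_partition M E k \<tau>" and qr: "q \<le> r"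
  shows "(\<integral>Y. (type_weight k \<tau> r (mtype E Y r) - type_weight k \<tau> q (mtype E Y q))\<^sup>2 \<partial>kappa k) =
    (\<integral>Y. (type_weight k \<tau> r (mtype E Y r))\<^sup>2 \<partial>kappa k) - (\<integral>Y. (type_weight k \<tau> q (mtype E Y q))\<^sup>2 \<partial>kappa k)"
proof -
  interpret K: finite_measure "kappa k" by (rule finite_measure_kappa[OF k])
  define W where "W r Y = type_weight k \<tau> r (mtype E Y r)" for r Y
  have W01: "0 \<le> W r Y" "W r Y \<le> 1" for r Y
    using type_weight_bounds[OF k \<tau>] by (auto simp: W_def)
  have Wm[measurable]: "W r \<in> borel_measurable (kappa k)" for r
    unfolding W_def measurable_kappa[OF k] by measurable
  have int: "integrable (kappa k) (\<lambda>Y. W r Y * W p Y)" for r p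
    by (rule K.integrable_const_bound[of _ 1]) (use W01 in \<open>auto intro!: mult_le_one simp: abs_mult\<close>)
  have rq: "(\<integral>Y. W r Y * W q Y \<partial>kappa k) = (\<integral>Y. W q Y \<partial>\<tau>)" unfolding W_def
    by (rule type_weight_integral[OF k \<tau>])
      (use mtype_mono[OF graphing_axioms conn_setsD(1,2) _ qr] in metis)
  have qq: "(\<integral>Y. W q Y * W q Y \<partial>kappa k) = (\<integral>Y. W q Y \<partial>\<tau>)" unfolding W_def
    by (rule type_weight_integral[OF k \<tau>]) simp
  have "(\<integral>Y. (W r Y - W q Y)\<^sup>2 \<partial>kappa k) = (\<integral>Y. W r Y * W r Y - 2 * (W r Y * W q Y) + W q Y * W q Y \<partial>kappa k)"
    by (simp add: power2_eq_square algebra_simps)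
  also have "\<dots> = (\<integral>Y. W r Y * W r Y \<partial>kappa k) - 2 * (\<integral>Y. W r Y * W q Y \<partial>kappa k) + (\<integral>Y. W q Y * W q Y \<partial>kappa k)"
    using int by simp
  also have "\<dots> = (\<integral>Y. W r Y * W r Y \<partial>kappa k) - (\<integral>Y. W q Y * W q Y \<partial>kappa k)"
    unfolding rq qq by simp
  finally show ?thesis by (simp add: W_def power2_eq_square)
qed

lemma type_weight_square_bound:
  assumes k: "k \<ge> 1" and \<tau>: "fractional_partition M E k \<tau>"
  shows "(\<integral>Y. (type_weight k \<tau> r (mtype E Y r))\<^sup>2 \<partial>kappa k) \<le> cbound k"
proof -
  interpret K: finite_measure "kappa k" by (rule finite_measure_kappa[OF k])
  have W01: "0 \<le> type_weight k \<tau> r t" "type_weight k \<tau> r t \<le> 1" for t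
    using type_weight_bounds[OF k \<tau>] by auto
  have "(\<integral>Y. (type_weight k \<tau> r (mtype E Y r))\<^sup>2 \<partial>kappa k) \<le> (\<integral>Y. 1 \<partial>kappa k)"
    by (rule integral_mono') (use W01 in \<open>auto simp: power_le_one\<close>)
  also have "\<dots> = measure (kappa k) (space (kappa k))" by simp
  also have "\<dots> \<le> cbound k"
    unfolding measure_def using emeasure_kappa_space[OF k] cbound_ge_1[of k]
    by (metis enn2real_ennreal enn2real_mono ennreal_less_top order_trans zero_le_one)
  finally show ?thesis .
qed

text \<open>The squared norms increase and are bounded, so past a radius where they are within
  \<open>d\<close> of their supremum every increment is at most \<open>d\<close>. The maximum with 1
  is taken for the sake of \<open>mtype_expansion\<close>.\<close>

lemma type_weight_converges:
  assumes k: "k \<ge> 1" and \<tau>: "fractional_partition M E k \<tau>" and d: "d > 0"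
  shows "\<exists>q\<ge>1. \<forall>r\<ge>q. (\<integral>Y. (type_weight k \<tau> r (mtype E Y r) - type_weight k \<tau> q (mtype E Y q))\<^sup>2 \<partial>kappa k) \<le> d"
proof -
  define a where "a r = (\<integral>Y. (type_weight k \<tau> r (mtype E Y r))\<^sup>2 \<partial>kappa k)" for r
  have inc: "(\<integral>Y. (type_weight k \<tau> r (mtype E Y r) - type_weight k \<tau> q (mtype E Y q))\<^sup>2 \<partial>kappa k) = a r - a q"
    if "q \<le> r" for q r
    unfolding a_def by (rule type_weight_square_increment[OF k \<tau> that])
  have mono: "a q \<le> a r" if "q \<le> r" for q r
  proof -
    have "0 \<le> (\<integral>Y. (type_weight k \<tau> r (mtype E Y r) - type_weight k \<tau> q (mtype E Y q))\<^sup>2 \<partial>kappa k)"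
      by (rule Bochner_Integration.integral_nonneg) simp
    then show ?thesis using inc[OF that] by simp
  qed
  have bdd: "bdd_above (range a)"
    by (rule bdd_aboveI[of _ "cbound k"]) (use type_weight_square_bound[OF k \<tau>] in \<open>auto simp: a_def\<close>)
  have "(SUP r. a r) - d < (SUP r. a r)" using d by simp
  then obtain q0 where q0: "(SUP r. a r) - d < a q0" using less_cSUP_iff[OF _ bdd] by auto
  have "a r - a (max q0 1) \<le> d" if "r \<ge> max q0 1" for r
    using cSUP_upper[OF _ bdd, of r] mono[of q0 "max q0 1"] q0 by auto
  then show ?thesis using inc by (intro exI[of _ "max q0 1"]) auto
qed

text \<open>The part of the marginal condition that survives averaging. Since
  \<open>p \<le> r\<close>, the mean of \<open>\<phi>\<close> over \<open>Y\<close> depends only on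
  the \<open>r\<close>-type of \<open>Y\<close>, so its integral does not change when
  \<open>\<tau>\<close> is averaged over \<open>r\<close>-types.\<close>

lemma local_test:
  assumes k: "k \<ge> 1" and \<tau>: "fractional_partition M E k \<tau>" and pr: "p \<le> r"
    and \<phi>: "\<And>x y. x \<in> space M \<Longrightarrow> y \<in> space M \<Longrightarrow> mtype E {x} p = mtype E {y} p \<Longrightarrow> \<phi> x = \<phi> y"
    and \<phi>0: "\<And>x. x \<in> space M \<Longrightarrow> 0 \<le> \<phi> x"
  shows "(\<integral>x. \<phi> x * conn_sum k (\<lambda>Y. type_weight k \<tau> r (mtype E Y r)) x \<partial>M) = (\<integral>x. \<phi> x \<partial>M)"
proof -
  have \<phi>m: "\<phi> \<in> borel_measurable M" by (rule root_mtype_function_measurable[OF \<phi>])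
  have fin: "finite (\<phi> ` space M)" by (rule finite_root_range[OF \<phi>])
  have "(\<integral>x. \<phi> x * conn_sum k (\<lambda>Y. type_weight k \<tau> r (mtype E Y r)) x \<partial>M) =
      (\<integral>Y. type_weight k \<tau> r (mtype E Y r) * ((\<Sum>x\<in>Y. \<phi> x) / real (card Y)) \<partial>kappa k)"
    by (rule integral_kappa_transport[OF k \<phi>m type_weight_measurable \<phi>0 type_weight_bounds(1)[OF k \<tau>]])
  also have "\<dots> = (\<integral>Y. (\<Sum>x\<in>Y. \<phi> x) / real (card Y) \<partial>\<tau>)"
  proof (rule type_weight_integral[OF k \<tau>])
    fix Y Y' assume Y: "Y \<in> conn_sets M E k" "Y' \<in> conn_sets M E k" and eq: "mtype E Y r = mtype E Y' r"
    have "(\<Sum>x\<in>Y. \<phi> x) = (\<Sum>x\<in>Y'. \<phi> x)"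
    proof (rule mtype_sum[OF graphing_axioms conn_setsD(1,2)[OF Y(1)] eq pr])
      fix x y assume "x \<in> Y" "y \<in> Y'" "mtype E {x} p = mtype E {y} p"
      then show "\<phi> x = \<phi> y" using \<phi> conn_setsD(1)[OF Y(1)] conn_setsD(1)[OF Y(2)] by blast
    qed
    moreover have "card Y = card Y'" by (rule mtype_card[OF graphing_axioms conn_setsD(1,2)[OF Y(1)] eq])
    ultimately show "(\<Sum>x\<in>Y. \<phi> x) / real (card Y) = (\<Sum>x\<in>Y'. \<phi> x) / real (card Y')" by simp
  qed
  also have "\<dots> = (\<integral>x. \<phi> x \<partial>M)" by (rule fractional_partition_average[OF \<tau> fin \<phi>m])
  finally show ?thesis .
qed

lemma local_sum_self:
  assumes "x \<in> space M" "y \<in> space M" "mtype E {x} (k * k + q) = mtype E {y} (k * k + q)"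
  shows "conn_sum k (\<lambda>Y. w (mtype E Y q)) x = conn_sum k (\<lambda>Y. w (mtype E Y q)) y"
  by (rule local_sum_eq[OF graphing_axioms graphing_axioms assms order_refl]) simp

text \<open>The radius \<open>k * k + q\<close> is the one on which \<open>s q\<close> depends, so
  \<open>s q\<close> is an admissible test function for \<open>s r\<close>. The outer
  \<open>cbound k\<close> bounds \<open>s q\<close>. The bracket bounds the L1 distance of the
  weights, which \<open>abs_le_square_bound\<close> derives from their squared distance
  \<open>e\<close>, with \<open>cbound k\<close> for the mass of \<open>kappa\<close>.\<close>

lemma type_weight_sum_variance:
  assumes k: "k \<ge> 1" and \<tau>: "fractional_partition M E k \<tau>" and d: "d > 0"
    and conv: "(\<integral>Y. (type_weight k \<tau> (k * k + q) (mtype E Y (k * k + q)) - type_weight k \<tau> q (mtype E Y q))\<^sup>2 \<partial>kappa k) \<le> e"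
  shows "(\<integral>x. (conn_sum k (\<lambda>Y. type_weight k \<tau> q (mtype E Y q)) x - 1)\<^sup>2 \<partial>M) \<le> cbound k * (d * cbound k + e / d)"
proof -
  interpret K: finite_measure "kappa k" by (rule finite_measure_kappa[OF k])
  define r where "r = k * k + q"
  define W where "W r Y = type_weight k \<tau> r (mtype E Y r)" for r Y
  define s where "s r = conn_sum k (W r)" for r
  have W01: "0 \<le> W r Y" "W r Y \<le> 1" for r Y
    using type_weight_bounds[OF k \<tau>] by (auto simp: W_def)
  have Wm[measurable]: "W r \<in> borel_measurable (conn_space M E k)" for r unfolding W_def by measurable
  have sm[measurable]: "s r \<in> borel_measurable M" for r
    unfolding s_def by (rule conn_sum_measurable_real[OF k Wm W01(1)])
  have s0: "0 \<le> s r x" for r x unfolding s_def by (rule conn_sum_nonneg[OF W01(1)])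
  have sB: "s r x \<le> cbound k" if "x \<in> space M" for r x
    using conn_sum_bound[OF that, of k "W r" 1] W01(2) by (simp add: s_def)
  have sloc: "s q x = s q y" if "x \<in> space M" "y \<in> space M" "mtype E {x} r = mtype E {y} r" for x y
    using local_sum_self[OF that[unfolded r_def]] by (simp add: s_def W_def)
  have t1: "(\<integral>x. s q x * s r x \<partial>M) = (\<integral>x. s q x \<partial>M)"
    using local_test[OF k \<tau> order_refl sloc s0] by (simp add: s_def W_def)
  have t2: "(\<integral>x. s q x \<partial>M) = 1"
    using local_test[OF k \<tau> order_refl[of q], where \<phi> = "\<lambda>_. 1"] by (simp add: s_def W_def prob_space)
  have ssB: "\<bar>s p x * s p' x\<bar> \<le> cbound k * cbound k" if "x \<in> space M" for p p' x
    using mult_mono[OF sB[OF that, of p] sB[OF that, of p']] s0 cbound_ge_1[of k] by (simp add: abs_mult)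
  have si: "integrable M (s p)" for p
    by (rule bounded_integrable[OF sm, where B = "cbound k"]) (use s0 sB in auto)
  have ssi: "integrable M (\<lambda>x. s p x * s p' x)" for p p'
    by (rule bounded_integrable[OF _ ssB]) measurable
  have "(\<integral>x. (s q x - 1)\<^sup>2 \<partial>M) = (\<integral>x. s q x * s q x - 2 * s q x + 1 \<partial>M)"
    by (simp add: power2_eq_square algebra_simps)
  also have "\<dots> = (\<integral>x. s q x * s q x \<partial>M) - 2 * (\<integral>x. s q x \<partial>M) + 1"
    using si ssi by (simp add: prob_space)
  also have "\<dots> = (\<integral>x. s q x * s q x \<partial>M) - (\<integral>x. s q x * s r x \<partial>M)" unfolding t1 t2 by simp
  also have "\<dots> = (\<integral>x. s q x * s q x - s q x * s r x \<partial>M)" using ssi by simp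
  also have "\<dots> \<le> (\<integral>x. cbound k * conn_sum k (\<lambda>Y. \<bar>W r Y - W q Y\<bar>) x \<partial>M)"
  proof (rule integral_mono)
    have ab: "\<bar>W r Y - W q Y\<bar> \<le> 1" for Y using W01[of r Y] W01[of q Y] by linarith
    have "conn_sum k (\<lambda>Y. \<bar>W r Y - W q Y\<bar>) \<in> borel_measurable M"
      by (rule conn_sum_measurable_real[OF k]) auto
    moreover have "\<bar>conn_sum k (\<lambda>Y. \<bar>W r Y - W q Y\<bar>) x\<bar> \<le> cbound k" if "x \<in> space M" for x
      using conn_sum_bound[OF that, of k "\<lambda>Y. \<bar>W r Y - W q Y\<bar>" 1] ab
        conn_sum_nonneg[of k "\<lambda>Y. \<bar>W r Y - W q Y\<bar>" x] by simp
    ultimately have "integrable M (conn_sum k (\<lambda>Y. \<bar>W r Y - W q Y\<bar>))" by (rule bounded_integrable)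
    then show "integrable M (\<lambda>x. cbound k * conn_sum k (\<lambda>Y. \<bar>W r Y - W q Y\<bar>) x)" by simp
    fix x assume x: "x \<in> space M"
    have "s q x - s r x = (\<Sum>Y\<in>conn_at M E k x. W q Y - W r Y)" by (simp add: s_def sum_subtractf)
    also have "\<dots> \<le> conn_sum k (\<lambda>Y. \<bar>W r Y - W q Y\<bar>) x" by (rule sum_mono) simp
    finally have diff: "s q x - s r x \<le> conn_sum k (\<lambda>Y. \<bar>W r Y - W q Y\<bar>) x" .
    have "s q x * s q x - s q x * s r x = s q x * (s q x - s r x)" by (simp add: algebra_simps)
    also have "\<dots> \<le> s q x * conn_sum k (\<lambda>Y. \<bar>W r Y - W q Y\<bar>) x" using diff s0 by (rule mult_left_mono)
    also have "\<dots> \<le> cbound k * conn_sum k (\<lambda>Y. \<bar>W r Y - W q Y\<bar>) x"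
      using sB[OF x] by (intro mult_right_mono sum_nonneg) auto
    finally show "s q x * s q x - s q x * s r x \<le> cbound k * conn_sum k (\<lambda>Y. \<bar>W r Y - W q Y\<bar>) x" .
  qed (use ssi in simp)
  also have "\<dots> = cbound k * (\<integral>Y. \<bar>W r Y - W q Y\<bar> \<partial>kappa k)"
    by (subst integral_kappa[OF k]) auto
  also have "\<dots> \<le> cbound k * (d * cbound k + e / d)"
  proof (rule mult_left_mono)
    have Wk[measurable]: "W r \<in> borel_measurable (kappa k)" for r using Wm unfolding measurable_kappa[OF k] .
    have i2: "integrable (kappa k) (\<lambda>Y. (W r Y - W q Y)\<^sup>2)"
    proof (rule K.integrable_const_bound[of _ 1])
      have "(W r Y - W q Y)\<^sup>2 \<le> 1" for Y
        using W01[of r Y] W01[of q Y] by (simp add: abs_square_le_1)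
      then show "AE Y in kappa k. norm ((W r Y - W q Y)\<^sup>2) \<le> 1" by simp
    qed measurable
    have i3: "integrable (kappa k) (\<lambda>Y. d + (W r Y - W q Y)\<^sup>2 / d)" using i2 by simp
    have "(\<integral>Y. \<bar>W r Y - W q Y\<bar> \<partial>kappa k) \<le> (\<integral>Y. d + (W r Y - W q Y)\<^sup>2 / d \<partial>kappa k)"
      by (rule integral_mono'[OF i3]) (use abs_le_square_bound[OF d] d in auto)
    also have "\<dots> = d * measure (kappa k) (space (kappa k)) + (\<integral>Y. (W r Y - W q Y)\<^sup>2 \<partial>kappa k) / d"
      using i2 by simp
    also have "\<dots> \<le> d * cbound k + e / d"
    proof (rule add_mono)
      have "measure (kappa k) (space (kappa k)) \<le> cbound k"
        unfolding measure_def using emeasure_kappa_space[OF k] cbound_ge_1[of k]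
        by (metis enn2real_ennreal enn2real_mono ennreal_less_top order_trans zero_le_one)
      then show "d * measure (kappa k) (space (kappa k)) \<le> d * cbound k" using d by (intro mult_left_mono) auto
      show "(\<integral>Y. (W r Y - W q Y)\<^sup>2 \<partial>kappa k) / d \<le> e / d"
        using conv d unfolding W_def r_def by (intro divide_right_mono) auto
    qed
    finally show "(\<integral>Y. \<bar>W r Y - W q Y\<bar> \<partial>kappa k) \<le> d * cbound k + e / d" .
  qed (use cbound_ge_1[of k] in simp)
  finally show ?thesis unfolding s_def W_def .
qed

text \<open>By the projection property of \<open>type_weight\<close>, the deviation of its sums from \<open>1\<close> is
  orthogonal to all later ones, so it tends to \<open>0\<close> in mean square as the radius grows.\<close>

lemma local_approximation:
  assumes k: "k \<ge> 1" and \<tau>: "fractional_partition M E k \<tau>" and \<epsilon>: "\<epsilon> > 0"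
  shows "\<exists>q\<ge>1. (\<integral>x. \<bar>conn_sum k (\<lambda>Y. type_weight k \<tau> q (mtype E Y q)) x - 1\<bar> \<partial>M) \<le> \<epsilon> \<and>
    (\<integral>x. conn_sum k (\<lambda>Y. expansion M E Y * type_weight k \<tau> q (mtype E Y q)) x \<partial>M) = (\<integral>Y. expansion M E Y \<partial>\<tau>)"
proof -
  define \<eta> where "\<eta> = \<epsilon> / 2"
  define c where "c = cbound k"
  have \<eta>: "\<eta> > 0" using \<epsilon> by (simp add: \<eta>_def)
  have c: "c > 0" using cbound_ge_1[of k] by (simp add: c_def)
  \<comment> \<open>\<open>d\<close> and \<open>e\<close> are chosen so that the two terms of the
    variance bound are \<open>\<eta>\<^sup>2 / 2\<close> each. The variance
    \<open>\<eta>\<^sup>2\<close> then gives the L1 bound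
    \<open>\<eta> + \<eta>\<^sup>2 / \<eta> = \<epsilon>\<close>.\<close>
  define d where "d = \<eta>\<^sup>2 / (2 * c * c)"
  define e where "e = d * \<eta>\<^sup>2 / (2 * c)"
  have d: "d > 0" using \<eta> c by (simp add: d_def)
  have e: "e > 0" using \<eta> c d by (simp add: e_def)
  have sum: "c * (d * c + e / d) = \<eta>\<^sup>2"
  proof -
    have "c * (d * c) = \<eta>\<^sup>2 / 2" using c by (simp add: d_def)
    moreover have "c * (e / d) = \<eta>\<^sup>2 / 2" using c d by (simp add: e_def)
    ultimately show ?thesis by (simp only: distrib_left field_sum_of_halves)
  qed
  obtain q where q: "q \<ge> 1" "\<And>r. r \<ge> q \<Longrightarrow>
      (\<integral>Y. (type_weight k \<tau> r (mtype E Y r) - type_weight k \<tau> q (mtype E Y q))\<^sup>2 \<partial>kappa k) \<le> e"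
    using type_weight_converges[OF k \<tau> e] by blast
  define s where "s = conn_sum k (\<lambda>Y. type_weight k \<tau> q (mtype E Y q))"
  have w01: "0 \<le> type_weight k \<tau> q t" "type_weight k \<tau> q t \<le> 1" for t
    using type_weight_bounds[OF k \<tau>] by auto
  have sm[measurable]: "s \<in> borel_measurable M"
    unfolding s_def by (rule conn_sum_measurable_real[OF k type_weight_measurable w01(1)])
  have s0: "0 \<le> s x" for x unfolding s_def by (rule conn_sum_nonneg[OF w01(1)])
  have sB: "s x \<le> c" if "x \<in> space M" for x
    using conn_sum_bound[OF that, of k "\<lambda>Y. type_weight k \<tau> q (mtype E Y q)" 1] w01(2) by (simp add: s_def c_def)
  have "(\<integral>x. (s x - 1)\<^sup>2 \<partial>M) \<le> cbound k * (d * cbound k + e / d)"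
    unfolding s_def by (rule type_weight_sum_variance[OF k \<tau> d q(2)]) simp
  then have var: "(\<integral>x. (s x - 1)\<^sup>2 \<partial>M) \<le> \<eta>\<^sup>2" using sum by (simp add: c_def)
  have i2: "integrable M (\<lambda>x. (s x - 1)\<^sup>2)"
  proof (rule bounded_integrable[where B = "(c + 1)\<^sup>2"])
    fix x assume x: "x \<in> space M"
    have "\<bar>s x - 1\<bar> \<le> c + 1" using s0[of x] sB[OF x] by linarith
    then show "\<bar>(s x - 1)\<^sup>2\<bar> \<le> (c + 1)\<^sup>2" using abs_le_square_iff[of "s x - 1" "c + 1"] c by simp
  qed measurable
  have "(\<integral>x. \<bar>s x - 1\<bar> \<partial>M) \<le> (\<integral>x. \<eta> + (s x - 1)\<^sup>2 / \<eta> \<partial>M)"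
    by (rule integral_mono') (use i2 abs_le_square_bound[OF \<eta>] \<eta> in auto)
  also have "\<dots> = \<eta> + (\<integral>x. (s x - 1)\<^sup>2 \<partial>M) / \<eta>" using i2 by (simp add: prob_space)
  also have "\<dots> \<le> \<eta> + \<eta>\<^sup>2 / \<eta>" using var \<eta> by (intro add_left_mono divide_right_mono) auto
  also have "\<dots> = \<epsilon>" using \<eta> by (simp add: power2_eq_square \<eta>_def)
  finally have 1: "(\<integral>x. \<bar>s x - 1\<bar> \<partial>M) \<le> \<epsilon>" .
  have "(\<integral>x. conn_sum k (\<lambda>Y. type_weight k \<tau> q (mtype E Y q) * expansion M E Y) x \<partial>M) =
      (\<integral>Y. type_weight k \<tau> q (mtype E Y q) * expansion M E Y \<partial>kappa k)"
    by (rule integral_kappa[OF k, symmetric]) (use w01 expansion_nonneg in \<open>auto intro!: mult_nonneg_nonneg\<close>)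
  also have "\<dots> = (\<integral>Y. expansion M E Y \<partial>\<tau>)"
  proof (rule type_weight_integral[OF k \<tau>])
    fix Y Y' assume Y: "Y \<in> conn_sets M E k" and eq: "mtype E Y q = mtype E Y' q"
    show "expansion M E Y = expansion M E Y'"
      by (rule mtype_expansion[OF graphing_axioms graphing_axioms conn_setsD(1,2)[OF Y] eq q(1)])
  qed
  finally have 2: "(\<integral>x. conn_sum k (\<lambda>Y. expansion M E Y * type_weight k \<tau> q (mtype E Y q)) x \<partial>M) = (\<integral>Y. expansion M E Y \<partial>\<tau>)"
    by (simp add: mult.commute)
  show ?thesis using q(1) 1 2 unfolding s_def by blast
qed

end

section \<open>Transfer between locally equivalent graphings\<close>

lemma fractional_partition_transfer:
  assumes k: "k \<ge> 1" and G1: "graphing D M1 E1" and G2: "graphing D M2 E2"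
    and le: "locally_equivalent M1 E1 M2 E2" and \<tau>: "fractional_partition M1 E1 k \<tau>" and \<epsilon>: "\<epsilon> > 0"
  shows "\<exists>\<tau>'. fractional_partition M2 E2 k \<tau>' \<and>
    (\<integral>Y. expansion M2 E2 Y \<partial>\<tau>') \<le> (\<integral>Y. expansion M1 E1 Y \<partial>\<tau>) + \<epsilon>"
proof -
  interpret g1: graphing D M1 E1 by fact
  interpret g2: graphing D M2 E2 by fact
  \<comment> \<open>The factor by which \<open>fractional_partition_repair\<close> multiplies the
    defect in the second graphing. It can be 0, so the accuracy asked for in the first graphing is
    \<open>\<epsilon> / (C + 1)\<close>.\<close>
  define C where "C = real D * (1 + real k * g2.cbound k)"
  have C0: "0 \<le> C" using g2.cbound_ge_1[of k] by (simp add: C_def)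
  have "0 < \<epsilon> / (C + 1)" using \<epsilon> C0 by simp
  from g1.local_approximation[OF k \<tau> this] obtain q where q: "q \<ge> 1"
    and near: "(\<integral>x. \<bar>g1.conn_sum k (\<lambda>Y. g1.type_weight k \<tau> q (mtype E1 Y q)) x - 1\<bar> \<partial>M1) \<le> \<epsilon> / (C + 1)"
    and cost: "(\<integral>x. g1.conn_sum k (\<lambda>Y. expansion M1 E1 Y * g1.type_weight k \<tau> q (mtype E1 Y q)) x \<partial>M1) =
      (\<integral>Y. expansion M1 E1 Y \<partial>\<tau>)" by blast
  define w where "w = g1.type_weight k \<tau> q"
  have w01: "0 \<le> w t \<and> w t \<le> 1" for t using g1.type_weight_bounds[OF k \<tau>] by (simp add: w_def)
  \<comment> \<open>The weight \<open>w\<close> is a function of abstract types, so it makes sense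
    in the second graphing too, and the defect at a node depends only on the ball of radius
    \<open>k * k + q\<close>.\<close>
  have near2: "(\<integral>x. \<bar>g1.conn_sum k (\<lambda>Y. w (mtype E1 Y q)) x - 1\<bar> \<partial>M1) =
      (\<integral>x. \<bar>g2.conn_sum k (\<lambda>Y. w (mtype E2 Y q)) x - 1\<bar> \<partial>M2)"
  proof (rule local_integral_eq[OF G1 G2 le, where r = "k * k + q"])
    fix x y assume "x \<in> space M1" "y \<in> space M2" "mtype E1 {x} (k * k + q) = mtype E2 {y} (k * k + q)"
    from local_sum_eq[OF G1 G2 this order_refl,
        where ?F1.0 = "\<lambda>Y. w (mtype E1 Y q)" and ?F2.0 = "\<lambda>Y. w (mtype E2 Y q)"]
    show "\<bar>g1.conn_sum k (\<lambda>Y. w (mtype E1 Y q)) x - 1\<bar> = \<bar>g2.conn_sum k (\<lambda>Y. w (mtype E2 Y q)) y - 1\<bar>" by simp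
  next
    fix x y assume "x \<in> space M1" "y \<in> space M1" "mtype E1 {x} (k * k + q) = mtype E1 {y} (k * k + q)"
    from g1.local_sum_self[OF this, of w]
    show "\<bar>g1.conn_sum k (\<lambda>Y. w (mtype E1 Y q)) x - 1\<bar> = \<bar>g1.conn_sum k (\<lambda>Y. w (mtype E1 Y q)) y - 1\<bar>" by simp
  next
    fix x y assume "x \<in> space M2" "y \<in> space M2" "mtype E2 {x} (k * k + q) = mtype E2 {y} (k * k + q)"
    from g2.local_sum_self[OF this, of w]
    show "\<bar>g2.conn_sum k (\<lambda>Y. w (mtype E2 Y q)) x - 1\<bar> = \<bar>g2.conn_sum k (\<lambda>Y. w (mtype E2 Y q)) y - 1\<bar>" by simp
  qed
  have c12: "expansion M1 E1 Y * w (mtype E1 Y q) = expansion M2 E2 Y' * w (mtype E2 Y' q)"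
    if "Y \<in> conn_sets M1 E1 k" "Y' \<in> conn_sets M2 E2 k" "mtype E1 Y q = mtype E2 Y' q" for Y Y'
    using mtype_expansion[OF G1 G2 g1.conn_setsD(1,2)[OF that(1)] that(3) q] unfolding that(3) by simp
  have c11: "expansion M1 E1 Y * w (mtype E1 Y q) = expansion M1 E1 Y' * w (mtype E1 Y' q)"
    if "Y \<in> conn_sets M1 E1 k" "Y' \<in> conn_sets M1 E1 k" "mtype E1 Y q = mtype E1 Y' q" for Y Y'
    using mtype_expansion[OF G1 G1 g1.conn_setsD(1,2)[OF that(1)] that(3) q] unfolding that(3) by simp
  have c22: "expansion M2 E2 Y * w (mtype E2 Y q) = expansion M2 E2 Y' * w (mtype E2 Y' q)"
    if "Y \<in> conn_sets M2 E2 k" "Y' \<in> conn_sets M2 E2 k" "mtype E2 Y q = mtype E2 Y' q" for Y Y'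
    using mtype_expansion[OF G2 G2 g2.conn_setsD(1,2)[OF that(1)] that(3) q] unfolding that(3) by simp
  have cost2: "(\<integral>x. g1.conn_sum k (\<lambda>Y. expansion M1 E1 Y * w (mtype E1 Y q)) x \<partial>M1) =
      (\<integral>x. g2.conn_sum k (\<lambda>Y. expansion M2 E2 Y * w (mtype E2 Y q)) x \<partial>M2)"
  proof (rule local_integral_eq[OF G1 G2 le, where r = "k * k + q"])
    fix x y assume "x \<in> space M1" "y \<in> space M2" "mtype E1 {x} (k * k + q) = mtype E2 {y} (k * k + q)"
    then show "g1.conn_sum k (\<lambda>Y. expansion M1 E1 Y * w (mtype E1 Y q)) x =
        g2.conn_sum k (\<lambda>Y. expansion M2 E2 Y * w (mtype E2 Y q)) y"
      by (rule local_sum_eq[OF G1 G2 _ _ _ order_refl]) (rule c12)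
  next
    fix x y assume "x \<in> space M1" "y \<in> space M1" "mtype E1 {x} (k * k + q) = mtype E1 {y} (k * k + q)"
    then show "g1.conn_sum k (\<lambda>Y. expansion M1 E1 Y * w (mtype E1 Y q)) x =
        g1.conn_sum k (\<lambda>Y. expansion M1 E1 Y * w (mtype E1 Y q)) y"
      by (rule local_sum_eq[OF G1 G1 _ _ _ order_refl]) (rule c11)
  next
    fix x y assume "x \<in> space M2" "y \<in> space M2" "mtype E2 {x} (k * k + q) = mtype E2 {y} (k * k + q)"
    then show "g2.conn_sum k (\<lambda>Y. expansion M2 E2 Y * w (mtype E2 Y q)) x =
        g2.conn_sum k (\<lambda>Y. expansion M2 E2 Y * w (mtype E2 Y q)) y"
      by (rule local_sum_eq[OF G2 G2 _ _ _ order_refl]) (rule c22)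
  qed
  obtain \<tau>' where \<tau>': "fractional_partition M2 E2 k \<tau>'"
    and bound: "(\<integral>Y. expansion M2 E2 Y \<partial>\<tau>') \<le>
      (\<integral>x. g2.conn_sum k (\<lambda>Y. expansion M2 E2 Y * w (mtype E2 Y q)) x \<partial>M2) +
      C * (\<integral>x. \<bar>g2.conn_sum k (\<lambda>Y. w (mtype E2 Y q)) x - 1\<bar> \<partial>M2)"
    using g2.fractional_partition_repair[where W = "\<lambda>Y. w (mtype E2 Y q)", OF k g2.type_weight_measurable w01]
    unfolding C_def by blast
  have "C * (\<integral>x. \<bar>g2.conn_sum k (\<lambda>Y. w (mtype E2 Y q)) x - 1\<bar> \<partial>M2) \<le> C * (\<epsilon> / (C + 1))"
    using near[folded w_def, unfolded near2] C0 by (rule mult_left_mono)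
  also have "\<dots> \<le> \<epsilon>" using C0 \<epsilon> by (simp add: pos_divide_le_eq field_simps)
  finally have "(\<integral>Y. expansion M2 E2 Y \<partial>\<tau>') \<le> (\<integral>Y. expansion M1 E1 Y \<partial>\<tau>) + \<epsilon>"
    using bound cost[folded w_def] cost2 by linarith
  then show ?thesis using \<tau>' by blast
qed

lemma expansion_integral_nonneg: "0 \<le> (\<integral>Y. expansion M E Y \<partial>\<tau>)"
  by (rule Bochner_Integration.integral_nonneg) (simp add: expansion_def)

text \<open>\<open>ne\<close> guards against the infimum of the empty set of reals, which bounds
  nothing.\<close>

lemma sep_star_le:
  assumes k: "k \<ge> 1" and G1: "graphing D M1 E1" and G2: "graphing D M2 E2"
    and le: "locally_equivalent M1 E1 M2 E2" and ne: "\<exists>\<tau>. fractional_partition M1 E1 k \<tau>"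
  shows "sep_star k M2 E2 \<le> sep_star k M1 E1"
proof -
  let ?c1 = "\<lambda>\<tau>. \<integral>Y. expansion M1 E1 Y \<partial>\<tau>" and ?c2 = "\<lambda>\<tau>. \<integral>Y. expansion M2 E2 Y \<partial>\<tau>"
  let ?S1 = "{\<tau>. fractional_partition M1 E1 k \<tau>}" and ?S2 = "{\<tau>. fractional_partition M2 E2 k \<tau>}"
  have bdd: "bdd_below (?c2 ` ?S2)" by (rule bdd_belowI[of _ 0]) (auto simp: expansion_integral_nonneg)
  have "(INF \<tau>\<in>?S2. ?c2 \<tau>) \<le> (INF \<tau>\<in>?S1. ?c1 \<tau>)"
  proof (rule cINF_greatest)
    show "?S1 \<noteq> {}" using ne by blast
    fix \<tau> assume \<tau>: "\<tau> \<in> ?S1"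
    show "(INF \<tau>\<in>?S2. ?c2 \<tau>) \<le> ?c1 \<tau>"
    proof (rule field_le_epsilon)
      fix e :: real assume "0 < e"
      then obtain \<tau>' where "\<tau>' \<in> ?S2" "?c2 \<tau>' \<le> ?c1 \<tau> + e"
        using fractional_partition_transfer[OF k G1 G2 le _ \<open>0 < e\<close>, of \<tau>] \<tau> by blast
      then show "(INF \<tau>\<in>?S2. ?c2 \<tau>) \<le> ?c1 \<tau> + e" using cINF_lower[OF bdd, of \<tau>'] by linarith
    qed
  qed
  then show ?thesis by (simp add: sep_star_def)
qed

theorem theorem11:
  fixes D k :: nat
    and M1 :: "'a measure" and E1 :: "'a rel"
    and M2 :: "'b measure" and E2 :: "'b rel"
  assumes "D \<ge> 1" and "k \<ge> 1"
    and "graphing D M1 E1" and "graphing D M2 E2"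
    and "locally_equivalent M1 E1 M2 E2"
  shows "sep_star k M1 E1 = sep_star k M2 E2"
proof -
  have le': "locally_equivalent M2 E2 M1 E1" using assms(5) by (simp add: locally_equivalent_def)
  show ?thesis
  proof (cases "\<exists>\<tau>. fractional_partition M1 E1 k \<tau>")
    case True
    then have "\<exists>\<tau>. fractional_partition M2 E2 k \<tau>"
      using fractional_partition_transfer[OF assms(2-5), of _ 1] by auto
    then show ?thesis
      using sep_star_le[OF assms(2-5) True] sep_star_le[OF assms(2,4,3) le'] by simp
  next
    \<comment> \<open>Both infima are then taken over the empty set and are the same real
      number.\<close>
    case False
    then have "\<nexists>\<tau>. fractional_partition M2 E2 k \<tau>"
      using fractional_partition_transfer[OF assms(2,4,3) le', of _ 1] by auto
    then show ?thesis using False by (simp add: sep_star_def)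
  qed
qed

end
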